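(* The equivalence between $\mathbf{MT_R}$ (MT-algebras and Raney morphisms) and $\mathbf{RE}$ (Raney extensions and their morphisms) given by the functors $\mathsf{R}:\mathbf{MT_R}\to\mathbf{RE}$ and $\mathcal{F}:\mathbf{RE}\to\mathbf{MT_R}$ restricts to an equivalence between the full subcategory $\mathbf{T0\,MT_R}$ of $\mathbf{MT_R}$ consisting of $T_0$-algebras and $\mathbf{RE}$. Consequently, the reflector $\mathcal{F}\mathsf{R}:\mathbf{MT_R}\to\mathbf{T0\,MT_R}$ is an equivalence.
   Context: A frame is a complete lattice with $a\wedge\bigvee S=\bigvee\{a\wedge s\mid s\in S\}$ for all elements $a$ and subsets $S$; a coframe is the order-dual notion. Frame morphisms preserve arbitrary joins and finite meets; coframe morphisms preserve arbitrary meets and finite joins. An MT-algebra is a pair $M=(B,\square)$, where $B$ is a complete Boolean algebra and $\square:B\to B$ is an interior operator: $\square 1=1$, $\square(a\wedge b)=\square a\wedge\square b$, $\square a\le a$, $\square a\le\square\square a$. We also write $M$ for $B$. An element $a$ is open if $\square a=a$, closed if $\neg a$ is open, and saturated if it is a meet of open elements. $\mathsf{O}M$, $\mathsf{C}M$ and $\mathsf{S}M$ denote the sets of open, closed and saturated elements; in the inherited order $\mathsf{O}M$ is a frame (joins and finite meets as in $M$) and $\mathsf{S}M$ is a coframe (meets and finite joins as in $M$). $\mathcal{B}\mathsf{S}M$ is the Boolean subalgebra of $M$ generated by $\mathsf{S}M$. $M$ is a $T_0$-algebra if each element is a join of elements of the form $s\wedge c$ with $s\in\mathsf{S}M$ and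 $c\in\mathsf{C}M$. A Raney morphism $f:M\to M'$ between MT-algebras is a function such that: (R1) $f$ restricts to a coframe morphism $\mathsf{S}M\to\mathsf{S}M'$; (R2) $f$ restricts to a frame morphism $\mathsf{O}M\to\mathsf{O}M'$; (R3) $f(a\wedge b)=f(a)\wedge f(b)$ for all $a,b\in M$; (R4) $f(x\vee y)=f(x)\vee f(y)$ for all $x,y\in\mathcal{B}\mathsf{S}M$; (R5) $f(a)=\bigvee\{f(x)\mid x\in\mathcal{B}\mathsf{S}M,\ x\le a\}$ for all $a\in M$. $\mathbf{MT_R}$ is the category of MT-algebras and Raney morphisms, with composition $(g\star f)(a)=\bigvee\{gf(x)\mid x\in\mathcal{B}\mathsf{S}M_1,\ x\le a\}$ for $f:M_1\to M_2$, $g:M_2\to M_3$, and identities $id_M(a)=\bigvee\{x\in\mathcal{B}\mathsf{S}M\mid x\le a\}$. For a complete lattice $C$, a subset $L\subseteq C$ is a subframe of $C$ if $L$ is a frame in the inherited order and the embedding $L\to C$ preserves arbitrary joins and finite meets. A Raney extension is a pair $R=(C,L)$ such that $C$ is a coframe, $L$ is a subframe of $C$ that meet-generates $C$ (every element of $C$ is a meet of elements of $L$), and $a\wedge\bigvee S=\bigvee\{a\wedge s\mid s\in S\}$ for all $a\in C$, $S\subseteq L$. A morphism $(C,L)\to(C',L')$ is a coframe morphism $h:C\to C'$ restricting to a frame morphism $L\to L'$. These form the category $\mathbf{RE}$ (with usual composition). The functor $\mathsf{R}$: $\mathsf{R}M=(\mathsf{S}M,\mathsf{O}M)$ and $\mathsf{R}f=f|_{\mathsf{S}M}$.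 The functor $\mathcal{F}$: for a Raney extension $R=(C,L)$ let $\mathcal{B}C$ be the Boolean envelope (free Boolean extension) of the bounded distributive lattice $C$ and $\mathcal{F}C$ the MacNeille completion of $\mathcal{B}C$, so $L\subseteq C\subseteq\mathcal{B}C\subseteq\mathcal{F}C$. The embedding $L\to\mathcal{F}C$ preserves all joins, so it has a right adjoint, giving the interior operator $\square a=\bigvee\{u\in L\mid u\le a\}$ on $\mathcal{F}C$. The Funayama envelope of $R$ is $\mathcal{F}R=(\mathcal{F}C,\square)$. For an $\mathbf{RE}$-morphism $h:C_1\to C_2$ from $(C_1,L_1)$ to $(C_2,L_2)$, let $\mathcal{B}h:\mathcal{B}C_1\to\mathcal{B}C_2$ be its unique extension to a Boolean morphism, and put $\mathcal{F}h(a)=\bigvee\{\mathcal{B}h(x)\mid x\in\mathcal{B}C_1,\ x\le a\}$ for $a\in\mathcal{F}R_1$, the join taken in $\mathcal{F}R_2$. A reflector is a left adjoint to the inclusion functor of a full subcategory. The functors $\mathsf{R}$ and $\mathcal{F}$ are mutually quasi-inverse equivalences between $\mathbf{MT_R}$ and $\mathbf{RE}$. *)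

theory Defs
  imports "HOL-Algebra.Complete_Lattice" "HOL-Library.FuncSet"
begin

text \<open>
  Structures are records over an explicit carrier; only the part on the carrier matters.
  Morphisms are extensional functions (undefined outside the carrier of their source), so that
  equality of morphisms is equality of functions.

  The objects of the categories below are the structures over all types. A quantifier over objects
  is therefore a quantifier over a free type variable, and the functors and natural
  transformations, which no formula can bind at several types at once, are polymorphic constants.
\<close>

section \<open>Frames, coframes, Boolean algebras\<close>

abbreviation suborder :: "('a, 'b) gorder_scheme \<Rightarrow> 'a set \<Rightarrow> ('a, 'b) gorder_scheme" where
  "suborder L A \<equiv> L\<lparr>carrier := A\<rparr>"

definition frame :: "('a, 'b) gorder_scheme \<Rightarrow> bool" where
  "frame L \<longleftrightarrow> complete_lattice L \<and>
     (\<forall>a\<in>carrier L. \<forall>A\<subseteq>carrier L. a \<sqinter>\<^bsub>L\<^esub> (\<Squnion>\<^bsub>L\<^esub> A) = \<Squnion>\<^bsub>L\<^esub> ((\<lambda>s. a \<sqinter>\<^bsub>L\<^esub> s) ` A))"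

definition coframe :: "('a, 'b) gorder_scheme \<Rightarrow> bool" where
  "coframe L \<longleftrightarrow> complete_lattice L \<and>
     (\<forall>a\<in>carrier L. \<forall>A\<subseteq>carrier L. a \<squnion>\<^bsub>L\<^esub> (\<Sqinter>\<^bsub>L\<^esub> A) = \<Sqinter>\<^bsub>L\<^esub> ((\<lambda>s. a \<squnion>\<^bsub>L\<^esub> s) ` A))"

text \<open>Being a frame (coframe) is not part of the following two predicates.\<close>

definition frame_hom :: "('a, 'c) gorder_scheme \<Rightarrow> ('b, 'd) gorder_scheme \<Rightarrow> ('a \<Rightarrow> 'b) \<Rightarrow> bool" where
  "frame_hom L L' f \<longleftrightarrow> f \<in> carrier L \<rightarrow> carrier L' \<and>
     sup_pres L L' f \<and> meet_pres L L' f \<and> f \<top>\<^bsub>L\<^esub> = \<top>\<^bsub>L'\<^esub>"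

definition coframe_hom :: "('a, 'c) gorder_scheme \<Rightarrow> ('b, 'd) gorder_scheme \<Rightarrow> ('a \<Rightarrow> 'b) \<Rightarrow> bool" where
  "coframe_hom L L' f \<longleftrightarrow> f \<in> carrier L \<rightarrow> carrier L' \<and>
     inf_pres L L' f \<and> join_pres L L' f \<and> f \<bottom>\<^bsub>L\<^esub> = \<bottom>\<^bsub>L'\<^esub>"

definition is_compl :: "('a, 'b) gorder_scheme \<Rightarrow> 'a \<Rightarrow> 'a \<Rightarrow> bool" where
  "is_compl L x y \<longleftrightarrow> y \<in> carrier L \<and> x \<sqinter>\<^bsub>L\<^esub> y = \<bottom>\<^bsub>L\<^esub> \<and> x \<squnion>\<^bsub>L\<^esub> y = \<top>\<^bsub>L\<^esub>"

definition boolean_lattice :: "('a, 'b) gorder_scheme \<Rightarrow> bool" where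
  "boolean_lattice L \<longleftrightarrow> bounded_lattice L \<and>
     (\<forall>x\<in>carrier L. \<forall>y\<in>carrier L. \<forall>z\<in>carrier L.
        x \<sqinter>\<^bsub>L\<^esub> (y \<squnion>\<^bsub>L\<^esub> z) = (x \<sqinter>\<^bsub>L\<^esub> y) \<squnion>\<^bsub>L\<^esub> (x \<sqinter>\<^bsub>L\<^esub> z)) \<and>
     (\<forall>x\<in>carrier L. \<exists>y. is_compl L x y)"

definition compl :: "('a, 'b) gorder_scheme \<Rightarrow> 'a \<Rightarrow> 'a" where
  "compl L x = (THE y. is_compl L x y)"

definition boolean_hom :: "('a, 'c) gorder_scheme \<Rightarrow> ('b, 'd) gorder_scheme \<Rightarrow> ('a \<Rightarrow> 'b) \<Rightarrow> bool" where
  "boolean_hom B B' f \<longleftrightarrow> f \<in> carrier B \<rightarrow> carrier B' \<and>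
     join_pres B B' f \<and> meet_pres B B' f \<and>
     f \<bottom>\<^bsub>B\<^esub> = \<bottom>\<^bsub>B'\<^esub> \<and> f \<top>\<^bsub>B\<^esub> = \<top>\<^bsub>B'\<^esub> \<and>
     (\<forall>x\<in>carrier B. f (compl B x) = compl B' (f x))"

definition boolean_subalgebra :: "('a, 'b) gorder_scheme \<Rightarrow> 'a set \<Rightarrow> bool" where
  "boolean_subalgebra B A \<longleftrightarrow> A \<subseteq> carrier B \<and> \<bottom>\<^bsub>B\<^esub> \<in> A \<and> \<top>\<^bsub>B\<^esub> \<in> A \<and>
     (\<forall>x\<in>A. \<forall>y\<in>A. x \<sqinter>\<^bsub>B\<^esub> y \<in> A \<and> x \<squnion>\<^bsub>B\<^esub> y \<in> A) \<and> (\<forall>x\<in>A. compl B x \<in> A)"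

definition boolean_generated :: "('a, 'b) gorder_scheme \<Rightarrow> 'a set \<Rightarrow> 'a set" where
  "boolean_generated B X = \<Inter> {A. boolean_subalgebra B A \<and> X \<subseteq> A}"

section \<open>MT-algebras and the category \<open>MT\<^sub>R\<close>\<close>

record 'a mt = "'a gorder" +
  box :: "'a \<Rightarrow> 'a"

definition mt_algebra :: "'a mt \<Rightarrow> bool" where
  "mt_algebra M \<longleftrightarrow> complete_lattice M \<and> boolean_lattice M \<and>
     box M \<in> carrier M \<rightarrow> carrier M \<and>
     box M \<top>\<^bsub>M\<^esub> = \<top>\<^bsub>M\<^esub> \<and>
     (\<forall>a\<in>carrier M. \<forall>b\<in>carrier M. box M (a \<sqinter>\<^bsub>M\<^esub> b) = box M a \<sqinter>\<^bsub>M\<^esub> box M b) \<and>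
     (\<forall>a\<in>carrier M. box M a \<sqsubseteq>\<^bsub>M\<^esub> a) \<and>
     (\<forall>a\<in>carrier M. box M a \<sqsubseteq>\<^bsub>M\<^esub> box M (box M a))"

definition opens :: "'a mt \<Rightarrow> 'a set" where
  "opens M = {a \<in> carrier M. box M a = a}"

definition closeds :: "'a mt \<Rightarrow> 'a set" where
  "closeds M = {a \<in> carrier M. compl M a \<in> opens M}"

definition saturateds :: "'a mt \<Rightarrow> 'a set" where
  "saturateds M = {a \<in> carrier M. \<exists>U\<subseteq>opens M. a = \<Sqinter>\<^bsub>M\<^esub> U}"

definition BS :: "'a mt \<Rightarrow> 'a set" where
  "BS M = boolean_generated M (saturateds M)"

definition t0_algebra :: "'a mt \<Rightarrow> bool" where
  "t0_algebra M \<longleftrightarrow> mt_algebra M \<and>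
     (\<forall>a\<in>carrier M. \<exists>X \<subseteq> {s \<sqinter>\<^bsub>M\<^esub> c |s c. s \<in> saturateds M \<and> c \<in> closeds M}. a = \<Squnion>\<^bsub>M\<^esub> X)"

definition mt_hom :: "'a mt \<Rightarrow> 'b mt \<Rightarrow> ('a \<Rightarrow> 'b) set" where
  "mt_hom M M' = {f \<in> carrier M \<rightarrow>\<^sub>E carrier M'.
     coframe_hom (suborder M (saturateds M)) (suborder M' (saturateds M')) f \<and>
     frame_hom (suborder M (opens M)) (suborder M' (opens M')) f \<and>
     (\<forall>a\<in>carrier M. \<forall>b\<in>carrier M. f (a \<sqinter>\<^bsub>M\<^esub> b) = f a \<sqinter>\<^bsub>M'\<^esub> f b) \<and>
     (\<forall>x\<in>BS M. \<forall>y\<in>BS M. f (x \<squnion>\<^bsub>M\<^esub> y) = f x \<squnion>\<^bsub>M'\<^esub> f y) \<and>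
     (\<forall>a\<in>carrier M. f a = \<Squnion>\<^bsub>M'\<^esub> {f x |x. x \<in> BS M \<and> x \<sqsubseteq>\<^bsub>M\<^esub> a})}"

text \<open>\<open>mt_comp M1 M3 g f\<close> composes \<open>f : M1 \<rightarrow> M2\<close> and \<open>g : M2 \<rightarrow> M3\<close>.\<close>

definition mt_comp :: "'a mt \<Rightarrow> 'c mt \<Rightarrow> ('b \<Rightarrow> 'c) \<Rightarrow> ('a \<Rightarrow> 'b) \<Rightarrow> ('a \<Rightarrow> 'c)" where
  "mt_comp M1 M3 g f =
     (\<lambda>a\<in>carrier M1. \<Squnion>\<^bsub>M3\<^esub> {g (f x) |x. x \<in> BS M1 \<and> x \<sqsubseteq>\<^bsub>M1\<^esub> a})"

definition mt_id :: "'a mt \<Rightarrow> 'a \<Rightarrow> 'a" where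
  "mt_id M = (\<lambda>a\<in>carrier M. \<Squnion>\<^bsub>M\<^esub> {x \<in> BS M. x \<sqsubseteq>\<^bsub>M\<^esub> a})"

definition mt_iso :: "'a mt \<Rightarrow> 'b mt \<Rightarrow> ('a \<Rightarrow> 'b) \<Rightarrow> bool" where
  "mt_iso M N f \<longleftrightarrow> f \<in> mt_hom M N \<and>
     (\<exists>g\<in>mt_hom N M. mt_comp M M g f = mt_id M \<and> mt_comp N N f g = mt_id N)"

section \<open>Raney extensions and the category \<open>RE\<close>\<close>

text \<open>The pair \<open>(C, L)\<close> is the order \<open>C\<close> with the additional field \<open>subfr = L\<close>.\<close>

record 'a raney = "'a gorder" +
  subfr :: "'a set"

definition subframe :: "('a, 'b) gorder_scheme \<Rightarrow> 'a set \<Rightarrow> bool" where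
  "subframe C L \<longleftrightarrow> L \<subseteq> carrier C \<and> frame (suborder C L) \<and> frame_hom (suborder C L) C (\<lambda>u. u)"

definition raney_extension :: "'a raney \<Rightarrow> bool" where
  "raney_extension R \<longleftrightarrow> coframe R \<and> subframe R (subfr R) \<and>
     (\<forall>c\<in>carrier R. \<exists>U\<subseteq>subfr R. c = \<Sqinter>\<^bsub>R\<^esub> U) \<and>
     (\<forall>a\<in>carrier R. \<forall>A\<subseteq>subfr R. a \<sqinter>\<^bsub>R\<^esub> (\<Squnion>\<^bsub>R\<^esub> A) = \<Squnion>\<^bsub>R\<^esub> ((\<lambda>s. a \<sqinter>\<^bsub>R\<^esub> s) ` A))"

definition re_hom :: "'a raney \<Rightarrow> 'b raney \<Rightarrow> ('a \<Rightarrow> 'b) set" where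
  "re_hom R R' = {h \<in> carrier R \<rightarrow>\<^sub>E carrier R'.
     coframe_hom R R' h \<and> frame_hom (suborder R (subfr R)) (suborder R' (subfr R')) h}"

definition re_comp :: "'a raney \<Rightarrow> ('b \<Rightarrow> 'c) \<Rightarrow> ('a \<Rightarrow> 'b) \<Rightarrow> ('a \<Rightarrow> 'c)" where
  "re_comp R g f = compose (carrier R) g f"

definition re_id :: "'a raney \<Rightarrow> 'a \<Rightarrow> 'a" where
  "re_id R = (\<lambda>c\<in>carrier R. c)"

definition re_iso :: "'a raney \<Rightarrow> 'b raney \<Rightarrow> ('a \<Rightarrow> 'b) \<Rightarrow> bool" where
  "re_iso R R' h \<longleftrightarrow> h \<in> re_hom R R' \<and>
     (\<exists>g\<in>re_hom R' R. re_comp R g h = re_id R \<and> re_comp R' h g = re_id R')"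

section \<open>The functor \<open>R\<close>\<close>

definition R_obj :: "'a mt \<Rightarrow> 'a raney" where
  "R_obj M = \<lparr>carrier = saturateds M, eq = (=), le = le M, subfr = opens M\<rparr>"

definition R_map :: "'a mt \<Rightarrow> ('a \<Rightarrow> 'b) \<Rightarrow> ('a \<Rightarrow> 'b)" where
  "R_map M f = restrict f (saturateds M)"

section \<open>Boolean envelope and MacNeille completion\<close>

definition prime_filter :: "('a, 'b) gorder_scheme \<Rightarrow> 'a set \<Rightarrow> bool" where
  "prime_filter C P \<longleftrightarrow> P \<subseteq> carrier C \<and> \<top>\<^bsub>C\<^esub> \<in> P \<and> \<bottom>\<^bsub>C\<^esub> \<notin> P \<and>
     (\<forall>x\<in>P. \<forall>y\<in>carrier C. x \<sqsubseteq>\<^bsub>C\<^esub> y \<longrightarrow> y \<in> P) \<and>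
     (\<forall>x\<in>P. \<forall>y\<in>P. x \<sqinter>\<^bsub>C\<^esub> y \<in> P) \<and>
     (\<forall>x\<in>carrier C. \<forall>y\<in>carrier C. x \<squnion>\<^bsub>C\<^esub> y \<in> P \<longrightarrow> x \<in> P \<or> y \<in> P)"

text \<open>
  The free Boolean extension of a bounded distributive lattice \<open>C\<close>, in its standard representation:
  \<open>C\<close> embeds into the powerset of its prime filters by \<open>env_emb\<close>, and the Boolean subalgebra
  generated by the image has the universal property that every bounded lattice morphism from \<open>C\<close> to a
  Boolean algebra \<open>B\<close> extends uniquely to a Boolean morphism; \<open>env_lift C B\<close> selects the extension.
\<close>

definition env_emb :: "('a, 'b) gorder_scheme \<Rightarrow> 'a \<Rightarrow> 'a set set" where
  "env_emb C c = {P. prime_filter C P \<and> c \<in> P}"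

definition pow_order :: "'a set \<Rightarrow> 'a set gorder" where
  "pow_order X = \<lparr>carrier = Pow X, eq = (=), le = (\<subseteq>)\<rparr>"

definition boolean_envelope :: "('a, 'b) gorder_scheme \<Rightarrow> 'a set set gorder" where
  "boolean_envelope C =
     suborder (pow_order {P. prime_filter C P})
       (boolean_generated (pow_order {P. prime_filter C P}) (env_emb C ` carrier C))"

definition env_lift :: "('a, 'c) gorder_scheme \<Rightarrow> ('b, 'd) gorder_scheme \<Rightarrow> ('a \<Rightarrow> 'b) \<Rightarrow> ('a set set \<Rightarrow> 'b)" where
  "env_lift C B h = (THE g. g \<in> extensional (carrier (boolean_envelope C)) \<and>
     boolean_hom (boolean_envelope C) B g \<and> (\<forall>c\<in>carrier C. g (env_emb C c) = h c))"

definition macneille :: "('a, 'b) gorder_scheme \<Rightarrow> 'a set gorder" where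
  "macneille B =
     \<lparr>carrier = {A. A \<subseteq> carrier B \<and> Lower B (Upper B A) = A}, eq = (=), le = (\<subseteq>)\<rparr>"

definition mac_emb :: "('a, 'b) gorder_scheme \<Rightarrow> 'a \<Rightarrow> 'a set" where
  "mac_emb B b = {x \<in> carrier B. x \<sqsubseteq>\<^bsub>B\<^esub> b}"

section \<open>The functor \<open>F\<close>\<close>

text \<open>The inclusions \<open>C \<subseteq> BC \<subseteq> FC\<close> are \<open>env_emb\<close> and \<open>fun_emb\<close>; their composite is \<open>F_emb\<close>.\<close>

definition fun_emb :: "('a, 'b) gorder_scheme \<Rightarrow> 'a set set \<Rightarrow> 'a set set set" where
  "fun_emb C = mac_emb (boolean_envelope C)"

definition F_emb :: "('a, 'b) gorder_scheme \<Rightarrow> 'a \<Rightarrow> 'a set set set" where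
  "F_emb C c = fun_emb C (env_emb C c)"

definition F_obj :: "'a raney \<Rightarrow> 'a set set set mt" where
  "F_obj R = (let FC = macneille (boolean_envelope R) in
     \<lparr>carrier = carrier FC, eq = (=), le = le FC,
      box = (\<lambda>a. \<Squnion>\<^bsub>FC\<^esub> {F_emb R u |u. u \<in> subfr R \<and> F_emb R u \<sqsubseteq>\<^bsub>FC\<^esub> a})\<rparr>)"

definition env_map :: "'a raney \<Rightarrow> 'b raney \<Rightarrow> ('a \<Rightarrow> 'b) \<Rightarrow> ('a set set \<Rightarrow> 'b set set)" where
  "env_map R1 R2 h = env_lift R1 (boolean_envelope R2) (\<lambda>c. env_emb R2 (h c))"

definition F_map :: "'a raney \<Rightarrow> 'b raney \<Rightarrow> ('a \<Rightarrow> 'b) \<Rightarrow> ('a set set set \<Rightarrow> 'b set set set)" where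
  "F_map R1 R2 h = (\<lambda>a\<in>carrier (F_obj R1).
     \<Squnion>\<^bsub>F_obj R2\<^esub> {fun_emb R2 (env_map R1 R2 h x) |x.
        x \<in> carrier (boolean_envelope R1) \<and> fun_emb R1 x \<sqsubseteq>\<^bsub>F_obj R1\<^esub> a})"

section \<open>The composites and the canonical natural transformations\<close>

abbreviation FR_obj :: "'a mt \<Rightarrow> 'a set set set mt" where
  "FR_obj M \<equiv> F_obj (R_obj M)"

abbreviation FR_map :: "'a mt \<Rightarrow> 'b mt \<Rightarrow> ('a \<Rightarrow> 'b) \<Rightarrow> ('a set set set \<Rightarrow> 'b set set set)" where
  "FR_map M N f \<equiv> F_map (R_obj M) (R_obj N) (R_map M f)"

abbreviation RF_obj :: "'a raney \<Rightarrow> 'a set set set raney" where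
  "RF_obj R \<equiv> R_obj (F_obj R)"

abbreviation RF_map :: "'a raney \<Rightarrow> 'b raney \<Rightarrow> ('a \<Rightarrow> 'b) \<Rightarrow> ('a set set set \<Rightarrow> 'b set set set)" where
  "RF_map R1 R2 h \<equiv> R_map (F_obj R1) (F_map R1 R2 h)"

text \<open>
  \<open>\<eta> M : M \<rightarrow> FR M\<close> sends \<open>a\<close> to the join, in \<open>FR M\<close>, of all \<open>x \<in> BS M\<close> with \<open>x \<le> a\<close>. Here \<open>BS M\<close> is
  viewed as the Boolean envelope of \<open>S M\<close> through the Boolean morphism extending \<open>S M \<subseteq> M\<close>.
  \<open>\<epsilon> R : R \<rightarrow> RF R\<close> is the inclusion of \<open>C\<close> into \<open>FC\<close>.
\<close>

definition eta :: "'a mt \<Rightarrow> 'a \<Rightarrow> 'a set set set" where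
  "eta M = (\<lambda>a\<in>carrier M. \<Squnion>\<^bsub>FR_obj M\<^esub> {fun_emb (R_obj M) x |x.
     x \<in> carrier (boolean_envelope (R_obj M)) \<and> env_lift (R_obj M) M (\<lambda>s. s) x \<sqsubseteq>\<^bsub>M\<^esub> a})"

definition eps :: "'a raney \<Rightarrow> 'a \<Rightarrow> 'a set set set" where
  "eps R = (\<lambda>c\<in>carrier R. F_emb R c)"

end

theory Submission
  imports Defs
begin

text \<open>
  The functor \<open>R\<close> is fully faithful on all MT-algebras. A Raney morphism \<open>f : M \<rightarrow> N\<close> is a Boolean
  morphism on \<open>BS M\<close>, and elsewhere it is by definition a join of values on \<open>BS M\<close>; as \<open>BS M\<close> is
  generated by the saturated elements, \<open>f\<close> is determined by its restriction to them (\<open>mt_hom_eqI\<close>).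
  Conversely \<open>BS M\<close> is the Boolean envelope of the coframe of saturated elements (\<open>BS_iso\<close>), so a
  morphism of Raney extensions extends uniquely to a Boolean morphism on \<open>BS M\<close>, and
  \<open>a \<mapsto> \<Squnion>{g x | x \<in> BS M, x \<sqsubseteq> a}\<close> turns a Boolean morphism \<open>g\<close> on \<open>BS M\<close> into a Raney morphism
  (\<open>mt_hom_extension\<close>), because complete Boolean algebras are frames. This
  gives \<open>R_map_full\<close> and \<open>R_map_faithful\<close>.

  The functor \<open>R\<close> is essentially surjective already on \<open>T\<^sub>0\<close>-algebras. For a Raney extension
  \<open>R = (C, L)\<close> the embedding of \<open>C\<close> into the MacNeille completion of its Boolean envelope preserves
  all meets of \<open>C\<close> and all joins of elements of \<open>L\<close>. For the passage to the envelope these are the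
  coframe law and the distributive law for \<open>L\<close> (\<open>env_emb_Inf\<close>, \<open>env_emb_Sup\<close>); the completion
  preserves all existing meets and joins. Therefore the open elements of the Funayama envelope are
  the elements of \<open>L\<close>, the saturated ones are the elements of \<open>C\<close>, and \<open>eps\<close> is an isomorphism
  (\<open>eps_iso\<close>). The Funayama envelope is a \<open>T\<^sub>0\<close>-algebra because differences of elements of \<open>C\<close> are
  join-dense in it and \<open>L\<close> meet-generates \<open>C\<close> (\<open>t0_algebra_F_obj\<close>).

  The rest is formal. The morphism \<open>F_map R1 R2 h\<close> is the only Raney morphism that corresponds to
  \<open>h\<close> under the isomorphisms \<open>eps\<close>, and \<open>eta M\<close> is the only one whose restriction to saturated
  elements is \<open>eps (R_obj M)\<close>. Hence functoriality of \<open>F\<close> and both naturality statements hold by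
  faithfulness, \<open>eta M\<close> is an isomorphism since \<open>R\<close> reflects isomorphisms, and precomposition with
  \<open>eta M\<close> is the adjunction.

  The Boolean envelope is represented by sets of prime filters. Its universal property is obtained
  by representing the target Boolean algebra in the same way and pulling prime filters back
  (\<open>envelope_extension\<close>); that both representations are faithful is the prime filter theorem for
  distributive lattices (\<open>prime_filter_separation\<close>).
\<close>

section \<open>Partial orders, suprema and infima\<close>

lemma (in partial_order) sup_eqI:
  assumes "A \<subseteq> carrier L" "x \<in> carrier L" "\<And>a. a \<in> A \<Longrightarrow> a \<sqsubseteq> x"
    "\<And>y. \<lbrakk>y \<in> carrier L; \<And>a. a \<in> A \<Longrightarrow> a \<sqsubseteq> y\<rbrakk> \<Longrightarrow> x \<sqsubseteq> y"
  shows "\<Squnion>A = x"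
proof -
  have "least L x (Upper L A)"
    by (rule least_UpperI) (use assms(1-3) in \<open>auto intro!: assms(4) simp: Upper_def\<close>)
  then show ?thesis
    unfolding sup_def by (metis least_unique someI_ex)
qed

lemma (in partial_order) inf_eqI:
  assumes "A \<subseteq> carrier L" "x \<in> carrier L" "\<And>a. a \<in> A \<Longrightarrow> x \<sqsubseteq> a"
    "\<And>y. \<lbrakk>y \<in> carrier L; \<And>a. a \<in> A \<Longrightarrow> y \<sqsubseteq> a\<rbrakk> \<Longrightarrow> y \<sqsubseteq> x"
  shows "\<Sqinter>A = x"
proof -
  have "greatest L x (Lower L A)"
    by (rule greatest_LowerI) (use assms(1-3) in \<open>auto intro!: assms(4) simp: Lower_def\<close>)
  then show ?thesis
    unfolding inf_def by (metis greatest_unique someI_ex)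
qed

lemma (in partial_order) join_eqI:
  assumes "x \<in> carrier L" "y \<in> carrier L" "z \<in> carrier L" "x \<sqsubseteq> z" "y \<sqsubseteq> z"
    "\<And>w. \<lbrakk>w \<in> carrier L; x \<sqsubseteq> w; y \<sqsubseteq> w\<rbrakk> \<Longrightarrow> z \<sqsubseteq> w"
  shows "x \<squnion> y = z"
  unfolding join_def by (rule sup_eqI) (use assms in auto)

lemma (in partial_order) meet_eqI:
  assumes "x \<in> carrier L" "y \<in> carrier L" "z \<in> carrier L" "z \<sqsubseteq> x" "z \<sqsubseteq> y"
    "\<And>w. \<lbrakk>w \<in> carrier L; w \<sqsubseteq> x; w \<sqsubseteq> y\<rbrakk> \<Longrightarrow> w \<sqsubseteq> z"
  shows "x \<sqinter> y = z"
  unfolding meet_def by (rule inf_eqI) (use assms in auto)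

lemma (in partial_order) top_eqI:
  assumes "t \<in> carrier L" "\<And>x. x \<in> carrier L \<Longrightarrow> x \<sqsubseteq> t"
  shows "\<top> = t"
proof -
  have "greatest L t (carrier L)" using assms by (simp add: greatest_def)
  then show ?thesis
    unfolding top_def by (metis greatest_unique someI_ex)
qed

lemma (in partial_order) bottom_eqI:
  assumes "t \<in> carrier L" "\<And>x. x \<in> carrier L \<Longrightarrow> t \<sqsubseteq> x"
  shows "\<bottom> = t"
proof -
  have "least L t (carrier L)" using assms by (simp add: least_def)
  then show ?thesis
    unfolding bottom_def by (metis least_unique someI_ex)
qed

lemma partial_orderI:
  assumes "eq L = (=)"
    "\<And>x. x \<in> carrier L \<Longrightarrow> x \<sqsubseteq>\<^bsub>L\<^esub> x"
    "\<And>x y. \<lbrakk>x \<in> carrier L; y \<in> carrier L; x \<sqsubseteq>\<^bsub>L\<^esub> y; y \<sqsubseteq>\<^bsub>L\<^esub> x\<rbrakk> \<Longrightarrow> x = y"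
    "\<And>x y z. \<lbrakk>x \<in> carrier L; y \<in> carrier L; z \<in> carrier L; x \<sqsubseteq>\<^bsub>L\<^esub> y; y \<sqsubseteq>\<^bsub>L\<^esub> z\<rbrakk> \<Longrightarrow> x \<sqsubseteq>\<^bsub>L\<^esub> z"
  shows "partial_order L"
proof -
  have "equivalence L"
    by (rule equivalence.intro) (auto simp: assms(1))
  moreover have "weak_partial_order_axioms L"
    by (rule weak_partial_order_axioms.intro)
      (simp_all only: assms(1), (rule assms; assumption)+)
  ultimately show ?thesis
    by (simp add: partial_order_def partial_order_axioms_def weak_partial_order_def assms(1))
qed

lemma partial_order_restrict:
  assumes "partial_order L" "carrier L' \<subseteq> carrier L" "le L' = le L" "eq L' = (=)"
  shows "partial_order L'"
proof -
  interpret partial_order L by fact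
  show ?thesis
    by (rule partial_orderI) (use assms in \<open>auto intro: le_trans\<close>)
qed

lemma (in partial_order) partial_order_suborder:
  "A \<subseteq> carrier L \<Longrightarrow> partial_order (suborder L A)"
  by (rule partial_order_restrict[OF partial_order_axioms]) (auto simp: eq_is_equal)

lemma partial_order_inclusion:
  assumes "eq L = (=)" "le L = (\<subseteq>)"
  shows "partial_order L"
  by (rule partial_orderI) (use assms in auto)

lemma (in partial_order) latticeI:
  assumes "\<And>x y. \<lbrakk>x \<in> carrier L; y \<in> carrier L\<rbrakk> \<Longrightarrow>
      \<exists>z\<in>carrier L. x \<sqsubseteq> z \<and> y \<sqsubseteq> z \<and> (\<forall>w\<in>carrier L. x \<sqsubseteq> w \<and> y \<sqsubseteq> w \<longrightarrow> z \<sqsubseteq> w)"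
    and "\<And>x y. \<lbrakk>x \<in> carrier L; y \<in> carrier L\<rbrakk> \<Longrightarrow>
      \<exists>z\<in>carrier L. z \<sqsubseteq> x \<and> z \<sqsubseteq> y \<and> (\<forall>w\<in>carrier L. w \<sqsubseteq> x \<and> w \<sqsubseteq> y \<longrightarrow> w \<sqsubseteq> z)"
  shows "lattice L"
proof unfold_locales
  fix x y assume xy: "x \<in> carrier L" "y \<in> carrier L"
  show "\<exists>s. is_lub L s {x, y}"
    using assms(1)[OF xy] xy by (auto simp: least_def Upper_def)
  show "\<exists>s. is_glb L s {x, y}"
    using assms(2)[OF xy] xy by (auto simp: greatest_def Lower_def)
qed

lemma (in lattice) bounded_latticeI:
  assumes "b \<in> carrier L" "\<And>x. x \<in> carrier L \<Longrightarrow> b \<sqsubseteq> x"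
    and "t \<in> carrier L" "\<And>x. x \<in> carrier L \<Longrightarrow> x \<sqsubseteq> t"
  shows "bounded_lattice L"
  by unfold_locales (use assms in \<open>auto simp: least_def greatest_def\<close>)

lemma (in partial_order) complete_lattice_from_infs:
  assumes "\<And>A. A \<subseteq> carrier L \<Longrightarrow> \<exists>x\<in>carrier L. (\<forall>a\<in>A. x \<sqsubseteq> a) \<and>
      (\<forall>y\<in>carrier L. (\<forall>a\<in>A. y \<sqsubseteq> a) \<longrightarrow> y \<sqsubseteq> x)"
  shows "complete_lattice L"
proof (rule complete_lattice_criterion1)
  show "\<exists>g. greatest L g (carrier L)"
    using assms[of "{}"] by (auto simp: greatest_def)
  fix A assume A: "A \<subseteq> carrier L"
  show "\<exists>i. is_glb L i A"
    using assms[OF A] A by (auto simp: greatest_def Lower_def subset_iff)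
qed

lemma (in partial_order) complete_lattice_from_sups:
  assumes "\<And>A. A \<subseteq> carrier L \<Longrightarrow> \<exists>x\<in>carrier L. (\<forall>a\<in>A. a \<sqsubseteq> x) \<and>
      (\<forall>y\<in>carrier L. (\<forall>a\<in>A. a \<sqsubseteq> y) \<longrightarrow> x \<sqsubseteq> y)"
  shows "complete_lattice L"
proof (rule complete_lattice_from_infs)
  fix A assume A: "A \<subseteq> carrier L"
  obtain x where x: "x \<in> carrier L" "\<forall>a\<in>Lower L A. a \<sqsubseteq> x"
    "\<forall>y\<in>carrier L. (\<forall>a\<in>Lower L A. a \<sqsubseteq> y) \<longrightarrow> x \<sqsubseteq> y"
    using assms[of "Lower L A"] by auto
  have "x \<sqsubseteq> a" if "a \<in> A" for a
    using x(3) that A by (auto simp: Lower_def)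
  moreover have "y \<sqsubseteq> x" if "y \<in> carrier L" "\<forall>a\<in>A. y \<sqsubseteq> a" for y
    using x(2) that A by (auto simp: Lower_def)
  ultimately show "\<exists>x\<in>carrier L. (\<forall>a\<in>A. x \<sqsubseteq> a) \<and>
      (\<forall>y\<in>carrier L. (\<forall>a\<in>A. y \<sqsubseteq> a) \<longrightarrow> y \<sqsubseteq> x)"
    using x(1) by blast
qed

lemma (in complete_lattice) sup_mono:
  assumes "A \<subseteq> B" "B \<subseteq> carrier L"
  shows "\<Squnion>A \<sqsubseteq> \<Squnion>B"
  by (rule sup_least) (use assms in \<open>auto intro: sup_upper\<close>)

lemma (in complete_lattice) Inf_empty: "\<Sqinter>{} = \<top>"
  by (rule inf_eqI) auto

section \<open>Distributive lattices and prime filters\<close>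

locale bounded_distrib_lattice = bounded_lattice L for L (structure) +
  assumes distrib: "\<lbrakk>x \<in> carrier L; y \<in> carrier L; z \<in> carrier L\<rbrakk> \<Longrightarrow>
    x \<sqinter> (y \<squnion> z) = (x \<sqinter> y) \<squnion> (x \<sqinter> z)"
begin

lemma meet_mono:
  assumes "x \<in> carrier L" "y \<in> carrier L" "x' \<in> carrier L" "y' \<in> carrier L" "x \<sqsubseteq> x'" "y \<sqsubseteq> y'"
  shows "x \<sqinter> y \<sqsubseteq> x' \<sqinter> y'"
  using assms by (meson le_trans meet_closed meet_le meet_left meet_right)

text \<open>
  A filter that contains \<open>a\<close> and is maximal among those avoiding \<open>b\<close> is prime: if it contains
  \<open>x \<squnion> y\<close> but neither \<open>x\<close> nor \<open>y\<close>, then adjoining either of them produces \<open>b\<close>, and by distributivity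
  so does \<open>x \<squnion> y\<close>.
\<close>

lemma prime_filter_separation:
  assumes a: "a \<in> carrier L" and b: "b \<in> carrier L" and nle: "\<not> a \<sqsubseteq> b"
  shows "\<exists>P. prime_filter L P \<and> a \<in> P \<and> b \<notin> P"
proof -
  define F where "F P \<longleftrightarrow> P \<subseteq> carrier L \<and> a \<in> P \<and> b \<notin> P \<and>
    (\<forall>x\<in>P. \<forall>y\<in>carrier L. x \<sqsubseteq> y \<longrightarrow> y \<in> P) \<and> (\<forall>x\<in>P. \<forall>y\<in>P. x \<sqinter> y \<in> P)" for P
  have "F {x \<in> carrier L. a \<sqsubseteq> x}"
    unfolding F_def using a b nle by (auto intro: meet_le le_trans)
  then have ne: "{P. F P} \<noteq> {}" by blast
  have "\<exists>M\<in>{P. F P}. \<forall>X\<in>{P. F P}. M \<subseteq> X \<longrightarrow> X = M"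
  proof (rule subset_Zorn_nonempty[OF ne])
    fix \<C> assume ne: "\<C> \<noteq> {}" and ch: "subset.chain {P. F P} \<C>"
    then have F: "\<And>P. P \<in> \<C> \<Longrightarrow> F P" and tot: "\<And>P Q. P \<in> \<C> \<Longrightarrow> Q \<in> \<C> \<Longrightarrow> P \<subseteq> Q \<or> Q \<subseteq> P"
      by (auto simp: subset.chain_def)
    have "x \<sqinter> y \<in> \<Union>\<C>" if "x \<in> \<Union>\<C>" "y \<in> \<Union>\<C>" for x y
    proof -
      from that tot obtain P where P: "P \<in> \<C>" "x \<in> P" "y \<in> P" by blast
      then have "x \<sqinter> y \<in> P" using F[OF P(1)] unfolding F_def by blast
      then show ?thesis using P by blast
    qed
    moreover have "y \<in> \<Union>\<C>" if "x \<in> \<Union>\<C>" "y \<in> carrier L" "x \<sqsubseteq> y" for x y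
      using F that unfolding F_def by blast
    moreover have "\<Union>\<C> \<subseteq> carrier L" "a \<in> \<Union>\<C>" "b \<notin> \<Union>\<C>"
      using F ne unfolding F_def by blast+
    ultimately show "\<Union>\<C> \<in> {P. F P}" unfolding F_def by blast
  qed
  then obtain P where P: "F P" and max: "\<And>Q. F Q \<Longrightarrow> P \<subseteq> Q \<Longrightarrow> Q = P" by auto
  note P' = P[unfolded F_def]
  have sub: "x \<in> carrier L" if "x \<in> P" for x using P' that by blast
  have top: "\<top> \<in> P" using P' a by blast
  have meet_P: "x \<sqinter> y \<in> P" if "x \<in> P" "y \<in> P" for x y using P' that by blast
  \<comment> \<open>the filter generated by \<open>P\<close> and \<open>x\<close> is strictly larger than \<open>P\<close>, so it contains \<open>b\<close>\<close>
  have adjoin: "\<exists>p\<in>P. p \<sqinter> x \<sqsubseteq> b" if x: "x \<in> carrier L" "x \<notin> P" for x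
  proof (rule ccontr)
    assume no: "\<not> ?thesis"
    define Q where "Q = {y \<in> carrier L. \<exists>p\<in>P. p \<sqinter> x \<sqsubseteq> y}"
    have "P \<subseteq> Q" unfolding Q_def using sub x meet_left by blast
    moreover have "x \<in> Q" unfolding Q_def using top x sub meet_right[of "\<top>" x] by blast
    moreover have "F Q"
    proof -
      have "y \<sqinter> z \<in> Q" if "y \<in> Q" "z \<in> Q" for y z
      proof -
        from that obtain p q where pq: "p \<in> P" "p \<sqinter> x \<sqsubseteq> y" "q \<in> P" "q \<sqinter> x \<sqsubseteq> z"
          and c: "y \<in> carrier L" "z \<in> carrier L"
          unfolding Q_def by blast
        have "(p \<sqinter> q) \<sqinter> x \<sqsubseteq> p \<sqinter> x" "(p \<sqinter> q) \<sqinter> x \<sqsubseteq> q \<sqinter> x"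
          using pq sub x by (simp_all add: meet_mono meet_left meet_right)
        then have "(p \<sqinter> q) \<sqinter> x \<sqsubseteq> y \<sqinter> z"
          using pq sub x c by (meson le_trans meet_closed meet_le)
        moreover have "p \<sqinter> q \<in> P" using pq P' by blast
        ultimately show ?thesis unfolding Q_def using c by auto
      qed
      moreover have "z \<in> Q" if "y \<in> Q" "z \<in> carrier L" "y \<sqsubseteq> z" for y z
        using that sub x unfolding Q_def by (blast intro: le_trans meet_closed)
      moreover have "b \<notin> Q" "Q \<subseteq> carrier L" using no unfolding Q_def by blast+
      moreover have "a \<in> Q" using \<open>P \<subseteq> Q\<close> P' by blast
      ultimately show ?thesis unfolding F_def by blast
    qed
    ultimately show False using max x by blast
  qed
  have "x \<in> P \<or> y \<in> P" if xy: "x \<in> carrier L" "y \<in> carrier L" "x \<squnion> y \<in> P" for x y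
  proof (rule ccontr)
    assume "\<not> ?thesis"
    then have n: "x \<notin> P" "y \<notin> P" by simp_all
    obtain p q where pq: "p \<in> P" "p \<sqinter> x \<sqsubseteq> b" "q \<in> P" "q \<sqinter> y \<sqsubseteq> b"
      using adjoin[OF xy(1) n(1)] adjoin[OF xy(2) n(2)] by blast
    define r where "r = p \<sqinter> q"
    have r: "r \<in> P" unfolding r_def using meet_P[OF pq(1,3)] .
    note r = r sub[OF r]
    have "r \<sqinter> x \<sqsubseteq> p \<sqinter> x" "r \<sqinter> y \<sqsubseteq> q \<sqinter> y"
      unfolding r_def using pq sub xy by (simp_all add: meet_mono meet_left meet_right)
    then have "r \<sqinter> x \<sqsubseteq> b" "r \<sqinter> y \<sqsubseteq> b"
      using pq sub xy r b by (meson le_trans meet_closed)+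
    then have "r \<sqinter> (x \<squnion> y) \<sqsubseteq> b"
      using r xy b by (simp add: distrib join_le)
    moreover have "r \<sqinter> (x \<squnion> y) \<in> P" using r xy meet_P by blast
    ultimately show False using P' b by blast
  qed
  moreover have "\<bottom> \<notin> P" using P' b by (metis bottom_lower)
  ultimately have "prime_filter L P"
    unfolding prime_filter_def using P' top by blast
  then show ?thesis using P' by blast
qed

lemma prime_filter_meet_iff:
  assumes "prime_filter L P" "x \<in> carrier L" "y \<in> carrier L"
  shows "x \<sqinter> y \<in> P \<longleftrightarrow> x \<in> P \<and> y \<in> P"
  using assms unfolding prime_filter_def by (meson meet_closed meet_left meet_right)

lemma prime_filter_join_iff:
  assumes "prime_filter L P" "x \<in> carrier L" "y \<in> carrier L"
  shows "x \<squnion> y \<in> P \<longleftrightarrow> x \<in> P \<or> y \<in> P"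
  using assms unfolding prime_filter_def by (meson join_closed join_left join_right)

lemma env_emb_meet:
  "\<lbrakk>x \<in> carrier L; y \<in> carrier L\<rbrakk> \<Longrightarrow> env_emb L (x \<sqinter> y) = env_emb L x \<inter> env_emb L y"
  by (auto simp: env_emb_def prime_filter_meet_iff)

lemma env_emb_join:
  "\<lbrakk>x \<in> carrier L; y \<in> carrier L\<rbrakk> \<Longrightarrow> env_emb L (x \<squnion> y) = env_emb L x \<union> env_emb L y"
  by (auto simp: env_emb_def prime_filter_join_iff)

lemma env_emb_top: "env_emb L \<top> = {P. prime_filter L P}"
  by (auto simp: env_emb_def prime_filter_def)

lemma env_emb_bottom: "env_emb L \<bottom> = {}"
  by (auto simp: env_emb_def prime_filter_def)

lemma env_emb_subset_iff:
  assumes "x \<in> carrier L" "y \<in> carrier L"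
  shows "env_emb L x \<subseteq> env_emb L y \<longleftrightarrow> x \<sqsubseteq> y"
proof
  show "x \<sqsubseteq> y" if "env_emb L x \<subseteq> env_emb L y"
    using prime_filter_separation[OF assms] that by (auto simp: env_emb_def)
  show "env_emb L x \<subseteq> env_emb L y" if "x \<sqsubseteq> y"
    using that assms by (auto simp: env_emb_def prime_filter_def)
qed

lemma env_emb_eq_iff:
  assumes "x \<in> carrier L" "y \<in> carrier L"
  shows "env_emb L x = env_emb L y \<longleftrightarrow> x = y"
  using assms by (metis env_emb_subset_iff le_antisym subset_refl)

end

section \<open>Boolean algebras\<close>

locale boolean_order = bounded_distrib_lattice L for L (structure) +
  assumes complement_exists: "x \<in> carrier L \<Longrightarrow> \<exists>y. is_compl L x y"
begin

text \<open>
  Under the representation by prime filters complements become set complements, which makes them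
  unique.
\<close>

lemma is_compl_env_emb:
  assumes "x \<in> carrier L"
  shows "is_compl L x y \<longleftrightarrow> y \<in> carrier L \<and> env_emb L y = {P. prime_filter L P} - env_emb L x"
proof -
  have "env_emb L z \<subseteq> {P. prime_filter L P}" for z by (auto simp: env_emb_def)
  moreover have "is_compl L x y \<longleftrightarrow> y \<in> carrier L \<and> env_emb L (x \<sqinter> y) = env_emb L \<bottom>
      \<and> env_emb L (x \<squnion> y) = env_emb L \<top>"
    unfolding is_compl_def using assms by (auto simp: env_emb_eq_iff)
  ultimately show ?thesis using assms
    by (auto simp: env_emb_meet env_emb_join env_emb_top env_emb_bottom)
qed

lemma compl_is_compl:
  assumes "x \<in> carrier L" shows "is_compl L x (compl L x)"
proof -
  obtain y where y: "is_compl L x y" using complement_exists assms by blast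
  have "z = y" if "is_compl L x z" for z
    using y that assms by (metis env_emb_eq_iff is_compl_env_emb)
  then show ?thesis unfolding compl_def using y by (metis theI)
qed

lemma compl_closed [simp]: "x \<in> carrier L \<Longrightarrow> compl L x \<in> carrier L"
  using compl_is_compl by (auto simp: is_compl_def)

lemma env_emb_compl:
  "x \<in> carrier L \<Longrightarrow> env_emb L (compl L x) = {P. prime_filter L P} - env_emb L x"
  using compl_is_compl is_compl_env_emb by blast

lemma compl_eqI:
  assumes "x \<in> carrier L" "y \<in> carrier L" "x \<sqinter> y = \<bottom>" "x \<squnion> y = \<top>"
  shows "compl L x = y"
proof -
  have "is_compl L x y" using assms by (simp add: is_compl_def)
  then show ?thesis using assms by (metis compl_closed env_emb_compl env_emb_eq_iff is_compl_env_emb)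
qed

lemma meet_compl [simp]: "x \<in> carrier L \<Longrightarrow> x \<sqinter> compl L x = \<bottom>"
  and join_compl [simp]: "x \<in> carrier L \<Longrightarrow> x \<squnion> compl L x = \<top>"
  using compl_is_compl by (auto simp: is_compl_def)

lemmas env_emb_simps =
  env_emb_meet env_emb_join env_emb_top env_emb_bottom env_emb_compl

lemma le_iff_env_emb: "\<lbrakk>x \<in> carrier L; y \<in> carrier L\<rbrakk> \<Longrightarrow> x \<sqsubseteq> y \<longleftrightarrow> env_emb L x \<subseteq> env_emb L y"
  by (simp add: env_emb_subset_iff)

lemma env_emb_sub: "env_emb L x \<subseteq> {P. prime_filter L P}"
  by (auto simp: env_emb_def)

text \<open>
  Since \<open>x \<mapsto> env_emb L x\<close> embeds \<open>L\<close> into a field of sets, finite Boolean identities are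
  set-theoretic tautologies.
\<close>

lemma shunt:
  assumes "x \<in> carrier L" "y \<in> carrier L" "z \<in> carrier L"
  shows "x \<sqinter> compl L y \<sqsubseteq> z \<longleftrightarrow> x \<sqsubseteq> y \<squnion> z"
  using assms env_emb_sub[of x] by (auto simp: le_iff_env_emb env_emb_simps)

lemma shunt':
  assumes "x \<in> carrier L" "y \<in> carrier L" "z \<in> carrier L"
  shows "x \<sqinter> y \<sqsubseteq> z \<longleftrightarrow> x \<sqsubseteq> compl L y \<squnion> z"
  using assms env_emb_sub[of x] by (auto simp: le_iff_env_emb env_emb_simps)

lemma compl_compl: "x \<in> carrier L \<Longrightarrow> compl L (compl L x) = x"
  using env_emb_sub[of x] by (subst env_emb_eq_iff[symmetric]) (auto simp: env_emb_simps)

end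

lemma boolean_lattice_iff: "boolean_lattice L \<longleftrightarrow> boolean_order L"
  unfolding boolean_lattice_def boolean_order_def boolean_order_axioms_def
    bounded_distrib_lattice_def bounded_distrib_lattice_axioms_def by blast

section \<open>Boolean morphisms and generated subalgebras\<close>

lemma boolean_homI:
  assumes "boolean_order B" "boolean_order B'" "\<And>x. x \<in> carrier B \<Longrightarrow> f x \<in> carrier B'"
    "\<And>x y. \<lbrakk>x \<in> carrier B; y \<in> carrier B\<rbrakk> \<Longrightarrow> f (x \<squnion>\<^bsub>B\<^esub> y) = f x \<squnion>\<^bsub>B'\<^esub> f y"
    "\<And>x y. \<lbrakk>x \<in> carrier B; y \<in> carrier B\<rbrakk> \<Longrightarrow> f (x \<sqinter>\<^bsub>B\<^esub> y) = f x \<sqinter>\<^bsub>B'\<^esub> f y"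
    "f \<bottom>\<^bsub>B\<^esub> = \<bottom>\<^bsub>B'\<^esub>" "f \<top>\<^bsub>B\<^esub> = \<top>\<^bsub>B'\<^esub>"
  shows "boolean_hom B B' f"
proof -
  interpret B: boolean_order B by fact
  interpret B': boolean_order B' by fact
  have "compl B' (f x) = f (compl B x)" if "x \<in> carrier B" for x
    by (rule B'.compl_eqI) (use that assms in \<open>simp_all flip: assms(4,5)\<close>)
  then show ?thesis
    unfolding boolean_hom_def join_pres_def meet_pres_def
    using assms B.lattice_axioms B'.lattice_axioms by simp
qed

lemma boolean_homD:
  assumes "boolean_hom B B' f"
  shows "x \<in> carrier B \<Longrightarrow> f x \<in> carrier B'"
    "\<lbrakk>x \<in> carrier B; y \<in> carrier B\<rbrakk> \<Longrightarrow> f (x \<squnion>\<^bsub>B\<^esub> y) = f x \<squnion>\<^bsub>B'\<^esub> f y"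
    "\<lbrakk>x \<in> carrier B; y \<in> carrier B\<rbrakk> \<Longrightarrow> f (x \<sqinter>\<^bsub>B\<^esub> y) = f x \<sqinter>\<^bsub>B'\<^esub> f y"
    "f \<bottom>\<^bsub>B\<^esub> = \<bottom>\<^bsub>B'\<^esub>" "f \<top>\<^bsub>B\<^esub> = \<top>\<^bsub>B'\<^esub>"
    "x \<in> carrier B \<Longrightarrow> f (compl B x) = compl B' (f x)"
  using assms by (auto simp: boolean_hom_def join_pres_def meet_pres_def)

lemma meet_preserving_mono:
  assumes "lattice L" "lattice L'" "x \<in> carrier L" "y \<in> carrier L" "x \<sqsubseteq>\<^bsub>L\<^esub> y"
    "f x \<in> carrier L'" "f y \<in> carrier L'" "f (x \<sqinter>\<^bsub>L\<^esub> y) = f x \<sqinter>\<^bsub>L'\<^esub> f y"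
  shows "f x \<sqsubseteq>\<^bsub>L'\<^esub> f y"
  using assms by (metis lattice.le_iff_join)

lemma boolean_hom_mono:
  assumes "boolean_hom B B' f" "x \<in> carrier B" "y \<in> carrier B" "x \<sqsubseteq>\<^bsub>B\<^esub> y"
  shows "f x \<sqsubseteq>\<^bsub>B'\<^esub> f y"
  by (rule meet_preserving_mono[of B B'])
    (use assms boolean_homD[OF assms(1)] in \<open>simp_all add: boolean_hom_def meet_pres_def\<close>)

lemma boolean_hom_comp:
  assumes "boolean_order B1" "boolean_order B2" "boolean_order B3"
    "boolean_hom B1 B2 f" "boolean_hom B2 B3 g"
  shows "boolean_hom B1 B3 (\<lambda>x. g (f x))"
  by (rule boolean_homI) (use assms boolean_homD[OF assms(4)] boolean_homD[OF assms(5)] in simp_all)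

lemma boolean_hom_cong:
  assumes "boolean_order B" "boolean_order B'" "boolean_hom B B' f"
    "\<And>x. x \<in> carrier B \<Longrightarrow> g x = f x"
  shows "boolean_hom B B' g"
proof -
  interpret B: boolean_order B by fact
  show ?thesis
    by (rule boolean_homI) (use assms boolean_homD[OF assms(3)] in simp_all)
qed

lemma boolean_subalgebraD:
  assumes "boolean_subalgebra B A"
  shows "A \<subseteq> carrier B" "\<bottom>\<^bsub>B\<^esub> \<in> A" "\<top>\<^bsub>B\<^esub> \<in> A"
    "\<lbrakk>x \<in> A; y \<in> A\<rbrakk> \<Longrightarrow> x \<sqinter>\<^bsub>B\<^esub> y \<in> A" "\<lbrakk>x \<in> A; y \<in> A\<rbrakk> \<Longrightarrow> x \<squnion>\<^bsub>B\<^esub> y \<in> A"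
    "x \<in> A \<Longrightarrow> compl B x \<in> A"
  using assms by (auto simp: boolean_subalgebra_def)

lemma boolean_subalgebra_suborder:
  assumes "boolean_order B" "boolean_subalgebra B A"
  shows "boolean_order (suborder B A)"
    and "\<lbrakk>x \<in> A; y \<in> A\<rbrakk> \<Longrightarrow> x \<squnion>\<^bsub>suborder B A\<^esub> y = x \<squnion>\<^bsub>B\<^esub> y"
    and "\<lbrakk>x \<in> A; y \<in> A\<rbrakk> \<Longrightarrow> x \<sqinter>\<^bsub>suborder B A\<^esub> y = x \<sqinter>\<^bsub>B\<^esub> y"
    and "\<bottom>\<^bsub>suborder B A\<^esub> = \<bottom>\<^bsub>B\<^esub>" and "\<top>\<^bsub>suborder B A\<^esub> = \<top>\<^bsub>B\<^esub>"
    and "x \<in> A \<Longrightarrow> compl (suborder B A) x = compl B x"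
proof -
  interpret B: boolean_order B by fact
  note A = boolean_subalgebraD[OF assms(2)]
  have AB: "x \<in> carrier B" if "x \<in> A" for x using that A(1) by blast
  interpret S: partial_order "suborder B A"
    by (rule B.partial_order_suborder[OF A(1)])
  show join: "x \<squnion>\<^bsub>suborder B A\<^esub> y = x \<squnion>\<^bsub>B\<^esub> y" if "x \<in> A" "y \<in> A" for x y
    by (rule S.join_eqI) (use that A AB in \<open>auto intro: B.join_left B.join_right B.join_le\<close>)
  show meet: "x \<sqinter>\<^bsub>suborder B A\<^esub> y = x \<sqinter>\<^bsub>B\<^esub> y" if "x \<in> A" "y \<in> A" for x y
    by (rule S.meet_eqI) (use that A AB in \<open>auto intro: B.meet_left B.meet_right B.meet_le\<close>)
  show bot: "\<bottom>\<^bsub>suborder B A\<^esub> = \<bottom>\<^bsub>B\<^esub>"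
    by (rule S.bottom_eqI) (use A AB in auto)
  show top: "\<top>\<^bsub>suborder B A\<^esub> = \<top>\<^bsub>B\<^esub>"
    by (rule S.top_eqI) (use A AB in auto)
  interpret S: lattice "suborder B A"
  proof (rule S.latticeI; simp)
    fix x y assume xy: "x \<in> A" "y \<in> A"
    show "\<exists>z\<in>A. x \<sqsubseteq>\<^bsub>B\<^esub> z \<and> y \<sqsubseteq>\<^bsub>B\<^esub> z \<and> (\<forall>w\<in>A. x \<sqsubseteq>\<^bsub>B\<^esub> w \<and> y \<sqsubseteq>\<^bsub>B\<^esub> w \<longrightarrow> z \<sqsubseteq>\<^bsub>B\<^esub> w)"
      by (rule bexI[of _ "x \<squnion>\<^bsub>B\<^esub> y"])
        (use xy A AB in \<open>auto intro: B.join_left B.join_right B.join_le\<close>)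
    show "\<exists>z\<in>A. z \<sqsubseteq>\<^bsub>B\<^esub> x \<and> z \<sqsubseteq>\<^bsub>B\<^esub> y \<and> (\<forall>w\<in>A. w \<sqsubseteq>\<^bsub>B\<^esub> x \<and> w \<sqsubseteq>\<^bsub>B\<^esub> y \<longrightarrow> w \<sqsubseteq>\<^bsub>B\<^esub> z)"
      by (rule bexI[of _ "x \<sqinter>\<^bsub>B\<^esub> y"])
        (use xy A AB in \<open>auto intro: B.meet_left B.meet_right B.meet_le\<close>)
  qed
  interpret S: bounded_lattice "suborder B A"
    by (rule S.bounded_latticeI[of "\<bottom>\<^bsub>B\<^esub>" "\<top>\<^bsub>B\<^esub>"]) (use A AB in auto)
  show *: "boolean_order (suborder B A)"
  proof (unfold_locales, goal_cases)
    case (1 x y z)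
    then show ?case using A AB by (simp add: join meet B.distrib)
  next
    case (2 x)
    then show ?case using A AB
      by (intro exI[of _ "compl B x"]) (simp add: is_compl_def join meet bot top)
  qed
  show "compl (suborder B A) x = compl B x" if "x \<in> A"
    by (rule boolean_order.compl_eqI[OF *]) (use that A AB in \<open>auto simp: join meet bot top\<close>)
qed

lemma boolean_hom_inclusion:
  assumes "boolean_order B" "boolean_subalgebra B A"
  shows "boolean_hom (suborder B A) B (\<lambda>x. x)"
  by (rule boolean_homI)
    (use assms boolean_subalgebra_suborder[OF assms] boolean_subalgebraD[OF assms(2)] in auto)

lemma (in boolean_order) carrier_boolean_subalgebra: "boolean_subalgebra L (carrier L)"
  by (simp add: boolean_subalgebra_def)

lemma generated_superset: "X \<subseteq> boolean_generated B X"
  by (auto simp: boolean_generated_def)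

lemma generated_least: "\<lbrakk>boolean_subalgebra B A; X \<subseteq> A\<rbrakk> \<Longrightarrow> boolean_generated B X \<subseteq> A"
  by (auto simp: boolean_generated_def)

lemma generated_boolean_subalgebra:
  assumes "boolean_order B" "X \<subseteq> carrier B"
  shows "boolean_subalgebra B (boolean_generated B X)"
proof -
  interpret boolean_order B by fact
  have "boolean_generated B X \<subseteq> carrier B"
    using generated_least carrier_boolean_subalgebra assms(2) by blast
  then show ?thesis
    unfolding boolean_subalgebra_def boolean_generated_def by blast
qed

text \<open>
  The Boolean envelope is generated inside a powerset and \<open>BS M\<close> inside \<open>M\<close>, but morphisms are
  defined on the generated algebra only. Hence generation is needed inside that algebra itself.
\<close>

lemma generated_subalgebra_suborder:
  assumes "boolean_order B" "boolean_subalgebra B A" "X \<subseteq> A"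
  shows "boolean_generated (suborder B A) X = boolean_generated B X"
proof -
  note ops = boolean_subalgebra_suborder[OF assms(1,2)]
  note A = boolean_subalgebraD[OF assms(2)]
  have "boolean_subalgebra (suborder B A) D \<longleftrightarrow> boolean_subalgebra B D \<and> D \<subseteq> A" for D
    using A(1) ops unfolding boolean_subalgebra_def by (auto simp: subset_iff)
  moreover have "boolean_subalgebra B (D \<inter> A)" if "boolean_subalgebra B D" for D
    using that assms(2) unfolding boolean_subalgebra_def by blast
  ultimately show ?thesis
    unfolding boolean_generated_def using assms(3) by blast
qed

text \<open>
  The preimage of the right-hand side and the image on the left-hand side are both subalgebras.
\<close>

lemma generated_image:
  assumes "boolean_order B" "boolean_order B'" "boolean_hom B B' f" "X \<subseteq> carrier B"
  shows "f ` boolean_generated B X = boolean_generated B' (f ` X)"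
proof
  interpret B: boolean_order B by fact
  note f = boolean_homD[OF assms(3)]
  note gen = boolean_subalgebraD[OF generated_boolean_subalgebra[OF assms(1,4)]]
  have fX: "f ` X \<subseteq> carrier B'" using assms(4) f(1) by blast
  note gen' = boolean_subalgebraD[OF generated_boolean_subalgebra[OF assms(2) fX]]
  have "boolean_subalgebra B {x \<in> carrier B. f x \<in> boolean_generated B' (f ` X)}"
    unfolding boolean_subalgebra_def using gen' f by auto
  then have "boolean_generated B X \<subseteq> {x \<in> carrier B. f x \<in> boolean_generated B' (f ` X)}"
    by (rule generated_least) (use assms(4) generated_superset[of "f ` X" B'] in auto)
  then show "f ` boolean_generated B X \<subseteq> boolean_generated B' (f ` X)" by blast
  have c: "x \<in> carrier B" if "x \<in> boolean_generated B X" for x using gen(1) that by blast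
  have "boolean_subalgebra B' (f ` boolean_generated B X)"
    unfolding boolean_subalgebra_def
  proof (intro conjI ballI)
    show "f ` boolean_generated B X \<subseteq> carrier B'" using c f(1) by blast
    show "\<bottom>\<^bsub>B'\<^esub> \<in> f ` boolean_generated B X" "\<top>\<^bsub>B'\<^esub> \<in> f ` boolean_generated B X"
      using gen(2,3) f(4,5) by (metis imageI)+
  next
    fix u v assume "u \<in> f ` boolean_generated B X" "v \<in> f ` boolean_generated B X"
    then obtain x y where xy: "x \<in> boolean_generated B X" "y \<in> boolean_generated B X"
      "u = f x" "v = f y" by blast
    show "u \<sqinter>\<^bsub>B'\<^esub> v \<in> f ` boolean_generated B X"
      by (rule image_eqI[of _ _ "x \<sqinter>\<^bsub>B\<^esub> y"]) (use xy c gen f in auto)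
    show "u \<squnion>\<^bsub>B'\<^esub> v \<in> f ` boolean_generated B X"
      by (rule image_eqI[of _ _ "x \<squnion>\<^bsub>B\<^esub> y"]) (use xy c gen f in auto)
  next
    fix u assume "u \<in> f ` boolean_generated B X"
    then obtain x where x: "x \<in> boolean_generated B X" "u = f x" by blast
    show "compl B' u \<in> f ` boolean_generated B X"
      by (rule image_eqI[of _ _ "compl B x"]) (use x c gen f in auto)
  qed
  then show "boolean_generated B' (f ` X) \<subseteq> f ` boolean_generated B X"
    by (rule generated_least) (use generated_superset[of X B] in blast)
qed

text \<open>
  Two Boolean morphisms agree on a subalgebra, so agreement on generators suffices.
\<close>

lemma boolean_homs_agree:
  assumes "boolean_order B" "boolean_hom B B' f" "boolean_hom B B' g" "X \<subseteq> carrier B"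
    "\<And>x. x \<in> X \<Longrightarrow> f x = g x" "x \<in> boolean_generated B X"
  shows "f x = g x"
proof -
  interpret B: boolean_order B by fact
  note f = boolean_homD[OF assms(2)] and g = boolean_homD[OF assms(3)]
  have "boolean_subalgebra B {x \<in> carrier B. f x = g x}"
    unfolding boolean_subalgebra_def by (auto simp: f g)
  then have "boolean_generated B X \<subseteq> {x \<in> carrier B. f x = g x}"
    by (rule generated_least) (use assms(4,5) in blast)
  then show ?thesis using assms(6) by blast
qed

section \<open>The Boolean envelope\<close>

locale field_of_sets =
  fixes F :: "('x set, 'm) gorder_scheme" (structure) and X :: "'x set"
  assumes eq_F: "eq F = (=)" and le_F: "le F = (\<subseteq>)"
    and sub_F: "A \<in> carrier F \<Longrightarrow> A \<subseteq> X" and empty_F: "{} \<in> carrier F"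
    and Un_F: "\<lbrakk>A \<in> carrier F; A' \<in> carrier F\<rbrakk> \<Longrightarrow> A \<union> A' \<in> carrier F"
    and Diff_F: "A \<in> carrier F \<Longrightarrow> X - A \<in> carrier F"
begin

lemma space_F: "X \<in> carrier F"
  using empty_F Diff_F by fastforce

lemma Int_F: "\<lbrakk>A \<in> carrier F; A' \<in> carrier F\<rbrakk> \<Longrightarrow> A \<inter> A' \<in> carrier F"
proof -
  assume A: "A \<in> carrier F" "A' \<in> carrier F"
  then have "A \<inter> A' = X - ((X - A) \<union> (X - A'))" using sub_F by blast
  then show ?thesis using A Un_F Diff_F by metis
qed

sublocale partial_order F
  by (rule partial_order_inclusion[OF eq_F le_F])

lemma join_F: "\<lbrakk>A \<in> carrier F; A' \<in> carrier F\<rbrakk> \<Longrightarrow> A \<squnion> A' = A \<union> A'"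
  by (rule join_eqI) (auto simp: le_F Un_F)

lemma meet_F: "\<lbrakk>A \<in> carrier F; A' \<in> carrier F\<rbrakk> \<Longrightarrow> A \<sqinter> A' = A \<inter> A'"
  by (rule meet_eqI) (auto simp: le_F Int_F)

lemma bottom_F: "\<bottom> = {}"
  by (rule bottom_eqI) (auto simp: le_F empty_F)

lemma top_F: "\<top> = X"
  by (rule top_eqI) (auto simp: le_F space_F sub_F)

lemma boolean_order_F: "boolean_order F"
proof -
  interpret lattice F
  proof (rule latticeI)
    fix x y assume xy: "x \<in> carrier F" "y \<in> carrier F"
    show "\<exists>z\<in>carrier F. x \<sqsubseteq> z \<and> y \<sqsubseteq> z \<and> (\<forall>w\<in>carrier F. x \<sqsubseteq> w \<and> y \<sqsubseteq> w \<longrightarrow> z \<sqsubseteq> w)"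
      by (rule bexI[of _ "x \<union> y"]) (use xy in \<open>auto simp: le_F Un_F\<close>)
    show "\<exists>z\<in>carrier F. z \<sqsubseteq> x \<and> z \<sqsubseteq> y \<and> (\<forall>w\<in>carrier F. w \<sqsubseteq> x \<and> w \<sqsubseteq> y \<longrightarrow> w \<sqsubseteq> z)"
      by (rule bexI[of _ "x \<inter> y"]) (use xy in \<open>auto simp: le_F Int_F\<close>)
  qed
  interpret bounded_lattice F
    by (rule bounded_latticeI[of "{}" X]) (auto simp: le_F empty_F space_F sub_F)
  show ?thesis
  proof (unfold_locales, goal_cases)
    case (1 x y z)
    then show ?case by (auto simp: join_F meet_F Un_F Int_F)
  next
    case (2 x)
    then show ?case
      by (intro exI[of _ "X - x"])
        (auto simp: is_compl_def join_F meet_F bottom_F top_F Diff_F dest: sub_F)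
  qed
qed

sublocale boolean_order F by (rule boolean_order_F)

lemma compl_F: "A \<in> carrier F \<Longrightarrow> compl F A = X - A"
  by (rule compl_eqI) (auto simp: join_F meet_F bottom_F top_F Diff_F dest: sub_F)

lemmas set_ops = join_F meet_F bottom_F top_F compl_F

end

lemma field_of_sets_pow_order: "field_of_sets (pow_order X) X"
  by unfold_locales (auto simp: pow_order_def)

abbreviation Spec :: "('a, 'b) gorder_scheme \<Rightarrow> 'a set set" where
  "Spec C \<equiv> {P. prime_filter C P}"

lemma env_emb_subset_Spec: "env_emb C c \<subseteq> Spec C"
  by (auto simp: env_emb_def)

lemma boolean_subalgebra_envelope:
  "boolean_subalgebra (pow_order (Spec C)) (carrier (boolean_envelope C))"
proof -
  interpret field_of_sets "pow_order (Spec C)" "Spec C" by (rule field_of_sets_pow_order)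
  show ?thesis
    unfolding boolean_envelope_def using env_emb_subset_Spec[of C]
    by (simp, intro generated_boolean_subalgebra boolean_order_axioms)
      (auto simp: pow_order_def)
qed

lemma field_of_sets_envelope: "field_of_sets (boolean_envelope C) (Spec C)"
proof -
  interpret field_of_sets "pow_order (Spec C)" "Spec C" by (rule field_of_sets_pow_order)
  note A = boolean_subalgebraD[OF boolean_subalgebra_envelope[of C]]
  have c: "A \<in> carrier (pow_order (Spec C))" if "A \<in> carrier (boolean_envelope C)" for A
    using A(1) that by blast
  show ?thesis
  proof
    show "eq (boolean_envelope C) = (=)" "le (boolean_envelope C) = (\<subseteq>)"
      by (simp_all add: boolean_envelope_def pow_order_def)
    show "A \<subseteq> Spec C" if "A \<in> carrier (boolean_envelope C)" for A
      using c[OF that] by (simp add: pow_order_def)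
    show "{} \<in> carrier (boolean_envelope C)" using A(2) by (simp add: bottom_F)
    show "A \<union> A' \<in> carrier (boolean_envelope C)"
      if "A \<in> carrier (boolean_envelope C)" "A' \<in> carrier (boolean_envelope C)" for A A'
      using A(5)[OF that] that c by (simp add: join_F)
    show "Spec C - A \<in> carrier (boolean_envelope C)" if "A \<in> carrier (boolean_envelope C)" for A
      using A(6)[OF that] that c by (simp add: compl_F)
  qed
qed

interpretation env: field_of_sets "boolean_envelope C" "Spec C" for C
  by (rule field_of_sets_envelope)

lemma env_emb_in_envelope: "c \<in> carrier C \<Longrightarrow> env_emb C c \<in> carrier (boolean_envelope C)"
  unfolding boolean_envelope_def using generated_superset by fastforce

lemma envelope_generated:
  "boolean_generated (boolean_envelope C) (env_emb C ` carrier C) = carrier (boolean_envelope C)"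
proof -
  interpret field_of_sets "pow_order (Spec C)" "Spec C" by (rule field_of_sets_pow_order)
  have "boolean_generated (suborder (pow_order (Spec C)) (carrier (boolean_envelope C)))
      (env_emb C ` carrier C) = boolean_generated (pow_order (Spec C)) (env_emb C ` carrier C)"
    by (rule generated_subalgebra_suborder[OF boolean_order_axioms boolean_subalgebra_envelope])
      (simp add: image_subset_iff env_emb_in_envelope)
  then show ?thesis by (simp add: boolean_envelope_def)
qed

lemma envelope_subset:
  assumes "boolean_subalgebra (boolean_envelope C) A"
    and "\<And>c. c \<in> carrier C \<Longrightarrow> env_emb C c \<in> A"
  shows "carrier (boolean_envelope C) \<subseteq> A"
  using generated_least[OF assms(1), of "env_emb C ` carrier C"] assms(2)
  by (simp add: envelope_generated image_subset_iff)

definition bounded_lattice_hom ::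
    "('a, 'c) gorder_scheme \<Rightarrow> ('b, 'd) gorder_scheme \<Rightarrow> ('a \<Rightarrow> 'b) \<Rightarrow> bool" where
  "bounded_lattice_hom L L' h \<longleftrightarrow> h \<in> carrier L \<rightarrow> carrier L' \<and>
     (\<forall>x\<in>carrier L. \<forall>y\<in>carrier L. h (x \<sqinter>\<^bsub>L\<^esub> y) = h x \<sqinter>\<^bsub>L'\<^esub> h y \<and> h (x \<squnion>\<^bsub>L\<^esub> y) = h x \<squnion>\<^bsub>L'\<^esub> h y) \<and>
     h \<bottom>\<^bsub>L\<^esub> = \<bottom>\<^bsub>L'\<^esub> \<and> h \<top>\<^bsub>L\<^esub> = \<top>\<^bsub>L'\<^esub>"

lemma prime_filter_vimage:
  assumes "bounded_distrib_lattice L" "bounded_distrib_lattice L'" "bounded_lattice_hom L L' h" "prime_filter L' Q"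
  shows "prime_filter L {c \<in> carrier L. h c \<in> Q}"
proof -
  interpret L: bounded_distrib_lattice L by fact
  interpret L': bounded_distrib_lattice L' by fact
  have h: "\<And>x. x \<in> carrier L \<Longrightarrow> h x \<in> carrier L'"
    "\<And>x y. \<lbrakk>x \<in> carrier L; y \<in> carrier L\<rbrakk> \<Longrightarrow> h (x \<sqinter>\<^bsub>L\<^esub> y) = h x \<sqinter>\<^bsub>L'\<^esub> h y"
    "\<And>x y. \<lbrakk>x \<in> carrier L; y \<in> carrier L\<rbrakk> \<Longrightarrow> h (x \<squnion>\<^bsub>L\<^esub> y) = h x \<squnion>\<^bsub>L'\<^esub> h y"
    "h \<bottom>\<^bsub>L\<^esub> = \<bottom>\<^bsub>L'\<^esub>" "h \<top>\<^bsub>L\<^esub> = \<top>\<^bsub>L'\<^esub>"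
    using assms(3) unfolding bounded_lattice_hom_def by auto
  have up: "h y \<in> Q" if "x \<in> carrier L" "y \<in> carrier L" "x \<sqsubseteq>\<^bsub>L\<^esub> y" "h x \<in> Q" for x y
    using L'.prime_filter_meet_iff[OF assms(4), of "h x" "h y"] that h
    by (metis L.le_iff_join)
  have "\<top>\<^bsub>L'\<^esub> \<in> Q" "\<bottom>\<^bsub>L'\<^esub> \<notin> Q" using assms(4) by (auto simp: prime_filter_def)
  then show ?thesis
    unfolding prime_filter_def mem_Collect_eq
    by (intro conjI ballI impI)
      (simp_all add: h up L'.prime_filter_meet_iff[OF assms(4)] L'.prime_filter_join_iff[OF assms(4)],
       meson up)
qed

text \<open>
  The extension of \<open>h\<close> to the envelope is dual to the map \<open>Spec B \<rightarrow> Spec C\<close>, \<open>Q \<mapsto> h\<^sup>-\<^sup>1 Q\<close>: it sends a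
  set \<open>x\<close> of prime filters to the element of \<open>B\<close> represented by the preimage of \<open>x\<close>. Those \<open>x\<close> whose
  preimage is represented form a Boolean subalgebra that contains the image of \<open>C\<close>.
\<close>

lemma envelope_extension:
  assumes "bounded_distrib_lattice C" "boolean_order B" "bounded_lattice_hom C B h"
  shows "\<exists>g. boolean_hom (boolean_envelope C) B g \<and> (\<forall>c\<in>carrier C. g (env_emb C c) = h c)"
proof -
  interpret C: bounded_distrib_lattice C by fact
  interpret B: boolean_order B by fact
  define pull where "pull Q = {c \<in> carrier C. h c \<in> Q}" for Q
  have pull: "pull Q \<in> Spec C" if "Q \<in> Spec B" for Q
    unfolding pull_def using prime_filter_vimage[OF assms(1) B.bounded_distrib_lattice_axioms assms(3)] that by simp
  define pre where "pre x = {Q \<in> Spec B. pull Q \<in> x}" for x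
  define rep where "rep x b \<longleftrightarrow> b \<in> carrier B \<and> env_emb B b = pre x" for x b
  have h: "h c \<in> carrier B" if "c \<in> carrier C" for c
    using assms(3) that unfolding bounded_lattice_hom_def by blast
  have gen: "rep (env_emb C c) (h c)" if "c \<in> carrier C" for c
    unfolding rep_def pre_def using that h pull by (auto simp: env_emb_def pull_def)
  have bot: "rep \<bottom>\<^bsub>boolean_envelope C\<^esub> \<bottom>\<^bsub>B\<^esub>" and top: "rep \<top>\<^bsub>boolean_envelope C\<^esub> \<top>\<^bsub>B\<^esub>"
    unfolding rep_def pre_def env.bottom_F env.top_F using pull
    by (auto simp: B.env_emb_simps)
  have ops: "rep (x \<squnion>\<^bsub>boolean_envelope C\<^esub> y) (a \<squnion>\<^bsub>B\<^esub> b)" "rep (x \<sqinter>\<^bsub>boolean_envelope C\<^esub> y) (a \<sqinter>\<^bsub>B\<^esub> b)"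
    if "x \<in> carrier (boolean_envelope C)" "y \<in> carrier (boolean_envelope C)" "rep x a" "rep y b" for x y a b
    using that unfolding rep_def pre_def by (auto simp: env.set_ops B.env_emb_simps)
  have comp: "rep (compl (boolean_envelope C) x) (compl B a)"
    if "x \<in> carrier (boolean_envelope C)" "rep x a" for x a
    using that pull unfolding rep_def pre_def by (auto simp: env.set_ops B.env_emb_simps)
  have "boolean_subalgebra (boolean_envelope C) {x \<in> carrier (boolean_envelope C). \<exists>b. rep x b}"
    unfolding boolean_subalgebra_def using bot top ops comp by (auto, blast+)
  then have "carrier (boolean_envelope C) \<subseteq> {x \<in> carrier (boolean_envelope C). \<exists>b. rep x b}"
    by (rule envelope_subset) (use gen env_emb_in_envelope in auto)
  then have ex: "\<exists>b. rep x b" if "x \<in> carrier (boolean_envelope C)" for x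
    using that by auto
  have unique: "a = b" if "rep x a" "rep x b" for x a b
    using that B.env_emb_eq_iff unfolding rep_def by metis
  define g where "g x = (SOME b. rep x b)" for x
  have rep: "rep x (g x)" if "x \<in> carrier (boolean_envelope C)" for x
    unfolding g_def using ex[OF that] by (rule someI_ex)
  have "boolean_hom (boolean_envelope C) B g"
  proof (rule boolean_homI[OF env.boolean_order_F assms(2)])
    show "g x \<in> carrier B" if "x \<in> carrier (boolean_envelope C)" for x
      using rep[OF that] by (simp add: rep_def)
  qed (use rep unique ops bot top env.join_closed env.meet_closed env.bottom_closed env.top_closed in meson)+
  moreover have "g (env_emb C c) = h c" if "c \<in> carrier C" for c
    using unique rep gen env_emb_in_envelope that by metis
  ultimately show ?thesis by blast
qed

lemma envelope_homs_agree:
  assumes "boolean_hom (boolean_envelope C) B f" "boolean_hom (boolean_envelope C) B g"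
    "\<And>c. c \<in> carrier C \<Longrightarrow> f (env_emb C c) = g (env_emb C c)" "x \<in> carrier (boolean_envelope C)"
  shows "f x = g x"
  by (rule boolean_homs_agree[OF env.boolean_order_F assms(1,2), of "env_emb C ` carrier C"])
    (use assms(3,4) in \<open>auto simp: env_emb_in_envelope envelope_generated\<close>)

lemma env_lift:
  assumes "bounded_distrib_lattice C" "boolean_order B" "bounded_lattice_hom C B h"
  shows env_lift_hom: "boolean_hom (boolean_envelope C) B (env_lift C B h)"
    and env_lift_emb: "c \<in> carrier C \<Longrightarrow> env_lift C B h (env_emb C c) = h c"
proof -
  let ?Q = "\<lambda>g. g \<in> extensional (carrier (boolean_envelope C)) \<and>
    boolean_hom (boolean_envelope C) B g \<and> (\<forall>c\<in>carrier C. g (env_emb C c) = h c)"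
  obtain g where g: "boolean_hom (boolean_envelope C) B g" "\<And>c. c \<in> carrier C \<Longrightarrow> g (env_emb C c) = h c"
    using envelope_extension[OF assms] by blast
  have Q: "?Q (restrict g (carrier (boolean_envelope C)))"
    using boolean_hom_cong[OF env.boolean_order_F assms(2) g(1), of "restrict g (carrier (boolean_envelope C))"]
      g(2) by (simp add: env_emb_in_envelope)
  have unique: "f = f'" if "?Q f" "?Q f'" for f f'
  proof (rule extensionalityI)
    show "f x = f' x" if "x \<in> carrier (boolean_envelope C)" for x
      by (rule envelope_homs_agree[of C B]) (use that \<open>?Q f\<close> \<open>?Q f'\<close> in auto)
  qed (use that in auto)
  have "?Q (env_lift C B h)"
    unfolding env_lift_def by (rule theI[of ?Q, OF Q]) (rule unique[OF _ Q])
  then show "boolean_hom (boolean_envelope C) B (env_lift C B h)"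
    "c \<in> carrier C \<Longrightarrow> env_lift C B h (env_emb C c) = h c" by auto
qed

text \<open>
  The differences of elements of \<open>C\<close> form a base of a topology on \<open>Spec C\<close>, because they are closed
  under finite intersections. The clopen sets of this topology are a Boolean subalgebra that
  contains \<open>C\<close>, hence the envelope consists of clopen sets.
\<close>

lemma envelope_base:
  assumes "bounded_distrib_lattice C" "x \<in> carrier (boolean_envelope C)" "P \<in> x"
  obtains a d where "a \<in> carrier C" "d \<in> carrier C" "P \<in> env_emb C a - env_emb C d"
    "env_emb C a - env_emb C d \<subseteq> x"
proof -
  interpret C: bounded_distrib_lattice C by fact
  let ?E = "boolean_envelope C"
  define nb where "nb P x \<longleftrightarrow> (\<exists>a\<in>carrier C. \<exists>d\<in>carrier C.
    P \<in> env_emb C a - env_emb C d \<and> env_emb C a - env_emb C d \<subseteq> x)" for P x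
  have nb_mono: "nb P y" if "nb P x" "x \<subseteq> y" for P x y
    using that unfolding nb_def by blast
  have nb_Int: "nb P (x \<inter> y)" if "nb P x" "nb P y" for P x y
  proof -
    from that obtain a d a' d' where c: "a \<in> carrier C" "d \<in> carrier C" "a' \<in> carrier C" "d' \<in> carrier C"
      and P: "P \<in> env_emb C a - env_emb C d" "P \<in> env_emb C a' - env_emb C d'"
      and sub: "env_emb C a - env_emb C d \<subseteq> x" "env_emb C a' - env_emb C d' \<subseteq> y"
      unfolding nb_def by blast
    show ?thesis
      unfolding nb_def
      by (rule bexI[of _ "a \<sqinter>\<^bsub>C\<^esub> a'"], rule bexI[of _ "d \<squnion>\<^bsub>C\<^esub> d'"])
        (use c P sub in \<open>auto simp: C.env_emb_meet C.env_emb_join\<close>)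
  qed
  define clopen where "clopen x \<longleftrightarrow> (\<forall>P\<in>x. nb P x) \<and> (\<forall>P\<in>Spec C - x. nb P (Spec C - x))" for x
  have Un: "clopen (x \<union> y)" if "clopen x" "clopen y" for x y
  proof -
    have "nb P (Spec C - (x \<union> y))" if "P \<in> Spec C - (x \<union> y)" for P
    proof -
      have "nb P ((Spec C - x) \<inter> (Spec C - y))"
        using that \<open>clopen x\<close> \<open>clopen y\<close> by (intro nb_Int) (auto simp: clopen_def)
      then show ?thesis by (rule nb_mono) blast
    qed
    moreover have "nb P (x \<union> y)" if "P \<in> x \<union> y" for P
      using that \<open>clopen x\<close> \<open>clopen y\<close> unfolding clopen_def by (meson Un_iff nb_mono sup_ge1 sup_ge2)
    ultimately show ?thesis by (simp add: clopen_def)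
  qed
  have Compl: "clopen (Spec C - x)" if "clopen x" "x \<subseteq> Spec C" for x
    using that by (simp add: clopen_def double_diff)
  have emb: "clopen (env_emb C c)" if "c \<in> carrier C" for c
  proof -
    have "nb P (env_emb C c)" if "P \<in> env_emb C c" for P
      unfolding nb_def
      by (rule bexI[of _ c], rule bexI[of _ "\<bottom>\<^bsub>C\<^esub>"]) (use that \<open>c \<in> carrier C\<close> in \<open>auto simp: C.env_emb_bottom\<close>)
    moreover have "nb P (Spec C - env_emb C c)" if "P \<in> Spec C - env_emb C c" for P
      unfolding nb_def
      by (rule bexI[of _ "\<top>\<^bsub>C\<^esub>"], rule bexI[of _ c]) (use that \<open>c \<in> carrier C\<close> in \<open>auto simp: C.env_emb_top\<close>)
    ultimately show ?thesis by (simp add: clopen_def)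
  qed
  have empty: "clopen {}" using emb[of "\<bottom>\<^bsub>C\<^esub>"] by (simp add: C.env_emb_bottom)
  have full: "clopen (Spec C)" using emb[of "\<top>\<^bsub>C\<^esub>"] by (simp add: C.env_emb_top)
  have Int: "clopen (x \<inter> y)" if "clopen x" "clopen y" "x \<subseteq> Spec C" "y \<subseteq> Spec C" for x y
  proof -
    have "x \<inter> y = Spec C - ((Spec C - x) \<union> (Spec C - y))" using that by blast
    then show ?thesis using that Un Compl by (metis Diff_subset Un_least)
  qed
  have "boolean_subalgebra ?E {x \<in> carrier ?E. clopen x}"
    unfolding boolean_subalgebra_def
    using empty full
    by (auto intro!: Un Int Compl env.sub_F simp del: env.le_refl simp: env.set_ops env.Un_F env.Int_F env.Diff_F env.space_F env.empty_F)
  then have "carrier ?E \<subseteq> {x \<in> carrier ?E. clopen x}"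
    by (rule envelope_subset) (simp add: emb env_emb_in_envelope)
  then have "clopen x" using assms(2) by auto
  then show thesis using assms(3) that unfolding clopen_def nb_def by blast
qed

section \<open>Complete Boolean algebras and coframes\<close>

locale complete_boolean = complete_lattice L + boolean_order L for L (structure)
begin

text \<open>
  Both infinite distributive laws come from residuation: \<open>x \<sqinter> compl L y \<sqsubseteq> z\<close> iff \<open>x \<sqsubseteq> y \<squnion> z\<close>.
\<close>

lemma join_Inf:
  assumes "a \<in> carrier L" "A \<subseteq> carrier L"
  shows "a \<squnion> \<Sqinter>A = \<Sqinter>((\<lambda>s. a \<squnion> s) ` A)"
proof (rule inf_eqI[symmetric])
  have c: "s \<in> carrier L" if "s \<in> A" for s using that assms by blast
  show "(\<lambda>s. a \<squnion> s) ` A \<subseteq> carrier L" using c assms by auto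
  show "a \<squnion> \<Sqinter>A \<in> carrier L" using assms by simp
  show "a \<squnion> \<Sqinter>A \<sqsubseteq> b" if "b \<in> (\<lambda>s. a \<squnion> s) ` A" for b
    using that c assms
    by (auto intro!: join_le join_left intro: le_trans[OF inf_lower join_right])
  fix y assume y: "y \<in> carrier L" "\<And>b. b \<in> (\<lambda>s. a \<squnion> s) ` A \<Longrightarrow> y \<sqsubseteq> b"
  have "y \<sqinter> compl L a \<sqsubseteq> \<Sqinter>A"
    by (rule inf_greatest) (use y c assms in \<open>auto simp: shunt\<close>)
  then show "y \<sqsubseteq> a \<squnion> \<Sqinter>A" using y assms by (simp add: shunt)
qed

lemma meet_Sup:
  assumes "a \<in> carrier L" "A \<subseteq> carrier L"
  shows "a \<sqinter> \<Squnion>A = \<Squnion>((\<lambda>s. a \<sqinter> s) ` A)"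
proof (rule sup_eqI[symmetric])
  have c: "s \<in> carrier L" if "s \<in> A" for s using that assms by blast
  show "(\<lambda>s. a \<sqinter> s) ` A \<subseteq> carrier L" using c assms by auto
  show "a \<sqinter> \<Squnion>A \<in> carrier L" using assms by simp
  show "b \<sqsubseteq> a \<sqinter> \<Squnion>A" if "b \<in> (\<lambda>s. a \<sqinter> s) ` A" for b
    using that c assms
    by (auto intro!: meet_le meet_left intro: le_trans[OF meet_right sup_upper])
  fix y assume y: "y \<in> carrier L" "\<And>b. b \<in> (\<lambda>s. a \<sqinter> s) ` A \<Longrightarrow> b \<sqsubseteq> y"
  have "\<Squnion>A \<sqsubseteq> compl L a \<squnion> y"
    by (rule sup_least) (use y c assms in \<open>auto simp: shunt'[symmetric] meet_comm[of _ _ a]\<close>)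
  then show "a \<sqinter> \<Squnion>A \<sqsubseteq> y" using y assms by (simp add: shunt'[symmetric] meet_comm[of _ _ a])
qed

end

text \<open>
  For a two-element set the coframe law says that joins distribute over meets, and in every lattice
  this implies the dual law.
\<close>

lemma coframe_bounded_distrib_lattice:
  assumes "coframe C"
  shows "bounded_distrib_lattice C"
proof -
  interpret complete_lattice C using assms by (simp add: coframe_def)
  have codistrib: "x \<squnion>\<^bsub>C\<^esub> (y \<sqinter>\<^bsub>C\<^esub> z) = (x \<squnion>\<^bsub>C\<^esub> y) \<sqinter>\<^bsub>C\<^esub> (x \<squnion>\<^bsub>C\<^esub> z)"
    if "x \<in> carrier C" "y \<in> carrier C" "z \<in> carrier C" for x y z
  proof -
    have "x \<squnion>\<^bsub>C\<^esub> \<Sqinter>\<^bsub>C\<^esub> {y, z} = \<Sqinter>\<^bsub>C\<^esub> ((\<lambda>s. x \<squnion>\<^bsub>C\<^esub> s) ` {y, z})"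
      using assms[unfolded coframe_def, THEN conjunct2, rule_format, of x "{y, z}"] that by simp
    then show ?thesis by (simp add: meet_def)
  qed
  show ?thesis
  proof (unfold_locales, goal_cases)
    case (1 x y z)
    have "(x \<sqinter>\<^bsub>C\<^esub> y) \<squnion>\<^bsub>C\<^esub> (x \<sqinter>\<^bsub>C\<^esub> z) = ((x \<sqinter>\<^bsub>C\<^esub> y) \<squnion>\<^bsub>C\<^esub> x) \<sqinter>\<^bsub>C\<^esub> ((x \<sqinter>\<^bsub>C\<^esub> y) \<squnion>\<^bsub>C\<^esub> z)"
      using 1 by (intro codistrib) simp_all
    also have "(x \<sqinter>\<^bsub>C\<^esub> y) \<squnion>\<^bsub>C\<^esub> x = x"
      using 1 by (intro join_eqI) (auto intro: meet_left)
    also have "(x \<sqinter>\<^bsub>C\<^esub> y) \<squnion>\<^bsub>C\<^esub> z = (z \<squnion>\<^bsub>C\<^esub> x) \<sqinter>\<^bsub>C\<^esub> (z \<squnion>\<^bsub>C\<^esub> y)"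
      using 1 codistrib[of z x y] by (simp add: join_comm[of C _ z])
    also have "x \<sqinter>\<^bsub>C\<^esub> ((z \<squnion>\<^bsub>C\<^esub> x) \<sqinter>\<^bsub>C\<^esub> (z \<squnion>\<^bsub>C\<^esub> y)) = (x \<sqinter>\<^bsub>C\<^esub> (z \<squnion>\<^bsub>C\<^esub> x)) \<sqinter>\<^bsub>C\<^esub> (z \<squnion>\<^bsub>C\<^esub> y)"
      using 1 by (simp add: meet_assoc)
    also have "x \<sqinter>\<^bsub>C\<^esub> (z \<squnion>\<^bsub>C\<^esub> x) = x"
      using 1 by (intro meet_eqI) (auto intro: join_right)
    finally show ?case by (simp add: join_comm[of _ y z])
  qed
qed

section \<open>Suborders of complete lattices\<close>

lemma (in complete_lattice) Inf_in_suborder: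
  assumes "carrier N \<subseteq> carrier L" "le N = le L" "eq N = (=)"
    "A \<subseteq> carrier N" "\<Sqinter>A \<in> carrier N"
  shows "\<Sqinter>\<^bsub>N\<^esub> A = \<Sqinter>A"
proof -
  interpret N: partial_order N by (rule partial_order_restrict[OF partial_order_axioms assms(1-3)])
  have A: "A \<subseteq> carrier L" using assms(1,4) by blast
  show ?thesis
    by (rule N.inf_eqI)
      (use assms A in \<open>auto simp: assms(2) intro!: inf_greatest inf_lower[OF A]\<close>)
qed

lemma (in complete_lattice) Sup_in_suborder:
  assumes "carrier N \<subseteq> carrier L" "le N = le L" "eq N = (=)"
    "A \<subseteq> carrier N" "\<Squnion>A \<in> carrier N"
  shows "\<Squnion>\<^bsub>N\<^esub> A = \<Squnion>A"
proof -
  interpret N: partial_order N by (rule partial_order_restrict[OF partial_order_axioms assms(1-3)])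
  have A: "A \<subseteq> carrier L" using assms(1,4) by blast
  show ?thesis
    by (rule N.sup_eqI)
      (use assms A in \<open>auto simp: assms(2) intro!: sup_least sup_upper[OF A]\<close>)
qed

lemma (in complete_lattice) top_bottom_in_suborder:
  assumes "carrier N \<subseteq> carrier L" "le N = le L" "eq N = (=)"
  shows "\<top> \<in> carrier N \<Longrightarrow> \<top>\<^bsub>N\<^esub> = \<top>" and "\<bottom> \<in> carrier N \<Longrightarrow> \<bottom>\<^bsub>N\<^esub> = \<bottom>"
proof -
  interpret N: partial_order N by (rule partial_order_restrict[OF partial_order_axioms assms(1-3)])
  show "\<top> \<in> carrier N \<Longrightarrow> \<top>\<^bsub>N\<^esub> = \<top>"
    by (rule N.top_eqI) (use assms in auto)
  show "\<bottom> \<in> carrier N \<Longrightarrow> \<bottom>\<^bsub>N\<^esub> = \<bottom>"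
    by (rule N.bottom_eqI) (use assms in auto)
qed

lemma (in complete_lattice) complete_suborder_infs:
  assumes "carrier N \<subseteq> carrier L" "le N = le L" "eq N = (=)"
    "\<And>A. A \<subseteq> carrier N \<Longrightarrow> \<Sqinter>A \<in> carrier N"
  shows "complete_lattice N"
proof -
  interpret N: partial_order N by (rule partial_order_restrict[OF partial_order_axioms assms(1-3)])
  show ?thesis
  proof (rule N.complete_lattice_from_infs)
    fix A assume A: "A \<subseteq> carrier N"
    then have A': "A \<subseteq> carrier L" using assms(1) by blast
    show "\<exists>x\<in>carrier N. (\<forall>a\<in>A. x \<sqsubseteq>\<^bsub>N\<^esub> a) \<and> (\<forall>y\<in>carrier N. (\<forall>a\<in>A. y \<sqsubseteq>\<^bsub>N\<^esub> a) \<longrightarrow> y \<sqsubseteq>\<^bsub>N\<^esub> x)"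
      by (rule bexI[OF _ assms(4)[OF A]])
        (use assms(1) A' in \<open>auto simp: assms(2) intro!: inf_greatest inf_lower[OF A']\<close>)
  qed
qed

lemma (in complete_lattice) complete_suborder_sups:
  assumes "carrier N \<subseteq> carrier L" "le N = le L" "eq N = (=)"
    "\<And>A. A \<subseteq> carrier N \<Longrightarrow> \<Squnion>A \<in> carrier N"
  shows "complete_lattice N"
proof -
  interpret N: partial_order N by (rule partial_order_restrict[OF partial_order_axioms assms(1-3)])
  show ?thesis
  proof (rule N.complete_lattice_from_sups)
    fix A assume A: "A \<subseteq> carrier N"
    then have A': "A \<subseteq> carrier L" using assms(1) by blast
    show "\<exists>x\<in>carrier N. (\<forall>a\<in>A. a \<sqsubseteq>\<^bsub>N\<^esub> x) \<and> (\<forall>y\<in>carrier N. (\<forall>a\<in>A. a \<sqsubseteq>\<^bsub>N\<^esub> y) \<longrightarrow> x \<sqsubseteq>\<^bsub>N\<^esub> y)"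
      by (rule bexI[OF _ assms(4)[OF A]])
        (use assms(1) A' in \<open>auto simp: assms(2) intro!: sup_least sup_upper[OF A']\<close>)
  qed
qed

section \<open>Open and saturated elements\<close>

locale mt_alg =
  fixes M :: "'a mt" (structure)
  assumes mt: "mt_algebra M"

sublocale mt_alg \<subseteq> complete_boolean M
  using mt unfolding mt_algebra_def boolean_lattice_iff complete_boolean_def by blast

context mt_alg
begin

lemma
  shows box_closed [simp]: "a \<in> carrier M \<Longrightarrow> box M a \<in> carrier M"
    and box_top: "box M \<top> = \<top>"
    and box_meet: "\<lbrakk>a \<in> carrier M; b \<in> carrier M\<rbrakk> \<Longrightarrow> box M (a \<sqinter> b) = box M a \<sqinter> box M b"
    and box_le: "a \<in> carrier M \<Longrightarrow> box M a \<sqsubseteq> a"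
  using mt unfolding mt_algebra_def by auto

lemma box_mono: "\<lbrakk>a \<in> carrier M; b \<in> carrier M; a \<sqsubseteq> b\<rbrakk> \<Longrightarrow> box M a \<sqsubseteq> box M b"
  by (rule meet_preserving_mono[of M M]) (auto intro: lattice_axioms simp: box_meet)

lemma opens_carrier: "u \<in> opens M \<Longrightarrow> u \<in> carrier M"
  by (simp add: opens_def)

lemma open_iff: "u \<in> opens M \<longleftrightarrow> u \<in> carrier M \<and> u \<sqsubseteq> box M u"
  unfolding opens_def using box_le by (auto intro: le_antisym)

lemma open_top: "\<top> \<in> opens M"
  by (simp add: opens_def box_top)

lemma open_meet: "\<lbrakk>u \<in> opens M; v \<in> opens M\<rbrakk> \<Longrightarrow> u \<sqinter> v \<in> opens M"
  by (simp add: opens_def box_meet)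

lemma open_Sup:
  assumes "U \<subseteq> opens M" shows "\<Squnion>U \<in> opens M"
proof -
  have U: "U \<subseteq> carrier M" using assms opens_carrier by blast
  have "u \<sqsubseteq> box M (\<Squnion>U)" if "u \<in> U" for u
  proof -
    have "u \<sqsubseteq> box M u" "u \<in> carrier M" using assms that by (auto simp: open_iff)
    moreover have "box M u \<sqsubseteq> box M (\<Squnion>U)" using U that sup_upper[OF U that] by (auto intro: box_mono)
    ultimately show ?thesis using U by (auto intro: le_trans)
  qed
  then show ?thesis using U by (auto simp: open_iff intro!: sup_least)
qed

lemma open_join: "\<lbrakk>u \<in> opens M; v \<in> opens M\<rbrakk> \<Longrightarrow> u \<squnion> v \<in> opens M"
  unfolding join_def by (rule open_Sup) simp

lemma open_bottom: "\<bottom> \<in> opens M"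
  by (simp add: open_iff)

text \<open>
  A meet of some open elements is also the meet of all open elements above it. In this form
  saturation needs no choice of a family.
\<close>

lemma saturated_iff:
  "a \<in> saturateds M \<longleftrightarrow> a \<in> carrier M \<and>
     (\<forall>y\<in>carrier M. (\<forall>u\<in>opens M. a \<sqsubseteq> u \<longrightarrow> y \<sqsubseteq> u) \<longrightarrow> y \<sqsubseteq> a)"
proof
  assume "a \<in> saturateds M"
  then obtain U where U: "U \<subseteq> opens M" "a = \<Sqinter>U" and a: "a \<in> carrier M"
    unfolding saturateds_def by blast
  have U': "U \<subseteq> carrier M" using U opens_carrier by blast
  have "y \<sqsubseteq> a" if "y \<in> carrier M" "\<forall>u\<in>opens M. a \<sqsubseteq> u \<longrightarrow> y \<sqsubseteq> u" for y
    unfolding U(2) by (rule inf_greatest) (use that U U' inf_lower in auto)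
  with a show "a \<in> carrier M \<and>
     (\<forall>y\<in>carrier M. (\<forall>u\<in>opens M. a \<sqsubseteq> u \<longrightarrow> y \<sqsubseteq> u) \<longrightarrow> y \<sqsubseteq> a)" by blast
next
  assume *: "a \<in> carrier M \<and> (\<forall>y\<in>carrier M. (\<forall>u\<in>opens M. a \<sqsubseteq> u \<longrightarrow> y \<sqsubseteq> u) \<longrightarrow> y \<sqsubseteq> a)"
  have "\<Sqinter>{u \<in> opens M. a \<sqsubseteq> u} = a"
    by (rule inf_eqI) (use * opens_carrier in auto)
  then show "a \<in> saturateds M"
    unfolding saturateds_def using * by (auto intro!: exI[of _ "{u \<in> opens M. a \<sqsubseteq> u}"])
qed

lemma saturated_carrier: "s \<in> saturateds M \<Longrightarrow> s \<in> carrier M"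
  by (simp add: saturateds_def)

lemma saturateds_subset: "saturateds M \<subseteq> carrier M"
  by (auto simp: saturateds_def)

lemma open_saturated: "u \<in> opens M \<Longrightarrow> u \<in> saturateds M"
  by (auto simp: saturated_iff opens_carrier)

lemma saturated_Inf:
  assumes "A \<subseteq> saturateds M" shows "\<Sqinter>A \<in> saturateds M"
proof -
  have A: "A \<subseteq> carrier M" using assms saturated_carrier by blast
  have "y \<sqsubseteq> \<Sqinter>A" if y: "y \<in> carrier M" "\<forall>u\<in>opens M. \<Sqinter>A \<sqsubseteq> u \<longrightarrow> y \<sqsubseteq> u" for y
  proof (rule inf_greatest[OF A y(1)])
    fix s assume s: "s \<in> A"
    then have "y \<sqsubseteq> u" if "u \<in> opens M" "s \<sqsubseteq> u" for u
      using y(2) that A by (meson inf_closed inf_lower le_trans opens_carrier subsetD)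
    then show "y \<sqsubseteq> s" using s assms y(1) by (auto simp: saturated_iff)
  qed
  then show ?thesis using A by (auto simp: saturated_iff)
qed

lemma saturated_meet: "\<lbrakk>s \<in> saturateds M; t \<in> saturateds M\<rbrakk> \<Longrightarrow> s \<sqinter> t \<in> saturateds M"
  unfolding meet_def by (rule saturated_Inf) simp

text \<open>
  If \<open>y\<close> lies below every open element above \<open>s \<squnion> t\<close>, then \<open>y \<sqsubseteq> u \<squnion> v\<close> for all open \<open>u\<close> above \<open>s\<close>
  and \<open>v\<close> above \<open>t\<close>. Moving first \<open>v\<close> and then \<open>s\<close> to the left by residuation takes the meets over
  \<open>u\<close> and over \<open>v\<close> one after the other.
\<close>

lemma saturated_join:
  assumes s: "s \<in> saturateds M" and t: "t \<in> saturateds M"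
  shows "s \<squnion> t \<in> saturateds M"
proof -
  note c = saturated_carrier[OF s] saturated_carrier[OF t]
  have "y \<sqsubseteq> s \<squnion> t" if y: "y \<in> carrier M" "\<forall>u\<in>opens M. s \<squnion> t \<sqsubseteq> u \<longrightarrow> y \<sqsubseteq> u" for y
  proof -
    have uv: "y \<sqsubseteq> u \<squnion> v" if u: "u \<in> opens M" "s \<sqsubseteq> u" and v: "v \<in> opens M" "t \<sqsubseteq> v" for u v
    proof -
      have "s \<squnion> t \<sqsubseteq> u \<squnion> v"
        using u v c opens_carrier by (meson join_closed join_le join_left join_right le_trans)
      then show ?thesis using y(2) u v open_join by blast
    qed
    have "y \<sqinter> compl M s \<sqsubseteq> v" if v: "v \<in> opens M" "t \<sqsubseteq> v" for v
    proof -
      note v' = opens_carrier[OF v(1)]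
      have "y \<sqinter> compl M v \<sqsubseteq> u" if "u \<in> opens M" "s \<sqsubseteq> u" for u
        using uv[OF that v] y(1) v' opens_carrier[OF that(1)] by (simp add: shunt join_comm[of _ u])
      then have "y \<sqinter> compl M v \<sqsubseteq> s"
        using s y(1) v' by (auto simp: saturated_iff)
      then show ?thesis using y(1) v' c by (simp add: shunt join_comm[of _ v])
    qed
    then have "y \<sqinter> compl M s \<sqsubseteq> t"
      using t y(1) c by (auto simp: saturated_iff)
    then show ?thesis using y(1) c by (simp add: shunt)
  qed
  then show ?thesis using c by (auto simp: saturated_iff)
qed

lemma saturated_top: "\<top> \<in> saturateds M" and saturated_bottom: "\<bottom> \<in> saturateds M"
  by (simp_all add: open_saturated open_top open_bottom)

text \<open>
  The orders on saturated and on open elements occur as different records with the same order; the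
  following facts cover all of them.
\<close>

lemma saturated_order:
  assumes N: "carrier N = saturateds M" "le N = le M" "eq N = (=)"
  shows "complete_lattice N"
    and "A \<subseteq> saturateds M \<Longrightarrow> \<Sqinter>\<^bsub>N\<^esub> A = \<Sqinter>A"
    and "\<lbrakk>A \<subseteq> saturateds M; \<Squnion>A \<in> saturateds M\<rbrakk> \<Longrightarrow> \<Squnion>\<^bsub>N\<^esub> A = \<Squnion>A"
    and "\<lbrakk>s \<in> saturateds M; t \<in> saturateds M\<rbrakk> \<Longrightarrow> s \<sqinter>\<^bsub>N\<^esub> t = s \<sqinter> t"
    and "\<lbrakk>s \<in> saturateds M; t \<in> saturateds M\<rbrakk> \<Longrightarrow> s \<squnion>\<^bsub>N\<^esub> t = s \<squnion> t"
    and "\<top>\<^bsub>N\<^esub> = \<top>" and "\<bottom>\<^bsub>N\<^esub> = \<bottom>"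
proof -
  have N1: "carrier N \<subseteq> carrier M" using N saturateds_subset by simp
  show "complete_lattice N"
    by (rule complete_suborder_infs[OF N1 N(2,3)]) (simp add: N saturated_Inf)
  show Inf: "\<Sqinter>\<^bsub>N\<^esub> A = \<Sqinter>A" if "A \<subseteq> saturateds M" for A
    by (rule Inf_in_suborder[OF N1 N(2,3)]) (simp_all add: that N saturated_Inf)
  show Sup: "\<Squnion>\<^bsub>N\<^esub> A = \<Squnion>A" if "A \<subseteq> saturateds M" "\<Squnion>A \<in> saturateds M" for A
    by (rule Sup_in_suborder[OF N1 N(2,3)]) (simp_all add: that N)
  show "\<lbrakk>s \<in> saturateds M; t \<in> saturateds M\<rbrakk> \<Longrightarrow> s \<sqinter>\<^bsub>N\<^esub> t = s \<sqinter> t"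
    by (simp add: meet_def Inf)
  show "\<lbrakk>s \<in> saturateds M; t \<in> saturateds M\<rbrakk> \<Longrightarrow> s \<squnion>\<^bsub>N\<^esub> t = s \<squnion> t"
    using saturated_join by (simp add: join_def Sup)
  show "\<top>\<^bsub>N\<^esub> = \<top>" "\<bottom>\<^bsub>N\<^esub> = \<bottom>"
    using top_bottom_in_suborder[OF N1 N(2,3)] N(1) saturated_top saturated_bottom by simp_all
qed

lemma open_order:
  assumes N: "carrier N = opens M" "le N = le M" "eq N = (=)"
  shows "complete_lattice N"
    and "A \<subseteq> opens M \<Longrightarrow> \<Squnion>\<^bsub>N\<^esub> A = \<Squnion>A"
    and "\<lbrakk>s \<in> opens M; t \<in> opens M\<rbrakk> \<Longrightarrow> s \<sqinter>\<^bsub>N\<^esub> t = s \<sqinter> t"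
    and "\<top>\<^bsub>N\<^esub> = \<top>"
proof -
  have N1: "carrier N \<subseteq> carrier M" using N opens_carrier by blast
  show "complete_lattice N"
    by (rule complete_suborder_sups[OF N1 N(2,3)]) (simp add: N open_Sup)
  show "\<Squnion>\<^bsub>N\<^esub> A = \<Squnion>A" if "A \<subseteq> opens M"
    by (rule Sup_in_suborder[OF N1 N(2,3)]) (simp_all add: that N open_Sup)
  show "\<lbrakk>s \<in> opens M; t \<in> opens M\<rbrakk> \<Longrightarrow> s \<sqinter>\<^bsub>N\<^esub> t = s \<sqinter> t"
    using open_meet by (simp add: meet_def Inf_in_suborder[OF N1 N(2,3)] N)
  show "\<top>\<^bsub>N\<^esub> = \<top>"
    using top_bottom_in_suborder[OF N1 N(2,3)] N(1) open_top by simp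
qed

lemma R_obj_simps: "carrier (R_obj M) = saturateds M" "le (R_obj M) = le M" "eq (R_obj M) = (=)"
    "subfr (R_obj M) = opens M"
  by (simp_all add: R_obj_def)

lemma eq_M: "eq M = (=)" by (rule eq_is_equal)

lemmas R_obj_order = saturated_order[of "R_obj M", OF R_obj_simps(1-3)]

lemma coframe_R_obj: "coframe (R_obj M)"
  unfolding coframe_def
proof (intro conjI ballI allI impI R_obj_order(1))
  fix a A assume a: "a \<in> carrier (R_obj M)" and A: "A \<subseteq> carrier (R_obj M)"
  have A': "A \<subseteq> saturateds M" "A \<subseteq> carrier M" and a': "a \<in> saturateds M" "a \<in> carrier M"
    using a A saturateds_subset by (auto simp: R_obj_simps)
  have "a \<squnion>\<^bsub>R_obj M\<^esub> \<Sqinter>\<^bsub>R_obj M\<^esub> A = a \<squnion> \<Sqinter>A"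
    using a' A' saturated_Inf by (simp add: R_obj_order)
  also have "\<dots> = \<Sqinter>((\<lambda>s. a \<squnion> s) ` A)"
    by (rule join_Inf) fact+
  also have "(\<lambda>s. a \<squnion> s) ` A = (\<lambda>s. a \<squnion>\<^bsub>R_obj M\<^esub> s) ` A"
    using a' A' by (intro image_cong refl) (auto simp: R_obj_order)
  also have "\<Sqinter>\<dots> = \<Sqinter>\<^bsub>R_obj M\<^esub> \<dots>"
    using a' A' saturated_join by (intro R_obj_order(2)[symmetric]) (auto simp: R_obj_order)
  finally show "a \<squnion>\<^bsub>R_obj M\<^esub> \<Sqinter>\<^bsub>R_obj M\<^esub> A = \<Sqinter>\<^bsub>R_obj M\<^esub> ((\<lambda>s. a \<squnion>\<^bsub>R_obj M\<^esub> s) ` A)" .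
qed

text \<open>
  Meets and finite joins of saturated elements, and joins and finite meets of open elements, are
  computed in \<open>M\<close>. So all laws are inherited from the complete Boolean algebra; the join of
  \<open>a \<sqinter> s\<close> over the open \<open>s \<in> A\<close> is again computed in \<open>M\<close> because \<open>a \<sqinter> \<Squnion>A\<close> is saturated.
\<close>

lemma raney_extension_R_obj: "raney_extension (R_obj M)"
proof -
  let ?R = "R_obj M" and ?O = "suborder (R_obj M) (opens M)"
  have O: "carrier ?O = opens M" "le ?O = le M" "eq ?O = (=)" by (simp_all add: R_obj_simps)
  note O_order = open_order[of ?O, OF O]
  interpret R: complete_lattice ?R by (rule R_obj_order(1))
  interpret O: complete_lattice ?O by (rule O_order(1))
  have o: "U \<subseteq> carrier M" if "U \<subseteq> opens M" for U using that opens_carrier by blast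
  have s: "U \<subseteq> saturateds M" if "U \<subseteq> opens M" for U using that open_saturated by blast
  have sup: "\<Squnion>\<^bsub>?R\<^esub> U = \<Squnion>U" if "U \<subseteq> opens M" for U
    by (rule R_obj_order(3)) (use s[OF that] open_Sup[OF that] open_saturated in auto)
  have "frame ?O"
    unfolding frame_def
  proof (intro conjI ballI allI impI O_order(1))
    fix a A assume "a \<in> carrier ?O" "A \<subseteq> carrier ?O"
    then have a: "a \<in> opens M" and A: "A \<subseteq> opens M" by simp_all
    have "a \<sqinter>\<^bsub>?O\<^esub> \<Squnion>\<^bsub>?O\<^esub> A = a \<sqinter> \<Squnion>A"
      using a A open_Sup by (simp add: O_order)
    also have "\<dots> = \<Squnion>((\<lambda>s. a \<sqinter> s) ` A)"
      by (rule meet_Sup) (use a o[OF A] opens_carrier in auto)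
    also have "(\<lambda>s. a \<sqinter> s) ` A = (\<lambda>s. a \<sqinter>\<^bsub>?O\<^esub> s) ` A"
      using a A by (intro image_cong refl) (auto simp: O_order)
    also have "\<Squnion>\<dots> = \<Squnion>\<^bsub>?O\<^esub> \<dots>"
      using a A by (intro O_order(2)[symmetric]) (auto simp: O_order open_meet subset_iff)
    finally show "a \<sqinter>\<^bsub>?O\<^esub> \<Squnion>\<^bsub>?O\<^esub> A = \<Squnion>\<^bsub>?O\<^esub> ((\<lambda>s. a \<sqinter>\<^bsub>?O\<^esub> s) ` A)" .
  qed
  moreover have "frame_hom ?O ?R (\<lambda>u. u)"
    unfolding frame_hom_def sup_pres_def meet_pres_def
    using O.complete_lattice_axioms R.complete_lattice_axioms O.lattice_axioms R.lattice_axioms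
      open_saturated open_top sup
    by (auto simp: R_obj_simps(1) O_order(2-4) R_obj_order(4,6))
  ultimately have "subframe ?R (subfr ?R)"
    unfolding subframe_def by (auto simp: R_obj_simps open_saturated)
  moreover have "\<exists>U\<subseteq>subfr ?R. c = \<Sqinter>\<^bsub>?R\<^esub> U" if "c \<in> carrier ?R" for c
  proof -
    obtain U where "U \<subseteq> opens M" "c = \<Sqinter>U"
      using \<open>c \<in> carrier ?R\<close> by (auto simp: R_obj_simps saturateds_def)
    then show ?thesis by (intro exI[of _ U]) (simp add: R_obj_simps R_obj_order(2) s)
  qed
  moreover have "a \<sqinter>\<^bsub>?R\<^esub> \<Squnion>\<^bsub>?R\<^esub> A = \<Squnion>\<^bsub>?R\<^esub> ((\<lambda>s. a \<sqinter>\<^bsub>?R\<^esub> s) ` A)"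
    if "a \<in> carrier ?R" "A \<subseteq> subfr ?R" for a A
  proof -
    have a: "a \<in> saturateds M" and A: "A \<subseteq> opens M" using that by (auto simp: R_obj_simps)
    have SA: "\<Squnion>A \<in> saturateds M" using A by (simp add: open_Sup open_saturated)
    have "a \<sqinter>\<^bsub>?R\<^esub> \<Squnion>\<^bsub>?R\<^esub> A = a \<sqinter> \<Squnion>A"
      using a SA by (simp add: sup[OF A] R_obj_order)
    also have eq: "\<dots> = \<Squnion>((\<lambda>s. a \<sqinter> s) ` A)"
      by (rule meet_Sup) (use a o[OF A] saturated_carrier in auto)
    also have img: "(\<lambda>s. a \<sqinter> s) ` A = (\<lambda>s. a \<sqinter>\<^bsub>?R\<^esub> s) ` A"
      using a s[OF A] by (intro image_cong refl) (auto simp: R_obj_order)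
    also have "\<Squnion>\<dots> = \<Squnion>\<^bsub>?R\<^esub> \<dots>"
    proof (rule R_obj_order(3)[symmetric])
      show "(\<lambda>s. a \<sqinter>\<^bsub>?R\<^esub> s) ` A \<subseteq> saturateds M"
        unfolding img[symmetric] using a s[OF A] by (auto intro: saturated_meet)
      show "\<Squnion>((\<lambda>s. a \<sqinter>\<^bsub>?R\<^esub> s) ` A) \<in> saturateds M"
        unfolding img[symmetric] eq[symmetric] using a SA by (rule saturated_meet)
    qed
    finally show ?thesis .
  qed
  ultimately show ?thesis
    unfolding raney_extension_def using coframe_R_obj by blast
qed

lemma bounded_distrib_R_obj: "bounded_distrib_lattice (R_obj M)"
  by (rule coframe_bounded_distrib_lattice[OF coframe_R_obj])

lemma boolean_subalgebra_BS: "boolean_subalgebra M (BS M)"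
  unfolding BS_def by (rule generated_boolean_subalgebra[OF boolean_order_axioms saturateds_subset])

lemma saturated_BS: "s \<in> saturateds M \<Longrightarrow> s \<in> BS M"
  unfolding BS_def by (rule subsetD[OF generated_superset])

lemma BS_carrier: "x \<in> BS M \<Longrightarrow> x \<in> carrier M"
  using boolean_subalgebraD(1)[OF boolean_subalgebra_BS] by blast

lemma boolean_order_BS: "boolean_order (suborder M (BS M))"
  by (rule boolean_subalgebra_suborder(1)[OF boolean_order_axioms boolean_subalgebra_BS])

lemmas BS_ops = boolean_subalgebra_suborder(2-6)[OF boolean_order_axioms boolean_subalgebra_BS]

end

section \<open>Raney morphisms are determined by their restriction to saturated elements\<close>

text \<open>
  The two conditions that a morphism be a coframe morphism on saturated elements and a frame
  morphism on open elements, expressed by operations of the algebras alone. Preservation of the top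
  element and of binary meets of open elements follows from preservation of meets of saturated ones.
\<close>

definition raney_map :: "'a mt \<Rightarrow> 'b mt \<Rightarrow> ('a \<Rightarrow> 'b) \<Rightarrow> bool" where
  "raney_map M M' f \<longleftrightarrow> f \<in> saturateds M \<rightarrow> saturateds M' \<and> f \<in> opens M \<rightarrow> opens M' \<and>
     (\<forall>A\<subseteq>saturateds M. f (\<Sqinter>\<^bsub>M\<^esub> A) = \<Sqinter>\<^bsub>M'\<^esub> (f ` A)) \<and>
     (\<forall>s\<in>saturateds M. \<forall>t\<in>saturateds M. f (s \<squnion>\<^bsub>M\<^esub> t) = f s \<squnion>\<^bsub>M'\<^esub> f t) \<and>
     f \<bottom>\<^bsub>M\<^esub> = \<bottom>\<^bsub>M'\<^esub> \<and>
     (\<forall>U\<subseteq>opens M. f (\<Squnion>\<^bsub>M\<^esub> U) = \<Squnion>\<^bsub>M'\<^esub> (f ` U))"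

lemma raney_mapD:
  assumes "raney_map M M' f"
  shows "s \<in> saturateds M \<Longrightarrow> f s \<in> saturateds M'" "u \<in> opens M \<Longrightarrow> f u \<in> opens M'"
    "A \<subseteq> saturateds M \<Longrightarrow> f (\<Sqinter>\<^bsub>M\<^esub> A) = \<Sqinter>\<^bsub>M'\<^esub> (f ` A)"
    "\<lbrakk>s \<in> saturateds M; t \<in> saturateds M\<rbrakk> \<Longrightarrow> f (s \<squnion>\<^bsub>M\<^esub> t) = f s \<squnion>\<^bsub>M'\<^esub> f t"
    "f \<bottom>\<^bsub>M\<^esub> = \<bottom>\<^bsub>M'\<^esub>"
    "U \<subseteq> opens M \<Longrightarrow> f (\<Squnion>\<^bsub>M\<^esub> U) = \<Squnion>\<^bsub>M'\<^esub> (f ` U)"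
  using assms unfolding raney_map_def by blast+

lemma raney_map_meet:
  assumes "raney_map M M' f" "s \<in> saturateds M" "t \<in> saturateds M"
  shows "f (s \<sqinter>\<^bsub>M\<^esub> t) = f s \<sqinter>\<^bsub>M'\<^esub> f t"
  using raney_mapD(3)[OF assms(1), of "{s, t}"] assms(2,3) by (simp add: meet_def)

lemma raney_map_top:
  assumes "mt_algebra M" "mt_algebra M'" "raney_map M M' f"
  shows "f \<top>\<^bsub>M\<^esub> = \<top>\<^bsub>M'\<^esub>"
proof -
  interpret M: mt_alg M by (rule mt_alg.intro) fact
  interpret M': mt_alg M' by (rule mt_alg.intro) fact
  show ?thesis using raney_mapD(3)[OF assms(3), of "{}"] by (simp add: M.Inf_empty M'.Inf_empty)
qed

lemma raney_map_cong:
  assumes "mt_algebra M" "\<And>s. s \<in> saturateds M \<Longrightarrow> f s = g s"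
  shows "raney_map M M' f \<longleftrightarrow> raney_map M M' g"
proof -
  interpret M: mt_alg M by (rule mt_alg.intro) fact
  have img: "f ` A = g ` A" if "A \<subseteq> saturateds M" for A
    using that assms(2) by (intro image_cong) auto
  have sub: "A \<subseteq> saturateds M" if "A \<subseteq> opens M" for A using that M.open_saturated by blast
  show ?thesis
    unfolding raney_map_def
    using assms(2) M.open_saturated M.saturated_Inf M.saturated_join M.saturated_bottom
      M.open_Sup img sub
    by (auto simp: Pi_def)
qed

text \<open>
  The orders \<open>N\<close> and \<open>K\<close> are arbitrary records because those in the definitions of the two categories
  have different record types.
\<close>

lemma raney_map_hom_iff:
  assumes "mt_algebra M" "mt_algebra M'"
    and N: "carrier N = saturateds M" "le N = le M" "eq N = (=)"
    and N': "carrier N' = saturateds M'" "le N' = le M'" "eq N' = (=)"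
    and K: "carrier K = opens M" "le K = le M" "eq K = (=)"
    and K': "carrier K' = opens M'" "le K' = le M'" "eq K' = (=)"
  shows "raney_map M M' f \<longleftrightarrow> coframe_hom N N' f \<and> frame_hom K K' f"
proof -
  interpret M: mt_alg M by (rule mt_alg.intro) fact
  interpret M': mt_alg M' by (rule mt_alg.intro) fact
  note S = M.saturated_order[OF N] and S' = M'.saturated_order[OF N']
  note O = M.open_order[OF K] and O' = M'.open_order[OF K']
  interpret N: complete_lattice N by (rule S(1))
  interpret N': complete_lattice N' by (rule S'(1))
  interpret K: complete_lattice K by (rule O(1))
  interpret K': complete_lattice K' by (rule O'(1))
  have cof: "coframe_hom N N' f \<longleftrightarrow> f \<in> saturateds M \<rightarrow> saturateds M' \<and>
     (\<forall>A\<subseteq>saturateds M. f (\<Sqinter>\<^bsub>M\<^esub> A) = \<Sqinter>\<^bsub>M'\<^esub> (f ` A)) \<and>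
     (\<forall>s\<in>saturateds M. \<forall>t\<in>saturateds M. f (s \<squnion>\<^bsub>M\<^esub> t) = f s \<squnion>\<^bsub>M'\<^esub> f t) \<and> f \<bottom>\<^bsub>M\<^esub> = \<bottom>\<^bsub>M'\<^esub>"
    unfolding coframe_hom_def inf_pres_def join_pres_def N N' S(7) S'(7)
  proof (intro conj_cong refl iffI; (elim conjE)?; intro conjI allI ballI impI N.complete_lattice_axioms
      N'.complete_lattice_axioms N.lattice_axioms N'.lattice_axioms; (elim conjE)?)
    fix A assume f: "f \<in> saturateds M \<rightarrow> saturateds M'" and A: "A \<subseteq> saturateds M"
    have fA: "f ` A \<subseteq> saturateds M'" using f A by auto
    show "f (\<Sqinter>\<^bsub>M\<^esub> A) = \<Sqinter>\<^bsub>M'\<^esub> (f ` A)"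
      if "\<forall>A\<subseteq>saturateds M. f (\<Sqinter>\<^bsub>N\<^esub> A) = \<Sqinter>\<^bsub>N'\<^esub> (f ` A)"
      using that A fA by (simp add: S(2) S'(2))
    show "f (\<Sqinter>\<^bsub>N\<^esub> A) = \<Sqinter>\<^bsub>N'\<^esub> (f ` A)"
      if "\<forall>A\<subseteq>saturateds M. f (\<Sqinter>\<^bsub>M\<^esub> A) = \<Sqinter>\<^bsub>M'\<^esub> (f ` A)"
      using that A fA by (simp add: S(2) S'(2))
  next
    fix s t assume f: "f \<in> saturateds M \<rightarrow> saturateds M'" and st: "s \<in> saturateds M" "t \<in> saturateds M"
    have ft: "f s \<in> saturateds M'" "f t \<in> saturateds M'" using f st by auto
    show "f (s \<squnion>\<^bsub>M\<^esub> t) = f s \<squnion>\<^bsub>M'\<^esub> f t"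
      if "\<forall>s\<in>saturateds M. \<forall>t\<in>saturateds M. f (s \<squnion>\<^bsub>N\<^esub> t) = f s \<squnion>\<^bsub>N'\<^esub> f t"
      using that st ft by (simp add: S(5) S'(5))
    show "f (s \<squnion>\<^bsub>N\<^esub> t) = f s \<squnion>\<^bsub>N'\<^esub> f t"
      if "\<forall>s\<in>saturateds M. \<forall>t\<in>saturateds M. f (s \<squnion>\<^bsub>M\<^esub> t) = f s \<squnion>\<^bsub>M'\<^esub> f t"
      using that st ft by (simp add: S(5) S'(5))
  qed
  have fr: "frame_hom K K' f \<longleftrightarrow> f \<in> opens M \<rightarrow> opens M' \<and>
     (\<forall>A\<subseteq>opens M. f (\<Squnion>\<^bsub>M\<^esub> A) = \<Squnion>\<^bsub>M'\<^esub> (f ` A)) \<and>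
     (\<forall>s\<in>opens M. \<forall>t\<in>opens M. f (s \<sqinter>\<^bsub>M\<^esub> t) = f s \<sqinter>\<^bsub>M'\<^esub> f t) \<and> f \<top>\<^bsub>M\<^esub> = \<top>\<^bsub>M'\<^esub>"
    unfolding frame_hom_def sup_pres_def meet_pres_def K K' O(4) O'(4)
  proof (intro conj_cong refl iffI; (elim conjE)?; intro conjI allI ballI impI K.complete_lattice_axioms
      K'.complete_lattice_axioms K.lattice_axioms K'.lattice_axioms; (elim conjE)?)
    fix A assume f: "f \<in> opens M \<rightarrow> opens M'" and A: "A \<subseteq> opens M"
    have fA: "f ` A \<subseteq> opens M'" using f A by auto
    show "f (\<Squnion>\<^bsub>M\<^esub> A) = \<Squnion>\<^bsub>M'\<^esub> (f ` A)"
      if "\<forall>A\<subseteq>opens M. f (\<Squnion>\<^bsub>K\<^esub> A) = \<Squnion>\<^bsub>K'\<^esub> (f ` A)"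
      using that A fA by (simp add: O(2) O'(2))
    show "f (\<Squnion>\<^bsub>K\<^esub> A) = \<Squnion>\<^bsub>K'\<^esub> (f ` A)"
      if "\<forall>A\<subseteq>opens M. f (\<Squnion>\<^bsub>M\<^esub> A) = \<Squnion>\<^bsub>M'\<^esub> (f ` A)"
      using that A fA by (simp add: O(2) O'(2))
  next
    fix s t assume f: "f \<in> opens M \<rightarrow> opens M'" and st: "s \<in> opens M" "t \<in> opens M"
    have ft: "f s \<in> opens M'" "f t \<in> opens M'" using f st by auto
    show "f (s \<sqinter>\<^bsub>M\<^esub> t) = f s \<sqinter>\<^bsub>M'\<^esub> f t"
      if "\<forall>s\<in>opens M. \<forall>t\<in>opens M. f (s \<sqinter>\<^bsub>K\<^esub> t) = f s \<sqinter>\<^bsub>K'\<^esub> f t"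
      using that st ft by (simp add: O(3) O'(3))
    show "f (s \<sqinter>\<^bsub>K\<^esub> t) = f s \<sqinter>\<^bsub>K'\<^esub> f t"
      if "\<forall>s\<in>opens M. \<forall>t\<in>opens M. f (s \<sqinter>\<^bsub>M\<^esub> t) = f s \<sqinter>\<^bsub>M'\<^esub> f t"
      using that st ft by (simp add: O(3) O'(3))
  qed
  have meet: "f (s \<sqinter>\<^bsub>M\<^esub> t) = f s \<sqinter>\<^bsub>M'\<^esub> f t" if "raney_map M M' f" "s \<in> opens M" "t \<in> opens M" for s t
    using raney_map_meet that M.open_saturated by metis
  show ?thesis
  proof
    assume f: "raney_map M M' f"
    show "coframe_hom N N' f \<and> frame_hom K K' f"
      unfolding cof fr
      using f[unfolded raney_map_def] meet[OF f] raney_map_top[OF assms(1,2) f] by simp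
  next
    assume "coframe_hom N N' f \<and> frame_hom K K' f"
    then show "raney_map M M' f"
      unfolding cof fr raney_map_def by simp
  qed
qed

lemma re_hom_R_obj_iff:
  assumes "mt_algebra M" "mt_algebra M'"
  shows "h \<in> re_hom (R_obj M) (R_obj M') \<longleftrightarrow> h \<in> saturateds M \<rightarrow>\<^sub>E saturateds M' \<and> raney_map M M' h"
  unfolding re_hom_def
  by (subst raney_map_hom_iff[OF assms, of "R_obj M" "R_obj M'"
      "suborder (R_obj M) (subfr (R_obj M))" "suborder (R_obj M') (subfr (R_obj M'))"])
    (auto simp: R_obj_def)

lemma mt_hom_iff:
  assumes "mt_algebra M" "mt_algebra M'"
  shows "f \<in> mt_hom M M' \<longleftrightarrow> f \<in> carrier M \<rightarrow>\<^sub>E carrier M' \<and> raney_map M M' f \<and>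
     (\<forall>a\<in>carrier M. \<forall>b\<in>carrier M. f (a \<sqinter>\<^bsub>M\<^esub> b) = f a \<sqinter>\<^bsub>M'\<^esub> f b) \<and>
     (\<forall>x\<in>BS M. \<forall>y\<in>BS M. f (x \<squnion>\<^bsub>M\<^esub> y) = f x \<squnion>\<^bsub>M'\<^esub> f y) \<and>
     (\<forall>a\<in>carrier M. f a = \<Squnion>\<^bsub>M'\<^esub> {f x |x. x \<in> BS M \<and> x \<sqsubseteq>\<^bsub>M\<^esub> a})"
proof -
  interpret M: mt_alg M by (rule mt_alg.intro) fact
  interpret M': mt_alg M' by (rule mt_alg.intro) fact
  show ?thesis
    unfolding mt_hom_def
    by (subst raney_map_hom_iff[OF assms, of "suborder M (saturateds M)" "suborder M' (saturateds M')"
        "suborder M (opens M)" "suborder M' (opens M')"])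
      (auto simp: M.eq_M M'.eq_M)
qed

lemma mt_homD:
  assumes "mt_algebra M" "mt_algebra M'" "f \<in> mt_hom M M'"
  shows "a \<in> carrier M \<Longrightarrow> f a \<in> carrier M'" "f \<in> extensional (carrier M)" "raney_map M M' f"
    "\<lbrakk>a \<in> carrier M; b \<in> carrier M\<rbrakk> \<Longrightarrow> f (a \<sqinter>\<^bsub>M\<^esub> b) = f a \<sqinter>\<^bsub>M'\<^esub> f b"
    "\<lbrakk>x \<in> BS M; y \<in> BS M\<rbrakk> \<Longrightarrow> f (x \<squnion>\<^bsub>M\<^esub> y) = f x \<squnion>\<^bsub>M'\<^esub> f y"
    "a \<in> carrier M \<Longrightarrow> f a = \<Squnion>\<^bsub>M'\<^esub> {f x |x. x \<in> BS M \<and> x \<sqsubseteq>\<^bsub>M\<^esub> a}"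
  using assms(3)[unfolded mt_hom_iff[OF assms(1,2)] PiE_def] by blast+

lemma mt_hom_BS:
  assumes "mt_algebra M" "mt_algebra M'" "f \<in> mt_hom M M'"
  shows mt_hom_boolean_hom: "boolean_hom (suborder M (BS M)) M' f"
    and mt_hom_BS_closed: "x \<in> BS M \<Longrightarrow> f x \<in> BS M'"
proof -
  interpret M: mt_alg M by (rule mt_alg.intro) fact
  interpret M': mt_alg M' by (rule mt_alg.intro) fact
  note f = mt_homD[OF assms]
  show hom: "boolean_hom (suborder M (BS M)) M' f"
    by (rule boolean_homI[OF M.boolean_order_BS M'.boolean_order_axioms])
      (use f M.BS_carrier in \<open>simp_all add: M.BS_ops raney_mapD(5)[OF f(3)] raney_map_top[OF assms(1,2) f(3)]\<close>)
  have "f ` BS M = f ` boolean_generated (suborder M (BS M)) (saturateds M)"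
    unfolding BS_def
    by (subst generated_subalgebra_suborder[OF M.boolean_order_axioms M.boolean_subalgebra_BS, unfolded BS_def])
      (use M.saturated_BS in \<open>auto simp: BS_def\<close>)
  also have "\<dots> = boolean_generated M' (f ` saturateds M)"
    by (rule generated_image[OF M.boolean_order_BS M'.boolean_order_axioms hom])
      (use M.saturated_BS in auto)
  also have "\<dots> \<subseteq> BS M'"
    by (rule generated_least[OF M'.boolean_subalgebra_BS])
      (use raney_mapD(1)[OF f(3)] M'.saturated_BS in auto)
  finally show "f x \<in> BS M'" if "x \<in> BS M" using that by blast
qed

text \<open>
  On \<open>BS M\<close> a Raney morphism is a Boolean morphism, hence determined by the generators; everywhere
  else it is a join of values on \<open>BS M\<close>. This makes \<open>R\<close> faithful.
\<close>

lemma mt_hom_eqI: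
  assumes "mt_algebra M" "mt_algebra M'" "f \<in> mt_hom M M'" "g \<in> mt_hom M M'"
    "\<And>s. s \<in> saturateds M \<Longrightarrow> f s = g s"
  shows "f = g"
proof -
  interpret M: mt_alg M by (rule mt_alg.intro) fact
  note f = mt_homD[OF assms(1-3)] and g = mt_homD[OF assms(1,2,4)]
  have gen: "x \<in> boolean_generated (suborder M (BS M)) (saturateds M)" if "x \<in> BS M" for x
    using that M.saturated_BS
    by (subst generated_subalgebra_suborder[OF M.boolean_order_axioms M.boolean_subalgebra_BS])
      (auto simp: BS_def)
  have BS: "f x = g x" if "x \<in> BS M" for x
  proof (rule boolean_homs_agree[OF M.boolean_order_BS mt_hom_boolean_hom[OF assms(1-3)]
        mt_hom_boolean_hom[OF assms(1,2,4)] _ assms(5) gen[OF that]])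
    show "saturateds M \<subseteq> carrier (suborder M (BS M))" using M.saturated_BS by auto
  qed
  show ?thesis
  proof (rule extensionalityI[OF f(2) g(2)])
    fix a assume "a \<in> carrier M"
    moreover have "{f x |x. x \<in> BS M \<and> x \<sqsubseteq>\<^bsub>M\<^esub> a} = {g x |x. x \<in> BS M \<and> x \<sqsubseteq>\<^bsub>M\<^esub> a}"
      using BS by (intro Collect_cong ex_cong1) auto
    ultimately show "f a = g a" using f(6)[of a] g(6)[of a] by presburger
  qed
qed

section \<open>Extending Boolean morphisms to Raney morphisms\<close>

lemma (in complete_boolean) Sup_meet_Sup_le:
  assumes "A \<subseteq> carrier L" "B \<subseteq> carrier L" "z \<in> carrier L"
    "\<And>a b. \<lbrakk>a \<in> A; b \<in> B\<rbrakk> \<Longrightarrow> a \<sqinter> b \<sqsubseteq> z"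
  shows "\<Squnion>A \<sqinter> \<Squnion>B \<sqsubseteq> z"
proof -
  have a: "a \<sqinter> \<Squnion>B \<sqsubseteq> z" if "a \<in> A" for a
  proof -
    have "a \<in> carrier L" using that assms(1) by blast
    then show ?thesis
      unfolding meet_Sup[OF \<open>a \<in> carrier L\<close> assms(2)]
      by (intro sup_least) (use assms that in auto)
  qed
  have "\<Squnion>B \<sqinter> \<Squnion>A \<sqsubseteq> z"
    unfolding meet_Sup[OF sup_closed[OF assms(2)] assms(1)]
    by (intro sup_least) (use assms a in \<open>auto simp: meet_comm[of L "\<Squnion>B"]\<close>)
  then show ?thesis by (simp add: meet_comm[of L "\<Squnion>B"])
qed

text \<open>
  Binary meets are preserved by \<open>f a = \<Squnion>{g x | e x \<sqsubseteq> a}\<close> because a complete Boolean algebra is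
  a frame: \<open>f a \<sqinter> f b\<close> is the join of all \<open>g x \<sqinter> g y = g (x \<sqinter> y)\<close>. On \<open>BS M\<close> the join has a largest
  member, so there \<open>f\<close> is \<open>g\<close> and inherits its properties.

  The algebra \<open>B\<close> is a parametrization of \<open>BS M\<close> by \<open>e\<close>. Identities and composites of Raney morphisms,
  the morphisms needed for fullness of \<open>R\<close>, the values of the functor \<open>F\<close> and the transformation
  \<open>eta\<close> are all of this form.
\<close>

lemma mt_hom_extension:
  assumes "mt_algebra M" "mt_algebra N" "boolean_order B"
    and e: "boolean_hom B M e" and g: "boolean_hom B N g"
    and emb: "\<And>x y. \<lbrakk>x \<in> carrier B; y \<in> carrier B; e x \<sqsubseteq>\<^bsub>M\<^esub> e y\<rbrakk> \<Longrightarrow> x \<sqsubseteq>\<^bsub>B\<^esub> y"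
    and BS: "e ` carrier B = BS M"
    and k: "raney_map M N k" and gk: "\<And>x. \<lbrakk>x \<in> carrier B; e x \<in> saturateds M\<rbrakk> \<Longrightarrow> g x = k (e x)"
  defines "f \<equiv> \<lambda>a\<in>carrier M. \<Squnion>\<^bsub>N\<^esub> {g x |x. x \<in> carrier B \<and> e x \<sqsubseteq>\<^bsub>M\<^esub> a}"
  shows mt_hom_extension_hom: "f \<in> mt_hom M N"
    and mt_hom_extension_BS: "x \<in> carrier B \<Longrightarrow> f (e x) = g x"
    and mt_hom_extension_saturated: "s \<in> saturateds M \<Longrightarrow> f s = k s"
proof -
  interpret M: mt_alg M by (rule mt_alg.intro) fact
  interpret N: mt_alg N by (rule mt_alg.intro) fact
  interpret B: boolean_order B by fact
  note e' = boolean_homD[OF e] and g' = boolean_homD[OF g]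
  let ?D = "\<lambda>a. {g x |x. x \<in> carrier B \<and> e x \<sqsubseteq>\<^bsub>M\<^esub> a}"
  have D: "?D a \<subseteq> carrier N" for a using g'(1) by auto
  have f: "f a = \<Squnion>\<^bsub>N\<^esub> ?D a" if "a \<in> carrier M" for a using that by (simp add: f_def)
  show fe: "f (e x) = g x" if x: "x \<in> carrier B" for x
  proof -
    have "\<Squnion>\<^bsub>N\<^esub> ?D (e x) = g x"
    proof (rule N.sup_eqI[OF D])
      show "g x \<in> carrier N" using x by (rule g'(1))
      show "a \<sqsubseteq>\<^bsub>N\<^esub> g x" if "a \<in> ?D (e x)" for a
        using that x emb boolean_hom_mono[OF g] by auto
      show "g x \<sqsubseteq>\<^bsub>N\<^esub> y" if "\<And>a. a \<in> ?D (e x) \<Longrightarrow> a \<sqsubseteq>\<^bsub>N\<^esub> y" for y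
        by (rule that) (use x e'(1) in auto)
    qed
    then show ?thesis using f[OF e'(1)[OF x]] by simp
  qed
  show fs: "f s = k s" if s: "s \<in> saturateds M" for s
  proof -
    obtain x where x: "x \<in> carrier B" "s = e x" using M.saturated_BS[OF s] unfolding BS[symmetric] by auto
    then show ?thesis using fe gk s by simp
  qed
  have fc: "f a \<in> carrier N" if "a \<in> carrier M" for a using f[OF that] D by simp
  have mono: "f a \<sqsubseteq>\<^bsub>N\<^esub> f b" if "a \<in> carrier M" "b \<in> carrier M" "a \<sqsubseteq>\<^bsub>M\<^esub> b" for a b
    unfolding f[OF that(1)] f[OF that(2)]
    by (rule N.sup_mono[OF _ D]) (use that e'(1) in \<open>blast intro: M.le_trans\<close>)
  have "f (a \<sqinter>\<^bsub>M\<^esub> b) = f a \<sqinter>\<^bsub>N\<^esub> f b" if a: "a \<in> carrier M" and b: "b \<in> carrier M" for a b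
  proof (rule N.le_antisym)
    show "f (a \<sqinter>\<^bsub>M\<^esub> b) \<sqsubseteq>\<^bsub>N\<^esub> f a \<sqinter>\<^bsub>N\<^esub> f b"
      using a b fc by (intro N.meet_le mono) (auto intro: M.meet_left M.meet_right)
    show "f a \<sqinter>\<^bsub>N\<^esub> f b \<sqsubseteq>\<^bsub>N\<^esub> f (a \<sqinter>\<^bsub>M\<^esub> b)"
      unfolding f[OF a] f[OF b]
    proof (rule N.Sup_meet_Sup_le[OF D D])
      show "f (a \<sqinter>\<^bsub>M\<^esub> b) \<in> carrier N" using a b fc by simp
      fix c d assume "c \<in> ?D a" "d \<in> ?D b"
      then obtain x y where xy: "c = g x" "d = g y" "x \<in> carrier B" "y \<in> carrier B"
        "e x \<sqsubseteq>\<^bsub>M\<^esub> a" "e y \<sqsubseteq>\<^bsub>M\<^esub> b" by blast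
      have "e (x \<sqinter>\<^bsub>B\<^esub> y) \<sqsubseteq>\<^bsub>M\<^esub> a \<sqinter>\<^bsub>M\<^esub> b"
        using xy a b e' by (simp add: M.meet_mono)
      then have "f (e (x \<sqinter>\<^bsub>B\<^esub> y)) \<sqsubseteq>\<^bsub>N\<^esub> f (a \<sqinter>\<^bsub>M\<^esub> b)"
        using xy a b e' by (intro mono) simp_all
      then show "c \<sqinter>\<^bsub>N\<^esub> d \<sqsubseteq>\<^bsub>N\<^esub> f (a \<sqinter>\<^bsub>M\<^esub> b)"
        using xy g' by (simp add: fe)
    qed
  qed (use a b fc in simp_all)
  moreover have "f (x \<squnion>\<^bsub>M\<^esub> y) = f x \<squnion>\<^bsub>N\<^esub> f y" if xy: "x \<in> BS M" "y \<in> BS M" for x y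
  proof -
    obtain x' y' where "x' \<in> carrier B" "y' \<in> carrier B" "x = e x'" "y = e y'"
      using xy unfolding BS[symmetric] by auto
    then show ?thesis using fe[of "x' \<squnion>\<^bsub>B\<^esub> y'"] e' g' by (simp add: fe)
  qed
  moreover have "f a = \<Squnion>\<^bsub>N\<^esub> {f x |x. x \<in> BS M \<and> x \<sqsubseteq>\<^bsub>M\<^esub> a}" if "a \<in> carrier M" for a
  proof -
    have "{f x |x. x \<in> BS M \<and> x \<sqsubseteq>\<^bsub>M\<^esub> a} = {f (e x) |x. x \<in> carrier B \<and> e x \<sqsubseteq>\<^bsub>M\<^esub> a}"
      unfolding BS[symmetric] by blast
    also have "\<dots> = ?D a" using fe by (intro Collect_cong ex_cong1) auto
    finally show ?thesis using f[OF that] by simp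
  qed
  moreover have "raney_map M N f"
    using k raney_map_cong[OF assms(1), where f = f and g = k and M' = N] fs by simp
  moreover have "f \<in> carrier M \<rightarrow>\<^sub>E carrier N" using fc by (auto simp: f_def)
  ultimately show "f \<in> mt_hom M N"
    unfolding mt_hom_iff[OF assms(1,2)] by blast
qed

lemma raney_map_id:
  "mt_algebra M \<Longrightarrow> raney_map M M (\<lambda>s. s)"
  by (simp add: raney_map_def)

lemma raney_map_comp:
  assumes "raney_map M N f" "raney_map N P g"
  shows "raney_map M P (\<lambda>s. g (f s))"
proof -
  note f = raney_mapD[OF assms(1)] and g = raney_mapD[OF assms(2)]
  have "f ` A \<subseteq> saturateds N" if "A \<subseteq> saturateds M" for A using that f(1) by blast
  moreover have "f ` A \<subseteq> opens N" if "A \<subseteq> opens M" for A using that f(2) by blast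
  ultimately show ?thesis
    unfolding raney_map_def using f g by (simp add: Pi_def image_image)
qed

section \<open>The categories and the functor \<open>R\<close>\<close>

lemma mt_id_hom:
  assumes "mt_algebra M"
  shows "mt_id M \<in> mt_hom M M" and "x \<in> BS M \<Longrightarrow> mt_id M x = x"
proof -
  interpret M: mt_alg M by (rule mt_alg.intro) fact
  have id: "mt_id M = (\<lambda>a\<in>carrier M. \<Squnion>\<^bsub>M\<^esub> {x |x. x \<in> carrier (suborder M (BS M)) \<and> x \<sqsubseteq>\<^bsub>M\<^esub> a})"
    by (simp add: mt_id_def)
  note incl = boolean_hom_inclusion[OF M.boolean_order_axioms M.boolean_subalgebra_BS]
  show "mt_id M \<in> mt_hom M M" "x \<in> BS M \<Longrightarrow> mt_id M x = x"
    unfolding id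
    using mt_hom_extension[OF assms assms M.boolean_order_BS incl incl _ _ raney_map_id[OF assms]]
    by simp_all
qed

text \<open>
  A pointwise composite need not be the join of its values on \<open>BS M\<close>. The composite of the category
  repairs this without changing the values on \<open>BS M\<close>, which \<open>f\<close> maps into \<open>BS N\<close>.
\<close>

lemma mt_comp_hom:
  assumes "mt_algebra M" "mt_algebra N" "mt_algebra P" "f \<in> mt_hom M N" "g \<in> mt_hom N P"
  shows "mt_comp M P g f \<in> mt_hom M P" and "x \<in> BS M \<Longrightarrow> mt_comp M P g f x = g (f x)"
proof -
  interpret M: mt_alg M by (rule mt_alg.intro) fact
  interpret N: mt_alg N by (rule mt_alg.intro) fact
  interpret P: mt_alg P by (rule mt_alg.intro) fact
  have comp: "mt_comp M P g f =
      (\<lambda>a\<in>carrier M. \<Squnion>\<^bsub>P\<^esub> {g (f x) |x. x \<in> carrier (suborder M (BS M)) \<and> x \<sqsubseteq>\<^bsub>M\<^esub> a})"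
    by (simp add: mt_comp_def)
  note incl = boolean_hom_inclusion[OF M.boolean_order_axioms M.boolean_subalgebra_BS]
  note f = boolean_homD[OF mt_hom_boolean_hom[OF assms(1,2,4)]]
    and g = boolean_homD[OF mt_hom_boolean_hom[OF assms(2,3,5)]]
  have gf: "boolean_hom (suborder M (BS M)) P (\<lambda>x. g (f x))"
    by (rule boolean_homI[OF M.boolean_order_BS P.boolean_order_axioms])
      (use f g mt_hom_BS_closed[OF assms(1,2,4)] in \<open>simp_all add: N.BS_ops\<close>)
  note k = raney_map_comp[OF mt_homD(3)[OF assms(1,2,4)] mt_homD(3)[OF assms(2,3,5)]]
  show "mt_comp M P g f \<in> mt_hom M P" "x \<in> BS M \<Longrightarrow> mt_comp M P g f x = g (f x)"
    unfolding comp
    using mt_hom_extension[OF assms(1,3) M.boolean_order_BS incl gf _ _ k]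
    by simp_all
qed

lemma R_map_hom:
  assumes "mt_algebra M" "mt_algebra N" "f \<in> mt_hom M N"
  shows "R_map M f \<in> re_hom (R_obj M) (R_obj N)"
proof -
  note f = mt_homD(3)[OF assms]
  then have "raney_map M N (R_map M f)"
    by (subst raney_map_cong[OF assms(1), where g = f]) (simp_all add: R_map_def)
  then show ?thesis
    unfolding re_hom_R_obj_iff[OF assms(1,2)] using raney_mapD(1)[OF f] by (simp add: R_map_def)
qed

lemma R_map_id:
  assumes "mt_algebra M"
  shows "R_map M (mt_id M) = re_id (R_obj M)"
proof -
  interpret M: mt_alg M by (rule mt_alg.intro) fact
  show ?thesis
    using mt_id_hom(2)[OF assms] M.saturated_BS
    by (auto simp: R_map_def re_id_def R_obj_def intro!: restrict_ext)
qed

lemma R_map_comp: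
  assumes "mt_algebra M" "mt_algebra N" "mt_algebra P" "f \<in> mt_hom M N" "g \<in> mt_hom N P"
  shows "R_map M (mt_comp M P g f) = re_comp (R_obj M) (R_map N g) (R_map M f)"
proof -
  interpret M: mt_alg M by (rule mt_alg.intro) fact
  show ?thesis
    using mt_comp_hom(2)[OF assms] M.saturated_BS raney_mapD(1)[OF mt_homD(3)[OF assms(1,2,4)]]
    by (auto simp: R_map_def re_comp_def R_obj_def compose_def intro!: ext)
qed

lemma R_map_faithful:
  assumes "mt_algebra M" "mt_algebra N" "f \<in> mt_hom M N" "g \<in> mt_hom M N" "R_map M f = R_map M g"
  shows "f = g"
proof (rule mt_hom_eqI[OF assms(1-4)])
  show "f s = g s" if "s \<in> saturateds M" for s
    using fun_cong[OF assms(5), of s] that by (simp add: R_map_def)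
qed

abbreviation BS_iso :: "'a mt \<Rightarrow> 'a set set \<Rightarrow> 'a" where
  "BS_iso M \<equiv> env_lift (R_obj M) M (\<lambda>s. s)"

lemma bounded_lattice_hom_raney_map:
  assumes "mt_algebra M" "mt_algebra N" "raney_map M N k"
  shows "bounded_lattice_hom (R_obj M) N k"
proof -
  interpret M: mt_alg M by (rule mt_alg.intro) fact
  interpret N: mt_alg N by (rule mt_alg.intro) fact
  show ?thesis
    unfolding bounded_lattice_hom_def
    using raney_mapD[OF assms(3)] raney_map_meet[OF assms(3)] raney_map_top[OF assms] N.saturated_carrier
    by (simp add: M.R_obj_simps M.R_obj_order Pi_def)
qed

text \<open>
  \<open>BS M\<close> is the Boolean envelope of the coframe of saturated elements: a nonempty member of the
  envelope contains a nonempty difference \<open>a - d\<close> with \<open>a\<close>, \<open>d\<close> saturated, and the image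
  \<open>a \<sqinter> compl M d\<close> of that is not \<open>\<bottom>\<close>.
\<close>

lemma BS_iso:
  assumes "mt_algebra M"
  shows BS_iso_hom: "boolean_hom (boolean_envelope (R_obj M)) M (BS_iso M)"
    and BS_iso_emb: "s \<in> saturateds M \<Longrightarrow> BS_iso M (env_emb (R_obj M) s) = s"
    and BS_iso_image: "BS_iso M ` carrier (boolean_envelope (R_obj M)) = BS M"
    and BS_iso_reflects: "\<lbrakk>x \<in> carrier (boolean_envelope (R_obj M)); y \<in> carrier (boolean_envelope (R_obj M));
      BS_iso M x \<sqsubseteq>\<^bsub>M\<^esub> BS_iso M y\<rbrakk> \<Longrightarrow> x \<sqsubseteq>\<^bsub>boolean_envelope (R_obj M)\<^esub> y"
proof -
  interpret M: mt_alg M by (rule mt_alg.intro) fact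
  let ?C = "R_obj M" and ?E = "boolean_envelope (R_obj M)"
  interpret C: bounded_distrib_lattice ?C by (rule M.bounded_distrib_R_obj)
  note lift = env_lift[OF M.bounded_distrib_R_obj M.boolean_order_axioms
      bounded_lattice_hom_raney_map[OF assms assms raney_map_id[OF assms]]]
  show hom: "boolean_hom ?E M (BS_iso M)" by (rule lift)
  show emb: "BS_iso M (env_emb ?C s) = s" if "s \<in> saturateds M" for s
    using lift(2)[of s] that by (simp add: M.R_obj_simps)
  note e = boolean_homD[OF hom]
  have "BS_iso M ` boolean_generated ?E (env_emb ?C ` carrier ?C)
      = boolean_generated M (BS_iso M ` env_emb ?C ` carrier ?C)"
    by (rule generated_image[OF env.boolean_order_F M.boolean_order_axioms hom])
      (auto intro: env_emb_in_envelope)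
  also have "BS_iso M ` env_emb ?C ` carrier ?C = saturateds M"
    by (simp add: M.R_obj_simps image_image emb)
  finally show "BS_iso M ` carrier ?E = BS M"
    by (simp add: envelope_generated BS_def)
  assume x: "x \<in> carrier ?E" and y: "y \<in> carrier ?E" and le: "BS_iso M x \<sqsubseteq>\<^bsub>M\<^esub> BS_iso M y"
  have "x \<subseteq> y"
  proof
    fix P assume "P \<in> x"
    show "P \<in> y"
    proof (rule ccontr)
      assume "P \<notin> y"
      have xy: "x - y \<in> carrier ?E" "x - y = x \<sqinter>\<^bsub>?E\<^esub> compl ?E y"
      proof -
        have "x - y = x \<inter> (Spec ?C - y)" using env.sub_F[OF x] by blast
        then show "x - y \<in> carrier ?E" "x - y = x \<sqinter>\<^bsub>?E\<^esub> compl ?E y"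
          using x y by (simp_all add: env.Int_F env.Diff_F env.set_ops)
      qed
      obtain a d where a: "a \<in> carrier ?C" and d: "d \<in> carrier ?C"
        and P: "P \<in> env_emb ?C a - env_emb ?C d" and sub: "env_emb ?C a - env_emb ?C d \<subseteq> x - y"
        using envelope_base[OF M.bounded_distrib_R_obj xy(1), of P] \<open>P \<in> x\<close> \<open>P \<notin> y\<close> by blast
      have ad: "a \<in> saturateds M" "d \<in> saturateds M" "a \<in> carrier M" "d \<in> carrier M"
        using a d M.saturated_carrier by (auto simp: M.R_obj_simps)
      have "env_emb ?C a - env_emb ?C d = env_emb ?C a \<inter> (Spec ?C - env_emb ?C d)"
        using env_emb_subset_Spec[of ?C a] by blast
      then have diff: "env_emb ?C a - env_emb ?C d = env_emb ?C a \<sqinter>\<^bsub>?E\<^esub> compl ?E (env_emb ?C d)"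
          "env_emb ?C a - env_emb ?C d \<in> carrier ?E"
        using a d by (simp_all add: env.set_ops env_emb_in_envelope env.Int_F env.Diff_F)
      have "a \<sqinter>\<^bsub>M\<^esub> compl M d = BS_iso M (env_emb ?C a - env_emb ?C d)"
        unfolding diff(1) using a d ad by (simp add: e emb env_emb_in_envelope)
      also have "\<dots> \<sqsubseteq>\<^bsub>M\<^esub> BS_iso M (x - y)"
        by (rule boolean_hom_mono[OF hom diff(2) xy(1)]) (use sub in \<open>simp add: env.le_F\<close>)
      also have "\<dots> = BS_iso M x \<sqinter>\<^bsub>M\<^esub> compl M (BS_iso M y)"
        unfolding xy(2) using x y by (simp add: e)
      also have "\<dots> \<sqsubseteq>\<^bsub>M\<^esub> \<bottom>\<^bsub>M\<^esub>"
      proof -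
        have "BS_iso M x \<sqsubseteq>\<^bsub>M\<^esub> BS_iso M y \<squnion>\<^bsub>M\<^esub> \<bottom>\<^bsub>M\<^esub>"
          using le e(1)[OF x] e(1)[OF y] M.join_left by (meson M.bottom_closed M.join_closed M.le_trans)
        then show ?thesis
          using e(1)[OF x] e(1)[OF y] by (simp add: M.shunt)
      qed
      finally have "a \<sqinter>\<^bsub>M\<^esub> compl M d \<sqsubseteq>\<^bsub>M\<^esub> \<bottom>\<^bsub>M\<^esub>"
        using ad e(1)[OF x] e(1)[OF y] e(1)[OF xy(1)] e(1)[OF diff(2)] by simp
      then have "a \<sqsubseteq>\<^bsub>M\<^esub> d \<squnion>\<^bsub>M\<^esub> \<bottom>\<^bsub>M\<^esub>" using ad by (simp add: M.shunt)
      moreover have "d \<squnion>\<^bsub>M\<^esub> \<bottom>\<^bsub>M\<^esub> = d" by (rule M.join_eqI) (use ad in auto)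
      ultimately have "a \<sqsubseteq>\<^bsub>?C\<^esub> d" by (simp add: M.R_obj_simps)
      then show False using P a d by (auto simp: C.env_emb_subset_iff[symmetric])
    qed
  qed
  then show "x \<sqsubseteq>\<^bsub>?E\<^esub> y" by (simp add: env.le_F)
qed

text \<open>
  So the parametrization of \<open>BS M\<close> by the envelope restricts to the inverse of \<open>env_emb\<close> on saturated
  elements.
\<close>

lemma BS_iso_saturated:
  assumes "mt_algebra M" "x \<in> carrier (boolean_envelope (R_obj M))" "BS_iso M x \<in> saturateds M"
  shows "env_emb (R_obj M) (BS_iso M x) = x"
proof -
  interpret M: mt_alg M by (rule mt_alg.intro) fact
  show ?thesis
    by (rule env.le_antisym[where C = "R_obj M"])
      (use assms in \<open>auto intro!: BS_iso_reflects[OF assms(1)] env_emb_in_envelope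
        simp: BS_iso_emb[OF assms(1)] M.R_obj_simps M.saturated_carrier\<close>)
qed

text \<open>
  A morphism \<open>h\<close> of Raney extensions is a lattice morphism on saturated elements, so it extends to
  their Boolean envelope \<open>BS M\<close>, and from there to \<open>M\<close> by joins.
\<close>

lemma R_map_full:
  assumes "mt_algebra M" "mt_algebra N" "h \<in> re_hom (R_obj M) (R_obj N)"
  shows "\<exists>f\<in>mt_hom M N. R_map M f = h"
proof -
  interpret M: mt_alg M by (rule mt_alg.intro) fact
  interpret N: mt_alg N by (rule mt_alg.intro) fact
  let ?E = "boolean_envelope (R_obj M)"
  have h: "h \<in> saturateds M \<rightarrow>\<^sub>E saturateds N" "raney_map M N h"
    using assms(3) re_hom_R_obj_iff[OF assms(1,2)] by auto
  note lift = env_lift[OF M.bounded_distrib_R_obj N.boolean_order_axioms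
      bounded_lattice_hom_raney_map[OF assms(1,2) h(2)]]
  have agree: "env_lift (R_obj M) N h x = h (BS_iso M x)"
    if "x \<in> carrier ?E" "BS_iso M x \<in> saturateds M" for x
    using lift(2)[of "BS_iso M x"] BS_iso_saturated[OF assms(1) that] that(2) by (simp add: M.R_obj_simps)
  note ext = mt_hom_extension[OF assms(1,2) env.boolean_order_F BS_iso_hom[OF assms(1)] lift(1)
      BS_iso_reflects[OF assms(1)] BS_iso_image[OF assms(1)] h(2) agree]
  show ?thesis
  proof (rule bexI[OF _ ext(1)])
    show "R_map M (\<lambda>a\<in>carrier M. \<Squnion>\<^bsub>N\<^esub> {env_lift (R_obj M) N h x |x. x \<in> carrier ?E \<and> BS_iso M x \<sqsubseteq>\<^bsub>M\<^esub> a}) = h"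
      unfolding R_map_def
      by (rule extensionalityI[of _ "saturateds M"]) (use h(1) ext(3) in \<open>auto simp: PiE_def\<close>)
  qed
qed

section \<open>The MacNeille completion of a Boolean algebra\<close>

text \<open>
  The record \<open>N\<close> is left open since the completion also occurs with an interior operator.
\<close>

locale macneille_order = B: boolean_order B for B :: "('a, 'm) gorder_scheme" +
  fixes N :: "('a set, 'n) gorder_scheme" (structure)
  assumes carrier_N: "carrier N = carrier (macneille B)"
    and le_N: "le N = (\<subseteq>)" and eq_N: "eq N = (=)"
begin

abbreviation cl :: "'a set \<Rightarrow> 'a set" where
  "cl A \<equiv> Lower B (Upper B A)"

lemma mem_cl:
  assumes "A \<subseteq> carrier B"
  shows "x \<in> cl A \<longleftrightarrow> x \<in> carrier B \<and> (\<forall>u\<in>carrier B. (\<forall>a\<in>A. a \<sqsubseteq>\<^bsub>B\<^esub> u) \<longrightarrow> x \<sqsubseteq>\<^bsub>B\<^esub> u)"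
proof -
  have "Upper B A = {u \<in> carrier B. \<forall>a\<in>A. a \<sqsubseteq>\<^bsub>B\<^esub> u}" using assms by (auto simp: Upper_def)
  then show ?thesis by (auto simp: Lower_def)
qed

lemma cl_superset: "A \<subseteq> carrier B \<Longrightarrow> A \<subseteq> cl A"
  by (auto simp: mem_cl)

lemma normal_iff: "A \<in> carrier N \<longleftrightarrow> A \<subseteq> carrier B \<and> cl A \<subseteq> A"
  unfolding carrier_N macneille_def using cl_superset by auto

lemma normalI:
  assumes "A \<subseteq> carrier B"
    "\<And>x. \<lbrakk>x \<in> carrier B; \<And>u. \<lbrakk>u \<in> carrier B; \<And>a. a \<in> A \<Longrightarrow> a \<sqsubseteq>\<^bsub>B\<^esub> u\<rbrakk> \<Longrightarrow> x \<sqsubseteq>\<^bsub>B\<^esub> u\<rbrakk> \<Longrightarrow> x \<in> A"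
  shows "A \<in> carrier N"
  unfolding normal_iff using assms by (auto simp: mem_cl)

lemma normalD:
  assumes "A \<in> carrier N" "x \<in> carrier B"
    "\<And>u. \<lbrakk>u \<in> carrier B; \<And>a. a \<in> A \<Longrightarrow> a \<sqsubseteq>\<^bsub>B\<^esub> u\<rbrakk> \<Longrightarrow> x \<sqsubseteq>\<^bsub>B\<^esub> u"
  shows "x \<in> A"
proof -
  have A: "A \<subseteq> carrier B" "cl A \<subseteq> A" using assms(1) by (auto simp: normal_iff)
  have "x \<in> cl A" unfolding mem_cl[OF A(1)] using assms(2,3) by blast
  then show ?thesis using A(2) by blast
qed

lemma normal_carrier: "\<lbrakk>A \<in> carrier N; x \<in> A\<rbrakk> \<Longrightarrow> x \<in> carrier B"
  by (auto simp: normal_iff)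

lemma normal_down:
  assumes "A \<in> carrier N" "a \<in> A" "x \<in> carrier B" "x \<sqsubseteq>\<^bsub>B\<^esub> a"
  shows "x \<in> A"
  by (rule normalD[OF assms(1,3)]) (use assms normal_carrier B.le_trans in blast)

lemma cl_normal:
  assumes "A \<subseteq> carrier B" shows "cl A \<in> carrier N"
proof (rule normalI)
  show "cl A \<subseteq> carrier B" by simp
  fix x assume x: "x \<in> carrier B"
    and le: "\<And>u. \<lbrakk>u \<in> carrier B; \<And>a. a \<in> cl A \<Longrightarrow> a \<sqsubseteq>\<^bsub>B\<^esub> u\<rbrakk> \<Longrightarrow> x \<sqsubseteq>\<^bsub>B\<^esub> u"
  show "x \<in> cl A"
    unfolding mem_cl[OF assms] using x le by (simp add: mem_cl[OF assms])
qed

lemma cl_least: "\<lbrakk>A \<subseteq> D; D \<in> carrier N\<rbrakk> \<Longrightarrow> cl A \<subseteq> D"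
proof
  fix x assume A: "A \<subseteq> D" and D: "D \<in> carrier N" and x: "x \<in> cl A"
  then have "A \<subseteq> carrier B" by (auto simp: normal_iff)
  with x have x: "x \<in> carrier B" "\<And>u. \<lbrakk>u \<in> carrier B; \<forall>a\<in>A. a \<sqsubseteq>\<^bsub>B\<^esub> u\<rbrakk> \<Longrightarrow> x \<sqsubseteq>\<^bsub>B\<^esub> u"
    by (simp_all add: mem_cl)
  show "x \<in> D"
    by (rule normalD[OF D x(1)], rule x(2)) (use A in auto)
qed

sublocale partial_order N
  by (rule partial_order_inclusion[OF eq_N le_N])

sublocale complete_lattice N
proof (rule complete_lattice_from_sups)
  fix \<A> assume A: "\<A> \<subseteq> carrier N"
  then have U: "\<Union>\<A> \<subseteq> carrier B" using normal_carrier by blast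
  show "\<exists>x\<in>carrier N. (\<forall>a\<in>\<A>. a \<sqsubseteq> x) \<and> (\<forall>y\<in>carrier N. (\<forall>a\<in>\<A>. a \<sqsubseteq> y) \<longrightarrow> x \<sqsubseteq> y)"
    by (rule bexI[OF _ cl_normal[OF U]])
      (use cl_superset[OF U] cl_least in \<open>simp add: le_N Sup_le_iff\<close>)
qed

lemma Inter_normal: "\<lbrakk>A \<in> carrier N; D \<in> carrier N\<rbrakk> \<Longrightarrow> A \<inter> D \<in> carrier N"
  by (rule normalI) (auto intro: normalD normal_carrier)

lemma meet_N: "\<lbrakk>A \<in> carrier N; D \<in> carrier N\<rbrakk> \<Longrightarrow> A \<sqinter> D = A \<inter> D"
  by (rule meet_eqI) (auto simp: le_N Inter_normal)

lemma join_N: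
  assumes "A \<in> carrier N" "D \<in> carrier N" shows "A \<squnion> D = cl (A \<union> D)"
proof -
  have U: "A \<union> D \<subseteq> carrier B" using assms normal_carrier by blast
  show ?thesis
    by (rule join_eqI) (use assms cl_normal[OF U] cl_superset[OF U] cl_least in \<open>auto simp: le_N\<close>)
qed

lemma bottom_N: "\<bottom> = {\<bottom>\<^bsub>B\<^esub>}"
proof (rule bottom_eqI)
  show "{\<bottom>\<^bsub>B\<^esub>} \<in> carrier N"
    by (rule normalI) (auto intro: B.le_antisym)
  show "{\<bottom>\<^bsub>B\<^esub>} \<sqsubseteq> A" if "A \<in> carrier N" for A
    using normalD[OF that B.bottom_closed] by (simp add: le_N)
qed

lemma top_N: "\<top> = carrier B"
  by (rule top_eqI) (auto simp: le_N intro: normalI normal_carrier)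

text \<open>
  The complement of a normal set \<open>A\<close> is the set of lower bounds of the complements of its elements,
  equivalently of all elements disjoint from every member of \<open>A\<close>.
\<close>

sublocale boolean_order N
proof (unfold_locales, goal_cases)
  case (1 X Y Z)
  note c = normal_carrier[OF 1(1)] normal_carrier[OF 1(2)] normal_carrier[OF 1(3)]
  have XYZ: "X \<inter> Y \<in> carrier N" "X \<inter> Z \<in> carrier N" using 1 by (simp_all add: Inter_normal)
  have U: "(X \<inter> Y) \<union> (X \<inter> Z) \<subseteq> carrier B" using c by blast
  have V: "Y \<union> Z \<subseteq> carrier B" using c by blast
  have "X \<inter> cl (Y \<union> Z) = cl ((X \<inter> Y) \<union> (X \<inter> Z))"
  proof (rule equalityI[OF subsetI])
    fix x assume "x \<in> X \<inter> cl (Y \<union> Z)"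
    then have x: "x \<in> X" "x \<in> carrier B"
      and le: "\<And>u. \<lbrakk>u \<in> carrier B; \<forall>a\<in>Y \<union> Z. a \<sqsubseteq>\<^bsub>B\<^esub> u\<rbrakk> \<Longrightarrow> x \<sqsubseteq>\<^bsub>B\<^esub> u"
      using c by (auto simp: mem_cl[OF V])
    \<comment> \<open>if \<open>u\<close> bounds \<open>X \<inter> Y\<close> and \<open>X \<inter> Z\<close>, then \<open>compl B x \<squnion> u\<close> bounds \<open>Y \<union> Z\<close> and hence \<open>x\<close>\<close>
    have "x \<sqsubseteq>\<^bsub>B\<^esub> u" if u: "u \<in> carrier B" "\<forall>a\<in>X \<inter> Y \<union> X \<inter> Z. a \<sqsubseteq>\<^bsub>B\<^esub> u" for u
    proof -
      have "a \<sqsubseteq>\<^bsub>B\<^esub> compl B x \<squnion>\<^bsub>B\<^esub> u" if "a \<in> Y \<union> Z" for a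
      proof -
        have a: "a \<in> carrier B" using that V by blast
        have "a \<sqinter>\<^bsub>B\<^esub> x \<in> X"
          by (rule normal_down[OF 1(1) x(1)]) (use a x B.meet_right in auto)
        moreover have "a \<sqinter>\<^bsub>B\<^esub> x \<in> Y \<or> a \<sqinter>\<^bsub>B\<^esub> x \<in> Z"
          using that normal_down[OF 1(2), of a "a \<sqinter>\<^bsub>B\<^esub> x"] normal_down[OF 1(3), of a "a \<sqinter>\<^bsub>B\<^esub> x"]
            a x B.meet_left by auto
        ultimately have "a \<sqinter>\<^bsub>B\<^esub> x \<sqsubseteq>\<^bsub>B\<^esub> u" using u by blast
        then show ?thesis using a x u by (simp add: B.shunt')
      qed
      then have "x \<sqsubseteq>\<^bsub>B\<^esub> compl B x \<squnion>\<^bsub>B\<^esub> u" using le x u by simp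
      then have "x \<sqinter>\<^bsub>B\<^esub> x \<sqsubseteq>\<^bsub>B\<^esub> u" using x u by (simp add: B.shunt')
      moreover have "x \<sqinter>\<^bsub>B\<^esub> x = x" by (rule B.meet_eqI) (use x in auto)
      ultimately show ?thesis by simp
    qed
    then show "x \<in> cl ((X \<inter> Y) \<union> (X \<inter> Z))" using x by (simp add: mem_cl[OF U])
  next
    have "cl ((X \<inter> Y) \<union> (X \<inter> Z)) \<subseteq> X"
      by (rule cl_least) (use 1 in auto)
    moreover have "cl ((X \<inter> Y) \<union> (X \<inter> Z)) \<subseteq> cl (Y \<union> Z)"
      by (rule cl_least[OF _ cl_normal[OF V]]) (use cl_superset[OF V] in blast)
    ultimately show "cl ((X \<inter> Y) \<union> (X \<inter> Z)) \<subseteq> X \<inter> cl (Y \<union> Z)" by blast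
  qed
  then show ?case
    using 1 XYZ by (simp add: meet_N join_N cl_normal[OF V])
next
  case (2 A)
  note c = normal_carrier[OF 2]
  define A' where "A' = {x \<in> carrier B. \<forall>a\<in>A. x \<sqsubseteq>\<^bsub>B\<^esub> compl B a}"
  have A': "A' \<in> carrier N"
    by (rule normalI) (use c in \<open>auto simp: A'_def\<close>)
  have U: "A \<union> A' \<subseteq> carrier B" using c by (auto simp: A'_def)
  have "A \<inter> A' = {\<bottom>\<^bsub>B\<^esub>}"
  proof (intro equalityI subsetI)
    fix x assume "x \<in> A \<inter> A'"
    then have x: "x \<in> carrier B" "x \<sqsubseteq>\<^bsub>B\<^esub> compl B x" by (auto simp: A'_def)
    then have "env_emb B x = {}"
      using B.env_emb_sub[of x] by (auto simp: B.le_iff_env_emb B.env_emb_simps)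
    then show "x \<in> {\<bottom>\<^bsub>B\<^esub>}" using x B.env_emb_eq_iff[of x "\<bottom>\<^bsub>B\<^esub>"] by (simp add: B.env_emb_bottom)
  next
    fix x assume "x \<in> {\<bottom>\<^bsub>B\<^esub>}"
    then show "x \<in> A \<inter> A'"
      using normalD[OF 2 B.bottom_closed] c by (auto simp: A'_def)
  qed
  moreover have "cl (A \<union> A') = carrier B"
  proof (intro equalityI subsetI)
    fix x assume x: "x \<in> carrier B"
    have "x \<sqsubseteq>\<^bsub>B\<^esub> u" if u: "u \<in> carrier B" "\<forall>a\<in>A \<union> A'. a \<sqsubseteq>\<^bsub>B\<^esub> u" for u
    proof -
      have "compl B u \<sqsubseteq>\<^bsub>B\<^esub> compl B a" if "a \<in> A" for a
        using u(1) u(2)[rule_format, of a] that c[OF that]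
        by (auto simp: B.le_iff_env_emb B.env_emb_simps)
      \<comment> \<open>so \<open>u\<close> lies above its own complement, that is, \<open>u\<close> is the top element\<close>
      then have "compl B u \<in> A'" using u by (simp add: A'_def)
      then have "compl B u \<sqsubseteq>\<^bsub>B\<^esub> u" using u by blast
      then have "env_emb B u = {P. prime_filter B P}"
        using u B.env_emb_sub[of u] by (auto simp: B.le_iff_env_emb B.env_emb_simps)
      then show ?thesis using x u B.env_emb_sub[of x] by (simp add: B.le_iff_env_emb)
    qed
    then show "x \<in> cl (A \<union> A')" using x by (simp add: mem_cl[OF U])
  qed (auto simp: mem_cl[OF U])
  ultimately have "is_compl N A A'"
    using 2 A' by (simp add: is_compl_def meet_N join_N bottom_N top_N)
  then show ?case by blast
qed

lemma mac_emb_normal: "b \<in> carrier B \<Longrightarrow> mac_emb B b \<in> carrier N"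
  unfolding mac_emb_def by (rule normalI) simp_all

lemma mac_emb_subset_iff:
  assumes "A \<in> carrier N" "b \<in> carrier B"
  shows "mac_emb B b \<subseteq> A \<longleftrightarrow> b \<in> A"
  using assms normal_down[OF assms(1)] by (auto simp: mac_emb_def)

lemma mac_emb_le_iff:
  "\<lbrakk>b \<in> carrier B; b' \<in> carrier B\<rbrakk> \<Longrightarrow> mac_emb B b \<subseteq> mac_emb B b' \<longleftrightarrow> b \<sqsubseteq>\<^bsub>B\<^esub> b'"
  by (simp add: mac_emb_subset_iff[OF mac_emb_normal]) (simp add: mac_emb_def)

lemma mac_emb_mono_iff:
  "\<lbrakk>b \<in> carrier B; b' \<in> carrier B\<rbrakk> \<Longrightarrow> mac_emb B b \<sqsubseteq> mac_emb B b' \<longleftrightarrow> b \<sqsubseteq>\<^bsub>B\<^esub> b'"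
  by (simp add: le_N mac_emb_le_iff)

text \<open>
  Whatever joins and meets exist in \<open>B\<close> are preserved: a normal set that contains \<open>A\<close> contains all
  elements below every upper bound of \<open>A\<close>, in particular a least upper bound.
\<close>

lemma mac_emb_Sup:
  assumes "A \<subseteq> carrier B" "b \<in> carrier B" "\<And>a. a \<in> A \<Longrightarrow> a \<sqsubseteq>\<^bsub>B\<^esub> b"
    "\<And>u. \<lbrakk>u \<in> carrier B; \<And>a. a \<in> A \<Longrightarrow> a \<sqsubseteq>\<^bsub>B\<^esub> u\<rbrakk> \<Longrightarrow> b \<sqsubseteq>\<^bsub>B\<^esub> u"
  shows "\<Squnion>(mac_emb B ` A) = mac_emb B b"
proof (rule sup_eqI)
  have c: "a \<in> carrier B" if "a \<in> A" for a using that assms(1) by blast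
  show "mac_emb B ` A \<subseteq> carrier N" "mac_emb B b \<in> carrier N"
    using c assms(2) mac_emb_normal by auto
  show "a \<sqsubseteq> mac_emb B b" if "a \<in> mac_emb B ` A" for a
    using that c assms(2,3) by (auto simp: mac_emb_mono_iff)
  fix D assume D: "D \<in> carrier N" and up: "\<And>a. a \<in> mac_emb B ` A \<Longrightarrow> a \<sqsubseteq> D"
  have AD: "a \<in> D" if "a \<in> A" for a
    using up[of "mac_emb B a"] that c mac_emb_subset_iff[OF D] by (auto simp: le_N)
  have "b \<in> D"
    by (rule normalD[OF D assms(2)], rule assms(4)) (simp_all add: AD)
  then show "mac_emb B b \<sqsubseteq> D" using D assms(2) by (simp add: le_N mac_emb_subset_iff)
qed

lemma mac_emb_Inf:
  assumes "A \<subseteq> carrier B" "b \<in> carrier B" "\<And>a. a \<in> A \<Longrightarrow> b \<sqsubseteq>\<^bsub>B\<^esub> a"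
    "\<And>u. \<lbrakk>u \<in> carrier B; \<And>a. a \<in> A \<Longrightarrow> u \<sqsubseteq>\<^bsub>B\<^esub> a\<rbrakk> \<Longrightarrow> u \<sqsubseteq>\<^bsub>B\<^esub> b"
  shows "\<Sqinter>(mac_emb B ` A) = mac_emb B b"
proof (rule inf_eqI)
  have c: "a \<in> carrier B" if "a \<in> A" for a using that assms(1) by blast
  show "mac_emb B ` A \<subseteq> carrier N" "mac_emb B b \<in> carrier N"
    using c assms(2) mac_emb_normal by auto
  show "mac_emb B b \<sqsubseteq> a" if "a \<in> mac_emb B ` A" for a
    using that c assms(2,3) by (auto simp: mac_emb_mono_iff)
  fix D assume D: "D \<in> carrier N" and low: "\<And>a. a \<in> mac_emb B ` A \<Longrightarrow> D \<sqsubseteq> a"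
  have "u \<sqsubseteq>\<^bsub>B\<^esub> a" if "u \<in> D" "a \<in> A" for u a
    using low[of "mac_emb B a"] that by (auto simp: le_N mac_emb_def)
  then show "D \<sqsubseteq> mac_emb B b"
    using normal_carrier[OF D] assms(4) by (auto simp: le_N mac_emb_def)
qed

lemma mac_emb_hom: "boolean_hom B N (mac_emb B)"
proof (rule boolean_homI[OF B.boolean_order_axioms boolean_order_axioms mac_emb_normal])
  fix x y assume xy: "x \<in> carrier B" "y \<in> carrier B"
  show "mac_emb B (x \<squnion>\<^bsub>B\<^esub> y) = mac_emb B x \<squnion> mac_emb B y"
  proof -
    have "\<Squnion>(mac_emb B ` {x, y}) = mac_emb B (x \<squnion>\<^bsub>B\<^esub> y)"
      by (rule mac_emb_Sup) (use xy in \<open>auto intro: B.join_left B.join_right B.join_le\<close>)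
    then show ?thesis unfolding join_def[of N] by simp
  qed
  show "mac_emb B (x \<sqinter>\<^bsub>B\<^esub> y) = mac_emb B x \<sqinter> mac_emb B y"
  proof -
    have "\<Sqinter>(mac_emb B ` {x, y}) = mac_emb B (x \<sqinter>\<^bsub>B\<^esub> y)"
      by (rule mac_emb_Inf) (use xy in \<open>auto intro: B.meet_left B.meet_right B.meet_le\<close>)
    then show ?thesis unfolding meet_def[of N] by simp
  qed
next
  show "mac_emb B \<bottom>\<^bsub>B\<^esub> = \<bottom>"
    unfolding bottom_N mac_emb_def by (auto intro: B.le_antisym)
  show "mac_emb B \<top>\<^bsub>B\<^esub> = \<top>"
    unfolding top_N mac_emb_def by auto
qed

end

section \<open>The Funayama envelope of a Raney extension\<close>

locale raney_ext =
  fixes R :: "'a raney" (structure)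
  assumes raney: "raney_extension R"

sublocale raney_ext \<subseteq> complete_lattice R
  using raney by (simp add: raney_extension_def coframe_def)

sublocale raney_ext \<subseteq> bounded_distrib_lattice R
  using raney by (intro coframe_bounded_distrib_lattice) (simp add: raney_extension_def)

sublocale raney_ext \<subseteq> mac: macneille_order "boolean_envelope R" "F_obj R"
  by (rule macneille_order.intro[OF env.boolean_order_F], unfold_locales)
    (simp_all add: F_obj_def Let_def macneille_def)

context raney_ext
begin

lemma join_Inf:
  assumes "a \<in> carrier R" "A \<subseteq> carrier R"
  shows "a \<squnion> \<Sqinter>A = \<Sqinter>((\<lambda>s. a \<squnion> s) ` A)"
  using raney assms by (simp add: raney_extension_def coframe_def)

lemma meet_Sup:
  assumes "a \<in> carrier R" "U \<subseteq> subfr R"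
  shows "a \<sqinter> \<Squnion>U = \<Squnion>((\<lambda>s. a \<sqinter> s) ` U)"
  using raney assms by (simp add: raney_extension_def)

lemma meet_generated: "c \<in> carrier R \<Longrightarrow> \<exists>U\<subseteq>subfr R. c = \<Sqinter>U"
  using raney by (simp add: raney_extension_def)

lemma
  shows subfr_subset: "subfr R \<subseteq> carrier R"
    and complete_subfr: "complete_lattice (suborder R (subfr R))"
    and subfr_Sup: "U \<subseteq> subfr R \<Longrightarrow> \<Squnion>U \<in> subfr R"
    and subfr_meet: "\<lbrakk>u \<in> subfr R; v \<in> subfr R\<rbrakk> \<Longrightarrow> u \<sqinter> v \<in> subfr R"
    and subfr_top: "\<top> \<in> subfr R"
proof -
  have sub: "subframe R (subfr R)" using raney by (simp add: raney_extension_def)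
  then show "subfr R \<subseteq> carrier R" by (simp add: subframe_def)
  show c: "complete_lattice (suborder R (subfr R))"
    using sub by (simp add: subframe_def frame_def)
  interpret O: complete_lattice "suborder R (subfr R)" by (rule c)
  have hom: "\<forall>A\<subseteq>subfr R. \<Squnion>\<^bsub>suborder R (subfr R)\<^esub> A = \<Squnion>A"
    "\<forall>x\<in>subfr R. \<forall>y\<in>subfr R. x \<sqinter>\<^bsub>suborder R (subfr R)\<^esub> y = x \<sqinter> y"
    "\<top>\<^bsub>suborder R (subfr R)\<^esub> = \<top>"
    using sub by (simp_all add: subframe_def frame_hom_def sup_pres_def meet_pres_def)
  show "\<Squnion>U \<in> subfr R" if "U \<subseteq> subfr R"
    using O.sup_closed[of U] that hom(1) by simp
  show "\<lbrakk>u \<in> subfr R; v \<in> subfr R\<rbrakk> \<Longrightarrow> u \<sqinter> v \<in> subfr R"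
    using O.meet_closed[of u v] hom(2) by simp
  show "\<top> \<in> subfr R" using O.top_closed hom(3) by simp
qed

lemma subfr_carrier: "u \<in> subfr R \<Longrightarrow> u \<in> carrier R"
  using subfr_subset by blast

text \<open>
  Meets of \<open>C\<close> remain meets in the Boolean envelope: a basic set \<open>a - d\<close> lies below all \<open>s \<in> A\<close> iff
  \<open>a \<sqsubseteq> d \<squnion> s\<close> for all \<open>s\<close>, hence \<open>a \<sqsubseteq> d \<squnion> \<Sqinter>A\<close> by the coframe law. Dually the law for joins of
  elements of \<open>L\<close> makes these joins remain joins.
\<close>

lemma env_emb_Inf:
  assumes A: "A \<subseteq> carrier R" and x: "x \<in> carrier (boolean_envelope R)"
    and le: "\<And>s. s \<in> A \<Longrightarrow> x \<subseteq> env_emb R s"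
  shows "x \<subseteq> env_emb R (\<Sqinter>A)"
proof
  fix P assume "P \<in> x"
  then obtain a d where c: "a \<in> carrier R" "d \<in> carrier R" and P: "P \<in> env_emb R a - env_emb R d"
    and sub: "env_emb R a - env_emb R d \<subseteq> x"
    using envelope_base[OF bounded_distrib_lattice_axioms x] by metis
  have s: "s \<in> carrier R" if "s \<in> A" for s using that A by blast
  have "a \<sqsubseteq> d \<squnion> s" if "s \<in> A" for s
  proof -
    have "env_emb R a \<subseteq> env_emb R (d \<squnion> s)"
      using sub le[OF that] s[OF that] c by (auto simp: env_emb_join)
    then show ?thesis using c s[OF that] by (simp add: env_emb_subset_iff)
  qed
  then have "a \<sqsubseteq> d \<squnion> \<Sqinter>A"
    unfolding join_Inf[OF c(2) A] using c s by (intro inf_greatest) auto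
  then have "env_emb R a \<subseteq> env_emb R d \<union> env_emb R (\<Sqinter>A)"
    using c A by (simp add: env_emb_subset_iff flip: env_emb_join)
  then show "P \<in> env_emb R (\<Sqinter>A)" using P by blast
qed

lemma env_emb_Sup:
  assumes U: "U \<subseteq> subfr R" and x: "x \<in> carrier (boolean_envelope R)"
    and le: "\<And>u. u \<in> U \<Longrightarrow> env_emb R u \<subseteq> x"
  shows "env_emb R (\<Squnion>U) \<subseteq> x"
proof
  fix P assume P: "P \<in> env_emb R (\<Squnion>U)"
  have u: "u \<in> carrier R" if "u \<in> U" for u using that U subfr_carrier by blast
  have U': "U \<subseteq> carrier R" using u by blast
  show "P \<in> x"
  proof (rule ccontr)
    assume "P \<notin> x"
    then have "P \<in> Spec R - x" using P by (auto simp: env_emb_def)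
    then obtain a d where c: "a \<in> carrier R" "d \<in> carrier R" and Pad: "P \<in> env_emb R a - env_emb R d"
      and sub: "env_emb R a - env_emb R d \<subseteq> Spec R - x"
      using envelope_base[OF bounded_distrib_lattice_axioms env.Diff_F[OF x]] by metis
    have "a \<sqinter> u \<sqsubseteq> d" if "u \<in> U" for u
    proof -
      have "env_emb R (a \<sqinter> u) \<subseteq> env_emb R d"
        using sub le[OF that] u[OF that] c by (auto simp: env_emb_meet)
      then show ?thesis using c u[OF that] by (simp add: env_emb_subset_iff)
    qed
    then have "a \<sqinter> \<Squnion>U \<sqsubseteq> d"
      unfolding meet_Sup[OF c(1) U] using c u by (intro sup_least) auto
    then have "env_emb R a \<inter> env_emb R (\<Squnion>U) \<subseteq> env_emb R d"
      using c U' by (simp add: env_emb_subset_iff flip: env_emb_meet)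
    then show False using P Pad by blast
  qed
qed

lemma F_emb_eq: "F_emb R c = mac_emb (boolean_envelope R) (env_emb R c)"
  by (simp add: F_emb_def fun_emb_def)

lemma F_emb_closed: "c \<in> carrier R \<Longrightarrow> F_emb R c \<in> carrier (F_obj R)"
  by (simp add: F_emb_eq mac.mac_emb_normal env_emb_in_envelope)

lemma F_emb_le_iff: "\<lbrakk>c \<in> carrier R; d \<in> carrier R\<rbrakk> \<Longrightarrow> F_emb R c \<subseteq> F_emb R d \<longleftrightarrow> c \<sqsubseteq> d"
  by (simp add: F_emb_eq mac.mac_emb_le_iff env_emb_in_envelope env.le_F env_emb_subset_iff)

lemma F_emb_Inf:
  assumes A: "A \<subseteq> carrier R"
  shows "F_emb R (\<Sqinter>A) = \<Sqinter>\<^bsub>F_obj R\<^esub> (F_emb R ` A)"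
proof -
  have s: "s \<in> carrier R" if "s \<in> A" for s using that A by blast
  have "\<Sqinter>\<^bsub>F_obj R\<^esub> (mac_emb (boolean_envelope R) ` (env_emb R ` A))
      = mac_emb (boolean_envelope R) (env_emb R (\<Sqinter>A))"
    by (rule mac.mac_emb_Inf)
      (use A s inf_lower[OF A] env_emb_Inf[OF A] in
        \<open>auto simp: env_emb_in_envelope env.le_F env_emb_subset_iff[symmetric]\<close>)
  then show ?thesis by (simp add: F_emb_eq image_image)
qed

lemma F_emb_Sup:
  assumes U: "U \<subseteq> subfr R"
  shows "F_emb R (\<Squnion>U) = \<Squnion>\<^bsub>F_obj R\<^esub> (F_emb R ` U)"
proof -
  have s: "s \<in> carrier R" if "s \<in> U" for s using that U subfr_carrier by blast
  then have U': "U \<subseteq> carrier R" by blast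
  have "\<Squnion>\<^bsub>F_obj R\<^esub> (mac_emb (boolean_envelope R) ` (env_emb R ` U))
      = mac_emb (boolean_envelope R) (env_emb R (\<Squnion>U))"
    by (rule mac.mac_emb_Sup)
      (use U' s sup_upper[OF U'] env_emb_Sup[OF U] in
        \<open>auto simp: env_emb_in_envelope env.le_F env_emb_subset_iff[symmetric]\<close>)
  then show ?thesis by (simp add: F_emb_eq image_image)
qed

lemma F_emb_meet: "\<lbrakk>c \<in> carrier R; d \<in> carrier R\<rbrakk> \<Longrightarrow> F_emb R (c \<sqinter> d) = F_emb R c \<inter> F_emb R d"
  using F_emb_Inf[of "{c, d}"] F_emb_closed
  by (simp add: meet_def[symmetric] mac.meet_N)

lemma F_emb_top: "F_emb R \<top> = \<top>\<^bsub>F_obj R\<^esub>"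
  using F_emb_Inf[of "{}"] by (simp add: Inf_empty mac.Inf_empty)

text \<open>
  Since the embedding of \<open>L\<close> preserves joins, \<open>box\<close> sends \<open>a\<close> to the largest element of \<open>L\<close> below \<open>a\<close>.
  The laws of an interior operator follow from this.
\<close>

lemma box_F_obj:
  assumes "a \<in> carrier (F_obj R)"
  shows "\<exists>u\<in>subfr R. box (F_obj R) a = F_emb R u" "box (F_obj R) a \<subseteq> a"
    "\<lbrakk>u \<in> subfr R; F_emb R u \<subseteq> a\<rbrakk> \<Longrightarrow> F_emb R u \<subseteq> box (F_obj R) a"
proof -
  let ?U = "{u \<in> subfr R. F_emb R u \<subseteq> a}"
  have sup_eq: "\<Squnion>\<^bsub>macneille (boolean_envelope R)\<^esub> A = \<Squnion>\<^bsub>F_obj R\<^esub> A" for A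
    by (simp add: F_obj_def Let_def sup_def least_def Upper_def macneille_def)
  have box: "box (F_obj R) a = \<Squnion>\<^bsub>F_obj R\<^esub> (F_emb R ` ?U)"
    unfolding sup_eq[symmetric] by (simp add: F_obj_def Let_def macneille_def image_Collect)
  have c: "F_emb R ` ?U \<subseteq> carrier (F_obj R)" using F_emb_closed subfr_carrier by blast
  have "\<Squnion>?U \<in> subfr R" by (rule subfr_Sup) blast
  moreover have "box (F_obj R) a = F_emb R (\<Squnion>?U)"
    unfolding box by (rule F_emb_Sup[symmetric]) blast
  ultimately show "\<exists>u\<in>subfr R. box (F_obj R) a = F_emb R u" by blast
  have "\<Squnion>\<^bsub>F_obj R\<^esub> (F_emb R ` ?U) \<sqsubseteq>\<^bsub>F_obj R\<^esub> a"
    by (rule mac.sup_least[OF c assms]) (auto simp: mac.le_N)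
  then show "box (F_obj R) a \<subseteq> a" by (simp add: box mac.le_N)
  show "F_emb R u \<subseteq> box (F_obj R) a" if "u \<in> subfr R" "F_emb R u \<subseteq> a"
    unfolding box using mac.sup_upper[OF c, of "F_emb R u"] that by (auto simp: mac.le_N)
qed

lemma mt_algebra_F_obj: "mt_algebra (F_obj R)"
proof -
  let ?N = "F_obj R"
  have closed: "box ?N a \<in> carrier ?N" if "a \<in> carrier ?N" for a
    using box_F_obj(1)[OF that] F_emb_closed subfr_carrier by metis
  have "box ?N \<top>\<^bsub>?N\<^esub> = \<top>\<^bsub>?N\<^esub>"
    using box_F_obj(2)[OF mac.top_closed] box_F_obj(3)[OF mac.top_closed, of \<top>] by (simp add: F_emb_top subfr_top equalityI)
  moreover have "box ?N (a \<sqinter>\<^bsub>?N\<^esub> b) = box ?N a \<sqinter>\<^bsub>?N\<^esub> box ?N b"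
    if ab: "a \<in> carrier ?N" "b \<in> carrier ?N" for a b
  proof -
    obtain u v where uv: "u \<in> subfr R" "box ?N a = F_emb R u" "v \<in> subfr R" "box ?N b = F_emb R v"
      using box_F_obj(1) ab by metis
    have i: "a \<inter> b \<in> carrier ?N" using ab by (rule mac.Inter_normal)
    obtain w where w: "w \<in> subfr R" "box ?N (a \<inter> b) = F_emb R w" using box_F_obj(1)[OF i] by blast
    have "F_emb R (u \<sqinter> v) \<subseteq> a \<inter> b"
      using uv box_F_obj(2)[OF ab(1)] box_F_obj(2)[OF ab(2)] subfr_carrier by (auto simp: F_emb_meet)
    then have "box ?N a \<inter> box ?N b \<subseteq> box ?N (a \<inter> b)"
      using box_F_obj(3)[OF i, of "u \<sqinter> v"] uv subfr_meet subfr_carrier by (simp add: F_emb_meet)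
    moreover have "box ?N (a \<inter> b) \<subseteq> box ?N a \<inter> box ?N b"
      using box_F_obj(3)[OF ab(1), of w] box_F_obj(3)[OF ab(2), of w] w box_F_obj(2)[OF i] by simp
    ultimately show ?thesis using ab closed by (simp add: mac.meet_N)
  qed
  moreover have "box ?N a \<subseteq> box ?N (box ?N a)" if "a \<in> carrier ?N" for a
    using box_F_obj(1)[OF that] box_F_obj(3)[OF closed[OF that]] by auto
  ultimately show ?thesis
    unfolding mt_algebra_def boolean_lattice_iff
    using mac.complete_lattice_axioms mac.boolean_order_axioms closed box_F_obj(2)
    by (simp add: mac.le_N)
qed

lemma opens_F_obj: "opens (F_obj R) = F_emb R ` subfr R"
proof (intro equalityI subsetI)
  fix a assume "a \<in> opens (F_obj R)"
  then have "a \<in> carrier (F_obj R)" "box (F_obj R) a = a" by (auto simp: opens_def)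
  then show "a \<in> F_emb R ` subfr R" using box_F_obj(1)[of a] by auto
next
  fix a assume "a \<in> F_emb R ` subfr R"
  then obtain u where u: "u \<in> subfr R" "a = F_emb R u" by blast
  then have a: "a \<in> carrier (F_obj R)" using F_emb_closed subfr_carrier by simp
  show "a \<in> opens (F_obj R)"
    unfolding opens_def using a box_F_obj(2)[OF a] box_F_obj(3)[OF a u(1)] u(2) by blast
qed

text \<open>
  The embedding of \<open>C\<close> preserves meets and \<open>L\<close> meet-generates \<open>C\<close>.
\<close>

lemma saturateds_F_obj: "saturateds (F_obj R) = F_emb R ` carrier R"
proof (intro equalityI subsetI)
  fix a assume "a \<in> saturateds (F_obj R)"
  then obtain V where V: "V \<subseteq> F_emb R ` subfr R" "a = \<Sqinter>\<^bsub>F_obj R\<^esub> V"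
    by (auto simp: saturateds_def opens_F_obj)
  then obtain U where U: "U \<subseteq> subfr R" "V = F_emb R ` U" by (auto simp: subset_image_iff)
  then have "U \<subseteq> carrier R" using subfr_subset by blast
  then show "a \<in> F_emb R ` carrier R"
    using V(2) U(2) F_emb_Inf by (intro image_eqI[of _ _ "\<Sqinter>U"]) simp_all
next
  fix a assume "a \<in> F_emb R ` carrier R"
  then obtain c where c: "c \<in> carrier R" "a = F_emb R c" by blast
  obtain U where U: "U \<subseteq> subfr R" "c = \<Sqinter>U" using meet_generated[OF c(1)] by blast
  then have "U \<subseteq> carrier R" using subfr_subset by blast
  then have "a = \<Sqinter>\<^bsub>F_obj R\<^esub> (F_emb R ` U)" using c U F_emb_Inf by simp
  moreover have "F_emb R ` U \<subseteq> opens (F_obj R)" using U by (auto simp: opens_F_obj)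
  ultimately show "a \<in> saturateds (F_obj R)"
    unfolding saturateds_def using F_emb_closed[OF c(1)] c(2)
    by (intro CollectI conjI exI[of _ "F_emb R ` U"]) simp_all
qed

lemma fun_emb_hom: "boolean_hom (boolean_envelope R) (F_obj R) (fun_emb R)"
  unfolding fun_emb_def by (rule mac.mac_emb_hom)

lemma BS_F_obj: "fun_emb R ` carrier (boolean_envelope R) = BS (F_obj R)"
proof -
  have "fun_emb R ` boolean_generated (boolean_envelope R) (env_emb R ` carrier R)
      = boolean_generated (F_obj R) (fun_emb R ` env_emb R ` carrier R)"
    by (rule generated_image[OF env.boolean_order_F mac.boolean_order_axioms fun_emb_hom])
      (auto simp: env_emb_in_envelope)
  then show ?thesis
    by (simp add: envelope_generated BS_def saturateds_F_obj image_image F_emb_def)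
qed

lemma fun_emb_reflects:
  "\<lbrakk>x \<in> carrier (boolean_envelope R); y \<in> carrier (boolean_envelope R);
    fun_emb R x \<sqsubseteq>\<^bsub>F_obj R\<^esub> fun_emb R y\<rbrakk> \<Longrightarrow> x \<sqsubseteq>\<^bsub>boolean_envelope R\<^esub> y"
  by (simp add: fun_emb_def mac.le_N mac.mac_emb_le_iff)

text \<open>
  Every element is a join of basic differences \<open>a - d\<close> with \<open>a\<close>, \<open>d\<close> in \<open>C\<close>, and since \<open>d\<close> is the
  meet of the members of \<open>L\<close> above it, \<open>a - d\<close> is the join of the elements \<open>a \<sqinter> compl u\<close>, where \<open>u\<close>
  ranges over those members; \<open>compl u\<close> is closed.
\<close>

lemma t0_algebra_F_obj: "t0_algebra (F_obj R)"
proof -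
  let ?N = "F_obj R" and ?E = "boolean_envelope R"
  interpret N: mt_alg ?N by (rule mt_alg.intro[OF mt_algebra_F_obj])
  have "\<exists>X\<subseteq>{s \<sqinter>\<^bsub>?N\<^esub> c |s c. s \<in> saturateds ?N \<and> c \<in> closeds ?N}. A = \<Squnion>\<^bsub>?N\<^esub> X"
    if A: "A \<in> carrier ?N" for A
  proof -
    define X where "X = {w. (\<exists>s c. w = s \<sqinter>\<^bsub>?N\<^esub> c \<and> s \<in> saturateds ?N \<and> c \<in> closeds ?N) \<and> w \<subseteq> A}"
    have Xc: "X \<subseteq> carrier ?N"
      unfolding X_def using N.saturated_carrier by (auto simp: closeds_def)
    have "\<Squnion>\<^bsub>?N\<^esub> X = A"
    proof (rule mac.sup_eqI[OF Xc A])
      show "w \<sqsubseteq>\<^bsub>?N\<^esub> A" if "w \<in> X" for w using that by (simp add: X_def mac.le_N)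
    next
      fix D assume D: "D \<in> carrier ?N" and up: "\<And>w. w \<in> X \<Longrightarrow> w \<sqsubseteq>\<^bsub>?N\<^esub> D"
      \<comment> \<open>by residuation and \<open>join_Inf\<close> it is enough that \<open>a \<sqsubseteq> D \<squnion> u\<close> for the members \<open>u\<close> of \<open>L\<close> with meet \<open>d\<close>\<close>
      have diff: "env_emb R a - env_emb R d \<in> D"
        if c: "a \<in> carrier R" "d \<in> carrier R" and in_A: "env_emb R a - env_emb R d \<in> A" for a d
      proof -
        have ad: "F_emb R a \<in> carrier ?N" "F_emb R d \<in> carrier ?N" using c F_emb_closed by simp_all
        have "env_emb R a - env_emb R d = env_emb R a \<inter> (Spec R - env_emb R d)"
          using env_emb_subset_Spec[of R a] by blast
        then have e: "env_emb R a - env_emb R d = env_emb R a \<sqinter>\<^bsub>?E\<^esub> compl ?E (env_emb R d)"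
          "env_emb R a - env_emb R d \<in> carrier ?E"
          using c by (simp_all add: env.set_ops env_emb_in_envelope env.Int_F env.Diff_F)
        have m: "mac_emb ?E (env_emb R a - env_emb R d) = F_emb R a \<sqinter>\<^bsub>?N\<^esub> compl ?N (F_emb R d)"
          unfolding e(1) F_emb_eq using c by (simp add: boolean_homD[OF mac.mac_emb_hom] env_emb_in_envelope)
        obtain U where U: "U \<subseteq> subfr R" "d = \<Sqinter>U" using meet_generated[OF c(2)] by blast
        have U': "U \<subseteq> carrier R" using U subfr_subset by blast
        have "F_emb R a \<sqsubseteq>\<^bsub>?N\<^esub> D \<squnion>\<^bsub>?N\<^esub> F_emb R u" if u: "u \<in> U" for u
        proof -
          have uc: "u \<in> carrier R" "u \<in> subfr R" using u U U' by blast+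
          have Fu: "F_emb R u \<in> carrier ?N" using uc F_emb_closed by simp
          have "F_emb R d \<subseteq> F_emb R u"
            using inf_lower[OF U' u] U(2) c(2) uc(1) by (simp add: F_emb_le_iff)
          then have "F_emb R a \<sqinter>\<^bsub>?N\<^esub> compl ?N (F_emb R u) \<sqsubseteq>\<^bsub>?N\<^esub> F_emb R a \<sqinter>\<^bsub>?N\<^esub> compl ?N (F_emb R d)"
            using ad Fu by (auto simp: mac.le_iff_env_emb mac.env_emb_simps mac.le_N[symmetric])
          moreover have "F_emb R a \<sqinter>\<^bsub>?N\<^esub> compl ?N (F_emb R d) \<subseteq> A"
            unfolding m[symmetric] using in_A A e(2) by (simp add: mac.mac_emb_subset_iff)
          moreover have "F_emb R a \<in> saturateds ?N" using c by (simp add: saturateds_F_obj)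
          moreover have "compl ?N (F_emb R u) \<in> closeds ?N"
            using Fu uc by (simp add: closeds_def mac.compl_compl opens_F_obj)
          ultimately have "F_emb R a \<sqinter>\<^bsub>?N\<^esub> compl ?N (F_emb R u) \<in> X"
            unfolding X_def by (auto simp: mac.le_N)
          then have "F_emb R a \<sqinter>\<^bsub>?N\<^esub> compl ?N (F_emb R u) \<sqsubseteq>\<^bsub>?N\<^esub> D" by (rule up)
          then show ?thesis using ad Fu D by (simp add: mac.shunt join_comm[of ?N D])
        qed
        then have "F_emb R a \<sqsubseteq>\<^bsub>?N\<^esub> D \<squnion>\<^bsub>?N\<^esub> F_emb R d"
          unfolding U(2) F_emb_Inf[OF U']
          using D ad(1) U' F_emb_closed
          by (subst N.join_Inf) (auto intro!: mac.inf_greatest)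
        then have "mac_emb ?E (env_emb R a - env_emb R d) \<subseteq> D"
          unfolding m mac.le_N[symmetric] using ad D by (simp add: mac.shunt join_comm[of ?N D])
        then show ?thesis using D e(2) by (simp add: mac.mac_emb_subset_iff)
      qed
      have "x \<in> D" if x: "x \<in> A" for x
      proof (rule mac.normalD[OF D])
        show xE: "x \<in> carrier ?E" using A x by (rule mac.normal_carrier)
        fix v assume v: "v \<in> carrier ?E" "\<And>w. w \<in> D \<Longrightarrow> w \<sqsubseteq>\<^bsub>?E\<^esub> v"
        have "P \<in> v" if Px: "P \<in> x" for P
        proof -
          obtain a d where c: "a \<in> carrier R" "d \<in> carrier R" and P: "P \<in> env_emb R a - env_emb R d"
            and sub: "env_emb R a - env_emb R d \<subseteq> x"
            using envelope_base[OF bounded_distrib_lattice_axioms xE Px] by metis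
          have "env_emb R a - env_emb R d = env_emb R a \<inter> (Spec R - env_emb R d)"
            using env_emb_subset_Spec[of R a] by blast
          then have "env_emb R a - env_emb R d \<in> carrier ?E"
            using c by (simp add: env_emb_in_envelope env.Int_F env.Diff_F)
          then have "env_emb R a - env_emb R d \<in> A"
            using mac.normal_down[OF A x] sub by (simp add: env.le_F)
          then have "env_emb R a - env_emb R d \<subseteq> v"
            using diff[OF c] v(2) by (simp add: env.le_F)
          then show ?thesis using P by blast
        qed
        then show "x \<sqsubseteq>\<^bsub>?E\<^esub> v" by (auto simp: env.le_F)
      qed
      then show "A \<sqsubseteq>\<^bsub>?N\<^esub> D" by (auto simp: mac.le_N)
    qed
    then show ?thesis by (intro exI[of _ X]) (auto simp: X_def)
  qed
  then show ?thesis unfolding t0_algebra_def using mt_algebra_F_obj by blast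
qed

end

section \<open>Morphisms of Raney extensions\<close>

lemma order_iso_Inf_Sup:
  assumes "complete_lattice L" "complete_lattice L'" and bij: "bij_betw \<phi> (carrier L) (carrier L')"
    and le: "\<And>x y. \<lbrakk>x \<in> carrier L; y \<in> carrier L\<rbrakk> \<Longrightarrow> \<phi> x \<sqsubseteq>\<^bsub>L'\<^esub> \<phi> y \<longleftrightarrow> x \<sqsubseteq>\<^bsub>L\<^esub> y"
    and A: "A \<subseteq> carrier L"
  shows "\<phi> (\<Sqinter>\<^bsub>L\<^esub> A) = \<Sqinter>\<^bsub>L'\<^esub> (\<phi> ` A)" "\<phi> (\<Squnion>\<^bsub>L\<^esub> A) = \<Squnion>\<^bsub>L'\<^esub> (\<phi> ` A)"
proof -
  interpret L: complete_lattice L by fact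
  interpret L': complete_lattice L' by fact
  have a: "a \<in> carrier L" if "a \<in> A" for a using that A by blast
  have c: "\<phi> x \<in> carrier L'" if "x \<in> carrier L" for x using that bij by (auto simp: bij_betw_def)
  have ex: "\<exists>x\<in>carrier L. y = \<phi> x" if "y \<in> carrier L'" for y using that bij by (auto simp: bij_betw_def)
  show "\<phi> (\<Sqinter>\<^bsub>L\<^esub> A) = \<Sqinter>\<^bsub>L'\<^esub> (\<phi> ` A)"
  proof (rule L'.inf_eqI[symmetric])
    fix y assume y: "y \<in> carrier L'" and low: "\<And>b. b \<in> \<phi> ` A \<Longrightarrow> y \<sqsubseteq>\<^bsub>L'\<^esub> b"
    obtain x where x: "x \<in> carrier L" "y = \<phi> x" using ex[OF y] by blast
    have "x \<sqsubseteq>\<^bsub>L\<^esub> b" if "b \<in> A" for b using low[of "\<phi> b"] le[OF x(1) a[OF that]] that x by simp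
    then have "x \<sqsubseteq>\<^bsub>L\<^esub> \<Sqinter>\<^bsub>L\<^esub> A" by (rule L.inf_greatest[OF A x(1)])
    then show "y \<sqsubseteq>\<^bsub>L'\<^esub> \<phi> (\<Sqinter>\<^bsub>L\<^esub> A)" using x A le by simp
  qed (use a c A le L.inf_lower[OF A] in auto)
  show "\<phi> (\<Squnion>\<^bsub>L\<^esub> A) = \<Squnion>\<^bsub>L'\<^esub> (\<phi> ` A)"
  proof (rule L'.sup_eqI[symmetric])
    fix y assume y: "y \<in> carrier L'" and up: "\<And>b. b \<in> \<phi> ` A \<Longrightarrow> b \<sqsubseteq>\<^bsub>L'\<^esub> y"
    obtain x where x: "x \<in> carrier L" "y = \<phi> x" using ex[OF y] by blast
    have "b \<sqsubseteq>\<^bsub>L\<^esub> x" if "b \<in> A" for b using up[of "\<phi> b"] le[OF a[OF that] x(1)] that x by simp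
    then have "\<Squnion>\<^bsub>L\<^esub> A \<sqsubseteq>\<^bsub>L\<^esub> x" by (rule L.sup_least[OF A x(1)])
    then show "\<phi> (\<Squnion>\<^bsub>L\<^esub> A) \<sqsubseteq>\<^bsub>L'\<^esub> y" using x A le by simp
  qed (use a c A le L.sup_upper[OF A] in auto)
qed

lemma order_iso_re_hom:
  assumes "raney_extension R" "raney_extension R'" and \<phi>: "\<phi> \<in> extensional (carrier R)"
    and bij: "bij_betw \<phi> (carrier R) (carrier R')" and bij_subfr: "bij_betw \<phi> (subfr R) (subfr R')"
    and le: "\<And>x y. \<lbrakk>x \<in> carrier R; y \<in> carrier R\<rbrakk> \<Longrightarrow> \<phi> x \<sqsubseteq>\<^bsub>R'\<^esub> \<phi> y \<longleftrightarrow> x \<sqsubseteq>\<^bsub>R\<^esub> y"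
  shows "\<phi> \<in> re_hom R R'"
proof -
  interpret R: raney_ext R by (rule raney_ext.intro) fact
  interpret R': raney_ext R' by (rule raney_ext.intro) fact
  let ?L = "suborder R (subfr R)" and ?L' = "suborder R' (subfr R')"
  interpret L: complete_lattice ?L by (rule R.complete_subfr)
  interpret L': complete_lattice ?L' by (rule R'.complete_subfr)
  note R_iso = order_iso_Inf_Sup[OF R.complete_lattice_axioms R'.complete_lattice_axioms bij le]
  have L_iso: "\<phi> (\<Sqinter>\<^bsub>?L\<^esub> A) = \<Sqinter>\<^bsub>?L'\<^esub> (\<phi> ` A)" "\<phi> (\<Squnion>\<^bsub>?L\<^esub> A) = \<Squnion>\<^bsub>?L'\<^esub> (\<phi> ` A)"
    if "A \<subseteq> subfr R" for A
    using order_iso_Inf_Sup[OF L.complete_lattice_axioms L'.complete_lattice_axioms, of \<phi> A]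
      bij_subfr le R.subfr_carrier that by auto
  have "\<phi> \<bottom>\<^bsub>R\<^esub> = \<bottom>\<^bsub>R'\<^esub>"
  proof -
    have "\<bottom>\<^bsub>R\<^esub> = \<Squnion>\<^bsub>R\<^esub> {}" "\<bottom>\<^bsub>R'\<^esub> = \<Squnion>\<^bsub>R'\<^esub> {}"
      by (rule R.sup_eqI[symmetric] R'.sup_eqI[symmetric]; simp)+
    then show ?thesis using R_iso(2)[of "{}"] by simp
  qed
  then have "coframe_hom R R' \<phi>"
    unfolding coframe_hom_def inf_pres_def join_pres_def
    using R_iso(1) R_iso(2)[of "{x, y}" for x y] bij R.complete_lattice_axioms R'.complete_lattice_axioms
      R.lattice_axioms R'.lattice_axioms
    by (auto simp: join_def bij_betw_def)
  moreover have "\<phi> \<top>\<^bsub>?L\<^esub> = \<top>\<^bsub>?L'\<^esub>"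
    using L_iso(1)[of "{}"] L.Inf_empty L'.Inf_empty by simp
  then have "frame_hom ?L ?L' \<phi>"
    unfolding frame_hom_def sup_pres_def meet_pres_def
    using L_iso(2) L_iso(1)[of "{x, y}" for x y] bij_subfr L.complete_lattice_axioms L'.complete_lattice_axioms
      L.lattice_axioms L'.lattice_axioms
    by (auto simp: meet_def bij_betw_def)
  moreover have "\<phi> \<in> carrier R \<rightarrow>\<^sub>E carrier R'"
    using \<phi> bij by (auto simp: PiE_def bij_betw_def)
  ultimately show ?thesis unfolding re_hom_def by blast
qed

text \<open>
  Order isomorphisms preserve all meets and joins, so nothing has to be verified besides the order.
\<close>

lemma order_iso_re_iso:
  assumes "raney_extension R" "raney_extension R'" and \<phi>: "\<phi> \<in> extensional (carrier R)"
    and bij: "bij_betw \<phi> (carrier R) (carrier R')" and subfr: "\<phi> ` subfr R = subfr R'"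
    and le: "\<And>x y. \<lbrakk>x \<in> carrier R; y \<in> carrier R\<rbrakk> \<Longrightarrow> \<phi> x \<sqsubseteq>\<^bsub>R'\<^esub> \<phi> y \<longleftrightarrow> x \<sqsubseteq>\<^bsub>R\<^esub> y"
  shows "re_iso R R' \<phi>"
proof -
  interpret R: raney_ext R by (rule raney_ext.intro) fact
  interpret R': raney_ext R' by (rule raney_ext.intro) fact
  define \<psi> where "\<psi> = restrict (inv_into (carrier R) \<phi>) (carrier R')"
  have \<psi>\<phi>: "\<psi> (\<phi> x) = x" if "x \<in> carrier R" for x
    using that bij by (auto simp: \<psi>_def bij_betw_def)
  have \<phi>\<psi>: "\<phi> (\<psi> y) = y" "\<psi> y \<in> carrier R" if "y \<in> carrier R'" for y
    using that bij by (auto simp: \<psi>_def bij_betw_def f_inv_into_f inv_into_into)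
  have \<phi>c: "\<phi> x \<in> carrier R'" if "x \<in> carrier R" for x using that bij by (auto simp: bij_betw_def)
  have "inj_on \<phi> (subfr R)" using bij R.subfr_subset by (auto simp: bij_betw_def intro: inj_on_subset)
  then have bij_subfr: "bij_betw \<phi> (subfr R) (subfr R')" using subfr by (simp add: bij_betw_def)
  have le': "\<psi> x \<sqsubseteq>\<^bsub>R\<^esub> \<psi> y \<longleftrightarrow> x \<sqsubseteq>\<^bsub>R'\<^esub> y" if "x \<in> carrier R'" "y \<in> carrier R'" for x y
    using le[of "\<psi> x" "\<psi> y"] \<phi>\<psi> that by simp
  have bij': "bij_betw \<psi> (carrier R') (carrier R)"
    by (rule bij_betw_byWitness[where f' = \<phi>]) (use \<psi>\<phi> \<phi>\<psi> \<phi>c in auto)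
  have bij_subfr': "bij_betw \<psi> (subfr R') (subfr R)"
    by (rule bij_betw_byWitness[where f' = \<phi>])
      (use \<psi>\<phi> \<phi>\<psi> R.subfr_carrier R'.subfr_carrier in \<open>auto simp flip: subfr\<close>)
  have "\<phi> \<in> re_hom R R'"
    by (rule order_iso_re_hom[OF assms(1,2) \<phi> bij bij_subfr le])
  moreover have "\<psi> \<in> re_hom R' R"
    by (rule order_iso_re_hom[OF assms(2,1) _ bij' bij_subfr' le']) (simp only: \<psi>_def restrict_extensional)
  moreover have "re_comp R \<psi> \<phi> = re_id R" "re_comp R' \<phi> \<psi> = re_id R'"
    using \<psi>\<phi> \<phi>\<psi> by (auto simp: re_comp_def re_id_def compose_def intro!: restrict_ext)
  ultimately show ?thesis unfolding re_iso_def by blast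
qed

lemma coframe_hom_comp:
  assumes "coframe_hom L1 L2 f" "coframe_hom L2 L3 g" "\<And>x. x \<in> carrier L1 \<Longrightarrow> k x = g (f x)"
  shows "coframe_hom L1 L3 k"
proof -
  interpret L1: complete_lattice L1 using assms(1) by (simp add: coframe_hom_def inf_pres_def)
  have f: "f x \<in> carrier L2" if "x \<in> carrier L1" for x using assms(1) that by (auto simp: coframe_hom_def)
  have fA: "f ` A \<subseteq> carrier L2" if "A \<subseteq> carrier L1" for A using f that by blast
  have kA: "k ` A = g ` f ` A" if "A \<subseteq> carrier L1" for A
    unfolding image_image by (rule image_cong) (use that assms(3) in auto)
  show ?thesis
    using assms(1,2) unfolding coframe_hom_def inf_pres_def join_pres_def
    by (simp add: fA kA f assms(3) Pi_def)
qed

lemma frame_hom_comp: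
  assumes "frame_hom L1 L2 f" "frame_hom L2 L3 g" "\<And>x. x \<in> carrier L1 \<Longrightarrow> k x = g (f x)"
  shows "frame_hom L1 L3 k"
proof -
  interpret L1: complete_lattice L1 using assms(1) by (simp add: frame_hom_def sup_pres_def)
  have f: "f x \<in> carrier L2" if "x \<in> carrier L1" for x using assms(1) that by (auto simp: frame_hom_def)
  have fA: "f ` A \<subseteq> carrier L2" if "A \<subseteq> carrier L1" for A using f that by blast
  have kA: "k ` A = g ` f ` A" if "A \<subseteq> carrier L1" for A
    unfolding image_image by (rule image_cong) (use that assms(3) in auto)
  show ?thesis
    using assms(1,2) unfolding frame_hom_def sup_pres_def meet_pres_def
    by (simp add: fA kA f assms(3) Pi_def)
qed

lemma re_hom_closed: "\<lbrakk>h \<in> re_hom R1 R2; c \<in> carrier R1\<rbrakk> \<Longrightarrow> h c \<in> carrier R2"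
  by (auto simp: re_hom_def)

lemma re_comp_hom:
  assumes "raney_extension R1" "h \<in> re_hom R1 R2" "k \<in> re_hom R2 R3"
  shows "re_comp R1 k h \<in> re_hom R1 R3"
proof -
  interpret R1: raney_ext R1 by (rule raney_ext.intro) fact
  have "coframe_hom R1 R3 (re_comp R1 k h)"
    by (rule coframe_hom_comp[of R1 R2 h R3 k])
      (use assms in \<open>auto simp: re_hom_def re_comp_def compose_def\<close>)
  moreover have "frame_hom (suborder R1 (subfr R1)) (suborder R3 (subfr R3)) (re_comp R1 k h)"
    by (rule frame_hom_comp[of _ "suborder R2 (subfr R2)" h _ k])
      (use assms R1.subfr_carrier in \<open>auto simp: re_hom_def re_comp_def compose_def\<close>)
  moreover have "re_comp R1 k h \<in> carrier R1 \<rightarrow>\<^sub>E carrier R3"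
    by (auto simp: re_comp_def compose_def intro!: re_hom_closed[OF assms(3)] re_hom_closed[OF assms(2)])
  ultimately show ?thesis by (simp add: re_hom_def)
qed

lemma re_id_hom: "raney_extension R \<Longrightarrow> re_id R \<in> re_hom R R"
proof -
  assume R: "raney_extension R"
  then interpret R: raney_ext R by (rule raney_ext.intro)
  show ?thesis
    by (rule order_iso_re_hom[OF R R])
      (use R.subfr_carrier in \<open>auto simp: re_id_def bij_betw_def inj_on_def\<close>)
qed

lemma re_hom_bounded_lattice_hom:
  assumes "raney_extension R1" "raney_extension R2" "h \<in> re_hom R1 R2"
  shows "bounded_lattice_hom R1 R2 h"
proof -
  interpret R1: raney_ext R1 by (rule raney_ext.intro) fact
  interpret R2: raney_ext R2 by (rule raney_ext.intro) fact
  have h: "coframe_hom R1 R2 h" using assms(3) by (simp add: re_hom_def)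
  then have inf: "h (\<Sqinter>\<^bsub>R1\<^esub> A) = \<Sqinter>\<^bsub>R2\<^esub> (h ` A)" if "A \<subseteq> carrier R1" for A
    using that by (simp add: coframe_hom_def inf_pres_def)
  have "h (x \<sqinter>\<^bsub>R1\<^esub> y) = h x \<sqinter>\<^bsub>R2\<^esub> h y" if "x \<in> carrier R1" "y \<in> carrier R1" for x y
    using inf[of "{x, y}"] that by (simp add: meet_def)
  moreover have "h \<top>\<^bsub>R1\<^esub> = \<top>\<^bsub>R2\<^esub>"
    using inf[of "{}"] by (simp add: R1.Inf_empty R2.Inf_empty)
  ultimately show ?thesis
    using h by (simp add: bounded_lattice_hom_def coframe_hom_def join_pres_def)
qed

section \<open>The functor \<open>F\<close> and the natural isomorphisms\<close>

context raney_ext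
begin

lemma F_emb_inj: "inj_on (F_emb R) (carrier R)"
  by (rule inj_onI) (metis F_emb_le_iff le_antisym subset_refl)

lemma eps_iso: "re_iso R (RF_obj R) (eps R)"
proof -
  interpret F: mt_alg "F_obj R" by (rule mt_alg.intro[OF mt_algebra_F_obj])
  have emb: "eps R c = F_emb R c" if "c \<in> carrier R" for c using that by (simp add: eps_def)
  show ?thesis
  proof (rule order_iso_re_iso[OF raney F.raney_extension_R_obj])
    show "eps R \<in> extensional (carrier R)" by (simp add: eps_def)
    show "bij_betw (eps R) (carrier R) (carrier (RF_obj R))"
      using F_emb_inj by (simp add: bij_betw_def emb F.R_obj_simps saturateds_F_obj cong: inj_on_cong image_cong)
    show "eps R ` subfr R = subfr (RF_obj R)"
      by (simp add: F.R_obj_simps opens_F_obj emb subfr_carrier cong: image_cong)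
    show "eps R x \<sqsubseteq>\<^bsub>RF_obj R\<^esub> eps R y \<longleftrightarrow> x \<sqsubseteq> y" if "x \<in> carrier R" "y \<in> carrier R" for x y
      using that by (simp add: emb F.R_obj_simps mac.le_N F_emb_le_iff)
  qed
qed

lemma eps_hom: "eps R \<in> re_hom R (RF_obj R)"
  using eps_iso by (simp add: re_iso_def)

end

text \<open>
  On \<open>BS (F_obj R1)\<close>, the copy of the envelope of \<open>R1\<close>, the morphism \<open>F_map R1 R2 h\<close> is the Boolean
  extension of \<open>h\<close>; on saturated elements it is therefore the conjugate of \<open>h\<close> by the isomorphisms
  \<open>eps\<close>, which is a morphism of Raney extensions.
\<close>

lemma F_map:
  assumes "raney_extension R1" "raney_extension R2" "h \<in> re_hom R1 R2"
  shows F_map_hom: "F_map R1 R2 h \<in> mt_hom (F_obj R1) (F_obj R2)"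
    and F_map_emb: "c \<in> carrier R1 \<Longrightarrow> F_map R1 R2 h (F_emb R1 c) = F_emb R2 (h c)"
proof -
  interpret R1: raney_ext R1 by (rule raney_ext.intro) fact
  interpret R2: raney_ext R2 by (rule raney_ext.intro) fact
  interpret F1: mt_alg "F_obj R1" by (rule mt_alg.intro[OF R1.mt_algebra_F_obj])
  interpret F2: mt_alg "F_obj R2" by (rule mt_alg.intro[OF R2.mt_algebra_F_obj])
  let ?E1 = "boolean_envelope R1" and ?E2 = "boolean_envelope R2"
  have "bounded_lattice_hom R1 ?E2 (\<lambda>c. env_emb R2 (h c))"
    using re_hom_bounded_lattice_hom[OF assms]
    by (auto simp: bounded_lattice_hom_def Pi_def env_emb_in_envelope env.set_ops
        R2.env_emb_meet R2.env_emb_join R2.env_emb_top R2.env_emb_bottom)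
  note env_map = env_lift[OF R1.bounded_distrib_lattice_axioms env.boolean_order_F this,
      folded env_map_def]
  define k where "k s = F_emb R2 (h (inv_into (carrier R1) (F_emb R1) s))" for s
  have k: "k (F_emb R1 c) = F_emb R2 (h c)" if "c \<in> carrier R1" for c
    using that R1.F_emb_inj by (simp add: k_def)
  obtain \<psi> where \<psi>: "\<psi> \<in> re_hom (RF_obj R1) R1" "re_comp R1 \<psi> (eps R1) = re_id R1"
    using R1.eps_iso by (auto simp: re_iso_def)
  have \<psi>': "\<psi> (F_emb R1 c) = c" if "c \<in> carrier R1" for c
    using fun_cong[OF \<psi>(2), of c] that by (simp add: re_comp_def re_id_def eps_def compose_def)
  have conj: "re_comp (RF_obj R1) (eps R2) (re_comp (RF_obj R1) h \<psi>) \<in> re_hom (RF_obj R1) (RF_obj R2)"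
    by (rule re_comp_hom[OF F1.raney_extension_R_obj
        re_comp_hom[OF F1.raney_extension_R_obj \<psi>(1) assms(3)] R2.eps_hom])
  then have "raney_map (F_obj R1) (F_obj R2) (re_comp (RF_obj R1) (eps R2) (re_comp (RF_obj R1) h \<psi>))"
    using re_hom_R_obj_iff[OF R1.mt_algebra_F_obj R2.mt_algebra_F_obj] by blast
  then have raney_k: "raney_map (F_obj R1) (F_obj R2) k"
    by (subst raney_map_cong[OF R1.mt_algebra_F_obj, of k])
      (auto simp: R1.saturateds_F_obj re_comp_def compose_def F1.R_obj_simps k \<psi>' eps_def
        re_hom_closed[OF assms(3)])
  have agree: "fun_emb R2 (env_map R1 R2 h x) = k (fun_emb R1 x)"
    if x: "x \<in> carrier ?E1" "fun_emb R1 x \<in> saturateds (F_obj R1)" for x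
  proof -
    obtain c where c: "c \<in> carrier R1" "fun_emb R1 x = F_emb R1 c"
      using x(2) by (auto simp: R1.saturateds_F_obj)
    have "x = env_emb R1 c"
      by (rule env.le_antisym[where C = R1])
        (use x c in \<open>auto intro!: R1.fun_emb_reflects env_emb_in_envelope simp: F_emb_def R1.mac.le_N\<close>)
    then show ?thesis using c env_map(2)[of c] k by (simp add: F_emb_def)
  qed
  have hom: "boolean_hom ?E1 (F_obj R2) (\<lambda>x. fun_emb R2 (env_map R1 R2 h x))"
    by (rule boolean_hom_comp[OF env.boolean_order_F env.boolean_order_F
        R2.mac.boolean_order_axioms env_map(1) R2.fun_emb_hom])
  note ext = mt_hom_extension[OF R1.mt_algebra_F_obj R2.mt_algebra_F_obj env.boolean_order_F
      R1.fun_emb_hom hom R1.fun_emb_reflects R1.BS_F_obj raney_k agree, folded F_map_def]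
  show "F_map R1 R2 h \<in> mt_hom (F_obj R1) (F_obj R2)" by (rule ext(1))
  show "F_map R1 R2 h (F_emb R1 c) = F_emb R2 (h c)" if "c \<in> carrier R1"
    using ext(3) that k by (simp add: R1.saturateds_F_obj)
qed

text \<open>
  The extension to \<open>M\<close> of the isomorphism \<open>eps\<close> of its Raney extension.
\<close>

lemma eta:
  assumes "mt_algebra M"
  shows eta_hom: "eta M \<in> mt_hom M (FR_obj M)"
    and eta_saturated: "s \<in> saturateds M \<Longrightarrow> eta M s = F_emb (R_obj M) s"
proof -
  interpret M: mt_alg M by (rule mt_alg.intro) fact
  interpret R: raney_ext "R_obj M" by (rule raney_ext.intro[OF M.raney_extension_R_obj])
  have "raney_map M (FR_obj M) (eps (R_obj M))"
    using R.eps_hom re_hom_R_obj_iff[OF assms R.mt_algebra_F_obj] by blast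
  then have k: "raney_map M (FR_obj M) (F_emb (R_obj M))"
    by (subst raney_map_cong[OF assms, where g = "eps (R_obj M)"]) (simp_all add: eps_def M.R_obj_simps)
  have agree: "fun_emb (R_obj M) x = F_emb (R_obj M) (BS_iso M x)"
    if "x \<in> carrier (boolean_envelope (R_obj M))" "BS_iso M x \<in> saturateds M" for x
    using BS_iso_saturated[OF assms that] by (simp add: F_emb_def)
  note ext = mt_hom_extension[OF assms R.mt_algebra_F_obj env.boolean_order_F BS_iso_hom[OF assms]
      R.fun_emb_hom BS_iso_reflects[OF assms] BS_iso_image[OF assms] k agree, folded eta_def]
  show "eta M \<in> mt_hom M (FR_obj M)" by (rule ext(1))
  show "s \<in> saturateds M \<Longrightarrow> eta M s = F_emb (R_obj M) s" by (rule ext(3))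
qed

section \<open>The equivalence\<close>

lemma t0_mt: "t0_algebra M \<Longrightarrow> mt_algebra M"
  by (simp add: t0_algebra_def)

lemma raney_R_obj: "mt_algebra M \<Longrightarrow> raney_extension (R_obj M)"
  by (rule mt_alg.raney_extension_R_obj) (rule mt_alg.intro)

lemma t0_F_obj: "raney_extension R \<Longrightarrow> t0_algebra (F_obj R)"
  by (rule raney_ext.t0_algebra_F_obj) (rule raney_ext.intro)

lemma mt_F_obj: "raney_extension R \<Longrightarrow> mt_algebra (F_obj R)"
  by (rule t0_mt[OF t0_F_obj])

lemma mt_comp_saturated:
  assumes "mt_algebra M" "mt_algebra N" "mt_algebra P" "f \<in> mt_hom M N" "g \<in> mt_hom N P" "s \<in> saturateds M"
  shows "mt_comp M P g f s = g (f s)"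
  by (rule mt_comp_hom(2)[OF assms(1-5) mt_alg.saturated_BS[OF mt_alg.intro[OF assms(1)] assms(6)]])

lemma mt_id_saturated: "\<lbrakk>mt_algebra M; s \<in> saturateds M\<rbrakk> \<Longrightarrow> mt_id M s = s"
  by (rule mt_id_hom(2)[OF _ mt_alg.saturated_BS[OF mt_alg.intro]])

lemma mt_hom_saturated:
  "\<lbrakk>mt_algebra M; mt_algebra N; f \<in> mt_hom M N; s \<in> saturateds M\<rbrakk> \<Longrightarrow> f s \<in> saturateds N"
  by (rule raney_mapD(1)[OF mt_homD(3)])

text \<open>
  Since \<open>R\<close> is faithful, identities between Raney morphisms are verified on saturated elements, where
  the composition of the category is composition of functions.
\<close>

lemma mt_comp_assoc:
  assumes "mt_algebra M" "mt_algebra N" "mt_algebra P" "mt_algebra Q"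
    "f \<in> mt_hom M N" "g \<in> mt_hom N P" "h \<in> mt_hom P Q"
  shows "mt_comp M Q h (mt_comp M P g f) = mt_comp M Q (mt_comp N Q h g) f"
proof (rule mt_hom_eqI[OF assms(1,4)])
  note gf = mt_comp_hom(1)[OF assms(1-3,5,6)] and hg = mt_comp_hom(1)[OF assms(2-4,6,7)]
  show "mt_comp M Q h (mt_comp M P g f) \<in> mt_hom M Q" "mt_comp M Q (mt_comp N Q h g) f \<in> mt_hom M Q"
    by (rule mt_comp_hom(1)[OF assms(1,3,4) gf assms(7)] mt_comp_hom(1)[OF assms(1,2,4,5) hg])+
  show "mt_comp M Q h (mt_comp M P g f) s = mt_comp M Q (mt_comp N Q h g) f s" if "s \<in> saturateds M" for s
    using mt_hom_saturated[OF assms(1,2,5) that] that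
    by (simp add: mt_comp_saturated[OF assms(1,3,4) gf assms(7)] mt_comp_saturated[OF assms(1,2,4,5) hg]
        mt_comp_saturated[OF assms(1-3,5,6)] mt_comp_saturated[OF assms(2-4,6,7)])
qed

lemma mt_comp_id:
  assumes "mt_algebra M" "mt_algebra N" "f \<in> mt_hom M N"
  shows "mt_comp M N f (mt_id M) = f" "mt_comp M N (mt_id N) f = f"
proof -
  note i = mt_id_hom(1)[OF assms(1)] and j = mt_id_hom(1)[OF assms(2)]
  show "mt_comp M N f (mt_id M) = f"
    by (rule mt_hom_eqI[OF assms(1,2) mt_comp_hom(1)[OF assms(1,1,2) i assms(3)] assms(3)])
      (simp add: mt_comp_saturated[OF assms(1,1,2) i assms(3)] mt_id_saturated[OF assms(1)])
  show "mt_comp M N (mt_id N) f = f"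
    by (rule mt_hom_eqI[OF assms(1,2) mt_comp_hom(1)[OF assms(1,2,2,3) j] assms(3)])
      (simp add: mt_comp_saturated[OF assms(1,2,2,3) j] mt_id_saturated[OF assms(2)] mt_hom_saturated[OF assms])
qed

text \<open>
  Lift the inverse by fullness; by faithfulness the lift is an inverse.
\<close>

lemma R_map_reflects_iso:
  assumes "mt_algebra M" "mt_algebra N" "f \<in> mt_hom M N" "re_iso (R_obj M) (R_obj N) (R_map M f)"
  shows "mt_iso M N f"
proof -
  obtain g where g: "g \<in> re_hom (R_obj N) (R_obj M)" "re_comp (R_obj M) g (R_map M f) = re_id (R_obj M)"
    "re_comp (R_obj N) (R_map M f) g = re_id (R_obj N)"
    using assms(4) by (auto simp: re_iso_def)
  obtain g' where g': "g' \<in> mt_hom N M" "R_map N g' = g"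
    using R_map_full[OF assms(2,1) g(1)] by blast
  have "mt_comp M M g' f = mt_id M"
    by (rule R_map_faithful[OF assms(1,1)])
      (use assms g g' in \<open>simp_all add: mt_comp_hom(1)[of M N M] mt_id_hom R_map_comp[of M N M] R_map_id\<close>)
  moreover have "mt_comp N N f g' = mt_id N"
    by (rule R_map_faithful[OF assms(2,2)])
      (use assms g g' in \<open>simp_all add: mt_comp_hom(1)[of N M N] mt_id_hom R_map_comp[of N M N] R_map_id\<close>)
  ultimately show ?thesis using assms(3) g'(1) by (auto simp: mt_iso_def)
qed

lemma eta_iso:
  assumes "mt_algebra M" shows "mt_iso M (FR_obj M) (eta M)"
proof (rule R_map_reflects_iso[OF assms mt_F_obj[OF raney_R_obj[OF assms]] eta_hom[OF assms]])
  have "R_map M (eta M) = eps (R_obj M)"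
    using eta_saturated[OF assms] by (auto simp: R_map_def eps_def R_obj_def intro!: restrict_ext)
  then show "re_iso (R_obj M) (R_obj (FR_obj M)) (R_map M (eta M))"
    using raney_ext.eps_iso[OF raney_ext.intro[OF raney_R_obj[OF assms]]] by simp
qed

lemma F_map_id:
  assumes "raney_extension R" shows "F_map R R (re_id R) = mt_id (F_obj R)"
proof -
  interpret R: raney_ext R by (rule raney_ext.intro) fact
  note F = mt_F_obj[OF assms] and id = re_id_hom[OF assms]
  show ?thesis
  proof (rule mt_hom_eqI[OF F F F_map_hom[OF assms assms id] mt_id_hom(1)[OF F]])
    fix s assume s: "s \<in> saturateds (F_obj R)"
    then obtain c where c: "c \<in> carrier R" "s = F_emb R c" by (auto simp: R.saturateds_F_obj)
    then show "F_map R R (re_id R) s = mt_id (F_obj R) s"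
      using F_map_emb[OF assms assms id c(1)] mt_id_saturated[OF F s] by (simp add: re_id_def)
  qed
qed

lemma F_map_comp:
  assumes "raney_extension R1" "raney_extension R2" "raney_extension R3" "h \<in> re_hom R1 R2" "k \<in> re_hom R2 R3"
  shows "F_map R1 R3 (re_comp R1 k h) = mt_comp (F_obj R1) (F_obj R3) (F_map R2 R3 k) (F_map R1 R2 h)"
proof -
  interpret R1: raney_ext R1 by (rule raney_ext.intro) fact
  note F = mt_F_obj[OF assms(1)] mt_F_obj[OF assms(2)] mt_F_obj[OF assms(3)]
  note kh = re_comp_hom[OF assms(1,4,5)]
  note Fh = F_map_hom[OF assms(1,2,4)] and Fk = F_map_hom[OF assms(2,3,5)]
  show ?thesis
  proof (rule mt_hom_eqI[OF F(1,3) F_map_hom[OF assms(1,3) kh] mt_comp_hom(1)[OF F Fh Fk]])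
    fix s assume s: "s \<in> saturateds (F_obj R1)"
    then obtain c where c: "c \<in> carrier R1" "s = F_emb R1 c" by (auto simp: R1.saturateds_F_obj)
    have "F_map R1 R3 (re_comp R1 k h) s = F_emb R3 (k (h c))"
      using F_map_emb[OF assms(1,3) kh c(1)] c by (simp add: re_comp_def compose_def)
    also have "\<dots> = F_map R2 R3 k (F_map R1 R2 h s)"
      using F_map_emb[OF assms(1,2,4) c(1)] F_map_emb[OF assms(2,3,5) re_hom_closed[OF assms(4) c(1)]] c by simp
    finally show "F_map R1 R3 (re_comp R1 k h) s
        = mt_comp (F_obj R1) (F_obj R3) (F_map R2 R3 k) (F_map R1 R2 h) s"
      by (simp add: mt_comp_saturated[OF F Fh Fk s])
  qed
qed

lemma eps_natural:
  assumes "raney_extension R1" "raney_extension R2" "h \<in> re_hom R1 R2"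
  shows "re_comp R1 (eps R2) h = re_comp R1 (RF_map R1 R2 h) (eps R1)"
proof -
  interpret R1: raney_ext R1 by (rule raney_ext.intro) fact
  show ?thesis
    unfolding re_comp_def compose_def
    by (intro restrict_ext)
      (simp add: eps_def R_map_def R1.saturateds_F_obj F_map_emb[OF assms] re_hom_closed[OF assms(3)])
qed

lemma eta_natural:
  assumes "mt_algebra M" "mt_algebra N" "f \<in> mt_hom M N"
  shows "mt_comp M (FR_obj N) (eta N) f = mt_comp M (FR_obj N) (FR_map M N f) (eta M)"
proof -
  note R = raney_R_obj[OF assms(1)] raney_R_obj[OF assms(2)]
  note F = mt_F_obj[OF R(1)] mt_F_obj[OF R(2)]
  note Rf = R_map_hom[OF assms] and eta = eta_hom[OF assms(1)] eta_hom[OF assms(2)]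
  note Ff = F_map_hom[OF R Rf]
  have carrier: "carrier (R_obj M) = saturateds M" by (simp add: R_obj_def)
  show ?thesis
  proof (rule mt_hom_eqI[OF assms(1) F(2) mt_comp_hom(1)[OF assms(1,2) F(2) assms(3) eta(2)]
        mt_comp_hom(1)[OF assms(1) F eta(1) Ff]])
    fix s assume s: "s \<in> saturateds M"
    then have fs: "R_map M f s = f s" "f s \<in> saturateds N"
      using mt_hom_saturated[OF assms s] by (simp_all add: R_map_def)
    have "mt_comp M (FR_obj N) (eta N) f s = F_emb (R_obj N) (f s)"
      using fs(2) s by (simp add: mt_comp_saturated[OF assms(1,2) F(2) assms(3) eta(2)] eta_saturated assms(2))
    also have "\<dots> = FR_map M N f (eta M s)"
      using F_map_emb[OF R Rf, of s] s fs(1) by (simp add: carrier eta_saturated assms(1))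
    finally show "mt_comp M (FR_obj N) (eta N) f s = mt_comp M (FR_obj N) (FR_map M N f) (eta M) s"
      by (simp add: mt_comp_saturated[OF assms(1) F eta(1) Ff s])
  qed
qed

text \<open>
  Precomposition with an isomorphism is bijective.
\<close>

lemma eta_adjunction:
  assumes "mt_algebra M" "mt_algebra N"
  shows "bij_betw (\<lambda>g. mt_comp M N g (eta M)) (mt_hom (FR_obj M) N) (mt_hom M N)"
proof -
  note F = mt_F_obj[OF raney_R_obj[OF assms(1)]]
  obtain \<theta> where \<theta>: "\<theta> \<in> mt_hom (FR_obj M) M" "mt_comp M M \<theta> (eta M) = mt_id M"
    "mt_comp (FR_obj M) (FR_obj M) (eta M) \<theta> = mt_id (FR_obj M)"
    using eta_iso[OF assms(1)] by (auto simp: mt_iso_def)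
  note eta = eta_hom[OF assms(1)]
  show ?thesis
  proof (rule bij_betwI[where g = "\<lambda>f. mt_comp (FR_obj M) N f \<theta>"])
    show "(\<lambda>g. mt_comp M N g (eta M)) \<in> mt_hom (FR_obj M) N \<rightarrow> mt_hom M N"
      using mt_comp_hom(1)[OF assms(1) F assms(2) eta] by blast
    show "(\<lambda>f. mt_comp (FR_obj M) N f \<theta>) \<in> mt_hom M N \<rightarrow> mt_hom (FR_obj M) N"
      using mt_comp_hom(1)[OF F assms \<theta>(1)] by blast
    show "mt_comp (FR_obj M) N (mt_comp M N g (eta M)) \<theta> = g" if "g \<in> mt_hom (FR_obj M) N" for g
      by (simp add: mt_comp_assoc[OF F assms(1) F assms(2) \<theta>(1) eta that, symmetric] \<theta>(3)
          mt_comp_id(1)[OF F assms(2) that])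
    show "mt_comp M N (mt_comp (FR_obj M) N f \<theta>) (eta M) = f" if "f \<in> mt_hom M N" for f
      by (simp add: mt_comp_assoc[OF assms(1) F assms eta \<theta>(1) that, symmetric] \<theta>(2)
          mt_comp_id(1)[OF assms that])
  qed
qed

lemma eta_adjunction_natural_left:
  assumes "mt_algebra M" "mt_algebra M'" "mt_algebra N" "f \<in> mt_hom M' M" "g \<in> mt_hom (FR_obj M) N"
  shows "mt_comp M' N (mt_comp (FR_obj M') N g (FR_map M' M f)) (eta M')
    = mt_comp M' N (mt_comp M N g (eta M)) f"
proof -
  note R = raney_R_obj[OF assms(1)] raney_R_obj[OF assms(2)]
  note F = mt_F_obj[OF R(1)] mt_F_obj[OF R(2)]
  note Ff = F_map_hom[OF R(2,1) R_map_hom[OF assms(2,1,4)]]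
  show ?thesis
    by (simp add: mt_comp_assoc[OF assms(2) F(2,1) assms(3) eta_hom[OF assms(2)] Ff assms(5), symmetric]
        mt_comp_assoc[OF assms(2,1) F(1) assms(3,4) eta_hom[OF assms(1)] assms(5), symmetric]
        eta_natural[OF assms(2,1,4)])
qed

theorem theorem5p11:
  shows
    "\<comment> \<open>R is a functor from MT_R to RE; in particular so is its restriction to the full subcategory T0 MT_R\<close>
     (\<forall>M::'a mt. mt_algebra M \<longrightarrow>
        raney_extension (R_obj M) \<and> R_map M (mt_id M) = re_id (R_obj M)) \<and>
     (\<forall>(M::'a mt) (N::'b mt). \<forall>f\<in>mt_hom M N. mt_algebra M \<and> mt_algebra N \<longrightarrow>
        R_map M f \<in> re_hom (R_obj M) (R_obj N)) \<and>
     (\<forall>(M::'a mt) (N::'b mt) (P::'c mt). \<forall>f\<in>mt_hom M N. \<forall>g\<in>mt_hom N P.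
        mt_algebra M \<and> mt_algebra N \<and> mt_algebra P \<longrightarrow>
        R_map M (mt_comp M P g f) = re_comp (R_obj M) (R_map N g) (R_map M f)) \<and>

     \<comment> \<open>F is a functor from RE to T0 MT_R\<close>
     (\<forall>R::'a raney. raney_extension R \<longrightarrow>
        t0_algebra (F_obj R) \<and> F_map R R (re_id R) = mt_id (F_obj R)) \<and>
     (\<forall>(R1::'a raney) (R2::'b raney). \<forall>h\<in>re_hom R1 R2.
        raney_extension R1 \<and> raney_extension R2 \<longrightarrow>
        F_map R1 R2 h \<in> mt_hom (F_obj R1) (F_obj R2)) \<and>
     (\<forall>(R1::'a raney) (R2::'b raney) (R3::'c raney). \<forall>h\<in>re_hom R1 R2. \<forall>k\<in>re_hom R2 R3.
        raney_extension R1 \<and> raney_extension R2 \<and> raney_extension R3 \<longrightarrow>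
        F_map R1 R3 (re_comp R1 k h)
          = mt_comp (F_obj R1) (F_obj R3) (F_map R2 R3 k) (F_map R1 R2 h)) \<and>

     \<comment> \<open>eps is a natural isomorphism Id -> RF on RE\<close>
     (\<forall>R::'a raney. raney_extension R \<longrightarrow> re_iso R (RF_obj R) (eps R)) \<and>
     (\<forall>(R1::'a raney) (R2::'b raney). \<forall>h\<in>re_hom R1 R2.
        raney_extension R1 \<and> raney_extension R2 \<longrightarrow>
        re_comp R1 (eps R2) h = re_comp R1 (RF_map R1 R2 h) (eps R1)) \<and>

     \<comment> \<open>eta is a natural isomorphism Id -> FR on T0 MT_R, so that R and F are mutually quasi-inverse between T0 MT_R and RE\<close>
     (\<forall>M::'a mt. t0_algebra M \<longrightarrow> mt_iso M (FR_obj M) (eta M)) \<and>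
     (\<forall>(M::'a mt) (N::'b mt). \<forall>f\<in>mt_hom M N. t0_algebra M \<and> t0_algebra N \<longrightarrow>
        mt_comp M (FR_obj N) (eta N) f = mt_comp M (FR_obj N) (FR_map M N f) (eta M)) \<and>

     \<comment> \<open>and on all of MT_R, so that the functor FR from MT_R to T0 MT_R is an equivalence with the inclusion of T0 MT_R into MT_R as quasi-inverse\<close>
     (\<forall>M::'a mt. mt_algebra M \<longrightarrow> t0_algebra (FR_obj M) \<and> mt_iso M (FR_obj M) (eta M)) \<and>
     (\<forall>(M::'a mt) (N::'b mt). \<forall>f\<in>mt_hom M N. mt_algebra M \<and> mt_algebra N \<longrightarrow>
        mt_comp M (FR_obj N) (eta N) f = mt_comp M (FR_obj N) (FR_map M N f) (eta M)) \<and>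

     \<comment> \<open>FR is left adjoint to that inclusion, with unit eta: bijection of hom-sets, natural in both arguments\<close>
     (\<forall>(M::'a mt) (N::'b mt). mt_algebra M \<and> t0_algebra N \<longrightarrow>
        bij_betw (\<lambda>g. mt_comp M N g (eta M)) (mt_hom (FR_obj M) N) (mt_hom M N)) \<and>
     (\<forall>(M::'a mt) (M'::'c mt) (N::'b mt). \<forall>f\<in>mt_hom M' M. \<forall>g\<in>mt_hom (FR_obj M) N.
        mt_algebra M \<and> mt_algebra M' \<and> t0_algebra N \<longrightarrow>
        mt_comp M' N (mt_comp (FR_obj M') N g (FR_map M' M f)) (eta M')
          = mt_comp M' N (mt_comp M N g (eta M)) f) \<and>
     (\<forall>(M::'a mt) (N::'b mt) (N'::'c mt). \<forall>g\<in>mt_hom (FR_obj M) N. \<forall>k\<in>mt_hom N N'.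
        mt_algebra M \<and> t0_algebra N \<and> t0_algebra N' \<longrightarrow>
        mt_comp M N' (mt_comp (FR_obj M) N' k g) (eta M)
          = mt_comp M N' k (mt_comp M N g (eta M)))"
proof (intro conjI allI ballI impI, goal_cases)
  case (1 M)
  then show ?case by (rule raney_R_obj)
next
  case (2 M)
  then show ?case by (rule R_map_id)
next
  case (3 M N f)
  then show ?case by (intro R_map_hom) simp_all
next
  case (4 M N P f g)
  then show ?case by (intro R_map_comp) simp_all
next
  case (5 R)
  then show ?case by (rule t0_F_obj)
next
  case (6 R)
  then show ?case by (rule F_map_id)
next
  case (7 R1 R2 h)
  then show ?case by (intro F_map_hom) simp_all
next
  case (8 R1 R2 R3 h k)
  then show ?case by (intro F_map_comp[of R1 R2 R3]) simp_all
next
  case (9 R)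
  then show ?case by (intro raney_ext.eps_iso raney_ext.intro)
next
  case (10 R1 R2 h)
  then show ?case by (intro eps_natural) simp_all
next
  case (11 M)
  then show ?case by (intro eta_iso t0_mt)
next
  case (12 M N f)
  then show ?case by (intro eta_natural) (simp_all add: t0_mt)
next
  case (13 M)
  then show ?case by (intro t0_F_obj raney_R_obj)
next
  case (14 M)
  then show ?case by (rule eta_iso)
next
  case (15 M N f)
  then show ?case by (intro eta_natural) simp_all
next
  case (16 M N)
  then show ?case by (intro eta_adjunction) (simp_all add: t0_mt)
next
  case (17 M M' N f g)
  then show ?case by (intro eta_adjunction_natural_left) (simp_all add: t0_mt)
next
  case (18 M N N' g k)
  then have "mt_algebra M" "mt_algebra N" "mt_algebra N'" by (simp_all add: t0_mt)
  then show ?case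
    using mt_comp_assoc[of M "FR_obj M" N N' "eta M" g k] 18
    by (simp add: eta_hom mt_F_obj raney_R_obj)
qed

end
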